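(* Let $1\le m<N$ be integers and let $2-\frac{7}{10\min\{m,N-m\}}\le q\le 2$. Then the $\ell^q$ anisotropy $$\Psi_q(T):=\|\xi_T\|_{\ell^q}=\Bigl(\sum_{|I|=m}|(\xi_T)_I|^q\Bigr)^{1/q},\qquad T\in\mathbb{G}(N,m),$$ satisfies the uniform scalar atomic condition USAC on $\mathbb{G}(N,m)$.
   Context: $\mathbb{G}(N,m)$ is the Grassmannian of $m$-dimensional linear subspaces of $\mathbb{R}^N$, identified with orthogonal projections $\{T\in\mathbb{R}^{N\times N}:T=T^t,\ T^2=T,\ \operatorname{tr}T=m\}$; $T^\perp=I-T$. $\langle A,B\rangle=\operatorname{tr}(A^tB)$ and $\|\cdot\|$ is the Frobenius norm. For $T\in\mathbb{G}(N,m)$, $\xi_T\in\bigwedge^m\mathbb{R}^N$ is a Euclidean unit simple $m$-vector spanning $T$ (unique up to sign), and $(\xi_T)_I$, $I=\{i_1<\dots<i_m\}\subset\{1,\dots,N\}$, are its (Plücker) coordinates in the standard basis $e_{i_1}\wedge\cdots\wedge e_{i_m}$. For $\Psi\in C^1(\mathbb{G}(N,m),(0,\infty))$, extended to a $C^1$ function near $\mathbb{G}(N,m)$ in $\mathbb{R}^{N\times N}$, set $d\Psi(T):=D\Psi(T)+D\Psi(T)^t$ and $$B_\Psi(T)=\Psi(T)T+T^\perp\,d\Psi(T)\,T .$$ The dual integrand is $\Psi^*(P):=\Psi(P^\perp)$ for $P\in\mathbb{G}(N,N-m)$, with $B_{\Psi^*}(S^\perp)=\Psi(S)S^\perp-S\,d\Psi(S)\,S^\perp$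 for $S\in\mathbb{G}(N,m)$. USAC: there is $c_\Psi>0$ such that $\langle B_\Psi(T),B_{\Psi^*}(S^\perp)\rangle\ge c_\Psi\|T-S\|^2$ for all $S,T\in\mathbb{G}(N,m)$. *)

theory Defs
  imports "HOL-Analysis.Analysis"
begin

text \<open>
  The ambient space is \<open>real ^ 'n\<close>, so \<open>N = CARD('n)\<close>. The linear order on \<open>'n\<close> is used only to list
  the elements of an index set \<open>I\<close> increasingly. On \<open>real ^ 'n ^ 'n\<close> the library's inner product
  and norm are the Frobenius ones (see \<open>frobenius_inner\<close> below).
\<close>

definition Grass :: "nat \<Rightarrow> (real ^ 'n ^ 'n) set" where
  "Grass m = {T. transpose T = T \<and> T ** T = T \<and> trace T = real m}"

definition perp :: "real ^ 'n ^ 'n \<Rightarrow> real ^ 'n ^ 'n" where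
  "perp T = mat 1 - T"

definition C1_extension ::
  "nat \<Rightarrow> (real ^ 'n ^ 'n \<Rightarrow> real) \<Rightarrow> (real ^ 'n ^ 'n \<Rightarrow> real) \<Rightarrow> (real ^ 'n ^ 'n \<Rightarrow> real ^ 'n ^ 'n) \<Rightarrow> bool"
  where
  "C1_extension m \<Psi> F DF \<longleftrightarrow>
     (\<exists>U. open U \<and> Grass m \<subseteq> U \<and> (\<forall>T\<in>U. GDERIV F T :> DF T) \<and> continuous_on U DF) \<and>
     (\<forall>T\<in>Grass m. F T = \<Psi> T)"

definition C1_integrand :: "nat \<Rightarrow> (real ^ 'n ^ 'n \<Rightarrow> real) \<Rightarrow> bool" where
  "C1_integrand m \<Psi> \<longleftrightarrow> (\<forall>T\<in>Grass m. \<Psi> T > 0) \<and> (\<exists>F DF. C1_extension m \<Psi> F DF)"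

text \<open>
  \<open>grad_ext m \<Psi>\<close> is the gradient of an arbitrarily chosen \<open>C\<^sup>1\<close> extension. It depends on the choice, but
  \<open>B_mat\<close> does not: see \<open>B_mat_eq\<close>.
\<close>

definition grad_ext :: "nat \<Rightarrow> (real ^ 'n ^ 'n \<Rightarrow> real) \<Rightarrow> real ^ 'n ^ 'n \<Rightarrow> real ^ 'n ^ 'n" where
  "grad_ext m \<Psi> = (SOME DF. \<exists>F. C1_extension m \<Psi> F DF)"

definition d_int :: "nat \<Rightarrow> (real ^ 'n ^ 'n \<Rightarrow> real) \<Rightarrow> real ^ 'n ^ 'n \<Rightarrow> real ^ 'n ^ 'n" where
  "d_int m \<Psi> T = grad_ext m \<Psi> T + transpose (grad_ext m \<Psi> T)"

definition B_mat :: "nat \<Rightarrow> (real ^ 'n ^ 'n \<Rightarrow> real) \<Rightarrow> real ^ 'n ^ 'n \<Rightarrow> real ^ 'n ^ 'n" where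
  "B_mat m \<Psi> T = \<Psi> T *\<^sub>R T + perp T ** d_int m \<Psi> T ** T"

definition dual_int :: "(real ^ 'n ^ 'n \<Rightarrow> real) \<Rightarrow> real ^ 'n ^ 'n \<Rightarrow> real" where
  "dual_int \<Psi> P = \<Psi> (perp P)"

text \<open>
  The dual integrand lives on the Grassmannian of \<open>(N - m)\<close>-planes. The closed formula for its
  matrix at \<open>perp S\<close> is the lemma \<open>B_mat_dual_eq\<close>.
\<close>

definition USAC :: "nat \<Rightarrow> (real ^ 'n ^ 'n \<Rightarrow> real) \<Rightarrow> bool" where
  "USAC m \<Psi> \<longleftrightarrow> C1_integrand m \<Psi> \<and>
     (\<exists>c>0. \<forall>S\<in>Grass m. \<forall>T\<in>Grass m.
        B_mat m \<Psi> T \<bullet> B_mat (CARD('n) - m) (dual_int \<Psi>) (perp S) \<ge> c * (norm (T - S))\<^sup>2)"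

text \<open>
  An \<open>m\<close>-vector is represented by its coordinates with respect to the basis
  \<open>e\<^bsub>i_1\<^esub> \<and> \<dots> \<and> e\<^bsub>i_m\<^esub>\<close>, \<open>i_1 < \<dots> < i_m\<close>, indexed by the sets \<open>{i_1, \<dots>, i_m}\<close>. The coordinate of
  \<open>v 0 \<and> \<dots> \<and> v (m - 1)\<close> at \<open>I\<close> is the minor \<open>det (v j $ i_k)\<close>, written with the Leibniz formula
  because the size \<open>m\<close> is not a type.
\<close>

definition wedge :: "nat \<Rightarrow> (nat \<Rightarrow> real ^ 'n::{finite,linorder}) \<Rightarrow> 'n::{finite,linorder} set \<Rightarrow> real" where
  "wedge m v I =
     (if card I = m
      then \<Sum>p | p permutes {..<m}. of_int (sign p) * (\<Prod>j<m. v j $ (sorted_list_of_set I ! p j))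
      else 0)"

text \<open>\<open>\<xi>\<close> is a simple \<open>m\<close>-vector of Euclidean norm 1 spanning the plane of the projection \<open>T\<close>.\<close>

definition unit_simple_spanning ::
  "nat \<Rightarrow> real ^ 'n::{finite,linorder} ^ 'n::{finite,linorder} \<Rightarrow> ('n::{finite,linorder} set \<Rightarrow> real) \<Rightarrow> bool" where
  "unit_simple_spanning m T \<xi> \<longleftrightarrow>
     (\<exists>v. \<xi> = wedge m v \<and> span (v ` {..<m}) = range ((*v) T)) \<and>
     sqrt (\<Sum>I | card I = m. (\<xi> I)\<^sup>2) = 1"

text \<open>On \<open>Grass m\<close> such a \<open>\<xi>\<close> exists and is unique up to sign, so \<open>\<bar>xi m T I\<bar>\<close> is well defined.\<close>

definition xi :: "nat \<Rightarrow> real ^ 'n::{finite,linorder} ^ 'n::{finite,linorder} \<Rightarrow> 'n::{finite,linorder} set \<Rightarrow> real" where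
  "xi m T = (SOME \<xi>. unit_simple_spanning m T \<xi>)"

definition lq_anisotropy ::
  "nat \<Rightarrow> real \<Rightarrow> real ^ 'n::{finite,linorder} ^ 'n::{finite,linorder} \<Rightarrow> real" where
  "lq_anisotropy m q T = (\<Sum>I | card I = m. \<bar>xi m T I\<bar> powr q) powr (1 / q)"

lemma frobenius_inner:
  fixes A B :: "real ^ 'n ^ 'n"
  shows "A \<bullet> B = trace (transpose A ** B)"
  unfolding inner_vec_def trace_def matrix_matrix_mult_def transpose_def
  by simp (rule sum.swap)

definition outer :: "real ^ 'n \<Rightarrow> real ^ 'n \<Rightarrow> real ^ 'n ^ 'n" where
  "outer u w = (\<chi> i j. u $ i * w $ j)"

lemma outer_mult_vec: "outer u w *v x = (w \<bullet> x) *\<^sub>R u"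
  by (simp add: vec_eq_iff outer_def matrix_vector_mult_def inner_vec_def sum_distrib_left mult_ac)

lemma inner_outer: "A \<bullet> outer u w = u \<bullet> (A *v w)"
  by (simp add: outer_def matrix_vector_mult_def inner_vec_def sum_distrib_left mult_ac)

lemma transpose_outer: "transpose (outer u w) = outer w u"
  by (simp add: vec_eq_iff outer_def transpose_def mult.commute)

lemma transpose_diff: "transpose (A - B) = transpose A - transpose (B :: real ^ 'n ^ 'm)"
  by (simp add: vec_eq_iff transpose_def)

lemma transpose_add: "transpose (A + B) = transpose A + transpose (B :: real ^ 'n ^ 'm)"
  by (simp add: vec_eq_iff transpose_def)

lemma trace_outer: "trace (outer u w) = u \<bullet> w"
  by (simp add: trace_def outer_def inner_vec_def)

lemma matrix_vector_scaleR: "A *v (c *\<^sub>R x) = c *\<^sub>R (A *v (x :: real ^ 'n))"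
  by (simp add: linear_cmul)

lemma rotate_in_Grass:
  fixes T :: "real ^ 'n ^ 'n"
  assumes T: "T \<in> Grass m" and w: "T *v w = w" "norm w = 1" and u: "T *v u = 0" "norm u = 1"
    and cs: "c\<^sup>2 + s\<^sup>2 = 1"
  defines "x \<equiv> c *\<^sub>R w + s *\<^sub>R u"
  shows "T - outer w w + outer x x \<in> Grass m"
proof -
  have sym: "transpose T = T" and idem: "T ** T = T" and tr: "trace T = real m"
    using T by (auto simp: Grass_def)
  have Tsym: "a \<bullet> (T *v b) = (T *v a) \<bullet> b" for a b
    by (metis dot_lmul_matrix sym vector_transpose_matrix)
  have wu: "w \<bullet> u = 0" by (metis Tsym inner_zero_right u(1) w(1))
  have ww: "w \<bullet> w = 1" and uu: "u \<bullet> u = 1" using w u by (auto simp: dot_square_norm)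
  have xx: "x \<bullet> x = 1"
    using cs ww uu wu by (simp add: x_def inner_simps inner_commute power2_eq_square)
  have wx: "w \<bullet> x = c" by (simp add: x_def inner_simps ww wu)
  have Tx: "T *v x = c *\<^sub>R w"
    by (simp add: x_def matrix_vector_right_distrib matrix_vector_scaleR w u)
  let ?P = "T - outer w w + outer x x"
  have P: "?P *v y = T *v y - (w \<bullet> y) *\<^sub>R w + (x \<bullet> y) *\<^sub>R x" for y
    by (simp add: matrix_vector_mult_add_rdistrib matrix_vector_mult_diff_rdistrib outer_mult_vec)
  have TT: "T *v (T *v y) = T *v y" for y by (simp add: matrix_vector_mul_assoc idem)
  have "?P *v (?P *v y) = ?P *v y" for y
  proof -
    have xT: "x \<bullet> (T *v y) = c * (w \<bullet> y)" by (simp add: Tsym Tx)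
    have wT: "w \<bullet> (T *v y) = w \<bullet> y" by (simp add: Tsym w)
    show ?thesis
      unfolding P
      by (simp add: matrix_vector_right_distrib matrix_vector_mult_diff_distrib
          matrix_vector_scaleR TT Tx w inner_simps xT wT ww xx wx inner_commute[of x w] algebra_simps)
  qed
  then have "?P ** ?P = ?P"
    by (simp add: matrix_eq matrix_vector_mul_assoc[symmetric])
  moreover have "transpose ?P = ?P"
    by (simp add: transpose_add transpose_diff transpose_outer sym)
  moreover have "trace ?P = real m"
    by (simp add: trace_add trace_sub trace_outer tr ww xx)
  ultimately show ?thesis by (simp add: Grass_def)
qed

lemma gradient_tangential_unique_unit:
  fixes T :: "real ^ 'n ^ 'n"
  assumes T: "T \<in> Grass m" and F: "C1_extension m \<Psi> F D" and F': "C1_extension m \<Psi> F' D'"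
    and w: "T *v w = w" "norm w = 1" and u: "T *v u = 0" "norm u = 1"
  shows "D T \<bullet> (outer u w + outer w u) = D' T \<bullet> (outer u w + outer w u)"
proof -
  define X where "X = outer u w + outer w u"
  define \<gamma> where "\<gamma> = (\<lambda>t::real. T - outer w w + (cos t)\<^sup>2 *\<^sub>R outer w w + (sin t * cos t) *\<^sub>R X
    + (sin t)\<^sup>2 *\<^sub>R outer u u)"
  have \<gamma>: "\<gamma> t \<in> Grass m" for t
  proof -
    have "\<gamma> t = T - outer w w + outer (cos t *\<^sub>R w + sin t *\<^sub>R u) (cos t *\<^sub>R w + sin t *\<^sub>R u)"
      by (simp add: \<gamma>_def X_def vec_eq_iff outer_def algebra_simps power2_eq_square)
    then show ?thesis using rotate_in_Grass[OF T w u, of "cos t" "sin t"] by simp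
  qed
  have \<gamma>0: "\<gamma> 0 = T" by (simp add: \<gamma>_def)
  have \<gamma>': "(\<gamma> has_derivative (\<lambda>h. h *\<^sub>R X)) (at 0)"
    unfolding \<gamma>_def by (auto intro!: derivative_eq_intros)
  have comp: "((\<lambda>t. G (\<gamma> t)) has_derivative (\<lambda>h. (h *\<^sub>R X) \<bullet> E T)) (at 0)"
    if "C1_extension m \<Psi> G E" for G E
  proof -
    have "GDERIV G (\<gamma> 0) :> E T" using that T unfolding C1_extension_def \<gamma>0 by blast
    then show ?thesis
      unfolding gderiv_def by (rule has_derivative_compose[OF \<gamma>'])
  qed
  have "(\<lambda>t. F (\<gamma> t)) = (\<lambda>t. F' (\<gamma> t))"
    using F F' \<gamma> by (auto simp: C1_extension_def)
  with comp[OF F] comp[OF F'] have "(\<lambda>h::real. (h *\<^sub>R X) \<bullet> D T) = (\<lambda>h. (h *\<^sub>R X) \<bullet> D' T)"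
    by (metis has_derivative_unique)
  from fun_cong[OF this, of 1] show ?thesis by (simp add: X_def inner_commute)
qed

lemma gradient_normal_tangent_unique:
  fixes T :: "real ^ 'n ^ 'n"
  assumes T: "T \<in> Grass m" and F: "C1_extension m \<Psi> F D" and F': "C1_extension m \<Psi> F' D'"
  shows "perp T ** (D T + transpose (D T)) ** T = perp T ** (D' T + transpose (D' T)) ** T"
proof -
  have sym: "transpose T = T" and idem: "T ** T = T"
    using T by (auto simp: Grass_def)
  have Tsym: "a \<bullet> (T *v b) = (T *v a) \<bullet> b" for a b
    by (metis dot_lmul_matrix sym vector_transpose_matrix)
  have TT: "T *v (T *v y) = T *v y" for y by (simp add: matrix_vector_mul_assoc idem)
  have Q: "perp T *v y = y - T *v y" for y
    by (simp add: perp_def matrix_vector_mult_diff_rdistrib)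
  have psym: "a \<bullet> (perp T *v b) = (perp T *v a) \<bullet> b" for a b
    by (simp add: Q inner_simps Tsym)
  have lift: "u \<bullet> ((E + transpose E) *v w) = E \<bullet> (outer u w + outer w u)" for E :: "real ^ 'n ^ 'n" and u w
  proof -
    have "u \<bullet> (transpose E *v w) = w \<bullet> (E *v u)"
      by (metis dot_lmul_matrix inner_commute vector_transpose_matrix transpose_transpose)
    then show ?thesis
      by (simp add: matrix_vector_mult_add_rdistrib inner_add_right inner_outer)
  qed
  have key: "u \<bullet> ((D T + transpose (D T)) *v w) = u \<bullet> ((D' T + transpose (D' T)) *v w)"
    if w: "T *v w = w" and u: "T *v u = 0" for u w
  proof (cases "u = 0 \<or> w = 0")
    case True
    then show ?thesis by auto
  next
    case False
    have "T *v (w /\<^sub>R norm w) = w /\<^sub>R norm w" "T *v (u /\<^sub>R norm u) = 0"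
      by (simp_all add: matrix_vector_scaleR w u)
    then have "D T \<bullet> (outer (u /\<^sub>R norm u) (w /\<^sub>R norm w) + outer (w /\<^sub>R norm w) (u /\<^sub>R norm u))
        = D' T \<bullet> (outer (u /\<^sub>R norm u) (w /\<^sub>R norm w) + outer (w /\<^sub>R norm w) (u /\<^sub>R norm u))"
      using False by (intro gradient_tangential_unique_unit[OF T F F']) auto
    then show ?thesis
      unfolding lift[symmetric] using False by (simp add: matrix_vector_scaleR)
  qed
  have "a \<bullet> ((perp T ** (D T + transpose (D T)) ** T) *v b)
      = a \<bullet> ((perp T ** (D' T + transpose (D' T)) ** T) *v b)" for a b
  proof -
    have "T *v (T *v b) = T *v b" "T *v (perp T *v a) = 0"
      by (simp_all add: TT Q matrix_vector_mult_diff_distrib)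
    from key[OF this] show ?thesis
      by (simp add: matrix_vector_mul_assoc[symmetric] psym)
  qed
  then show ?thesis
    by (metis matrix_eq vector_eq_ldot)
qed

lemma B_mat_eq:
  fixes T :: "real ^ 'n ^ 'n"
  assumes T: "T \<in> Grass m" and F: "C1_extension m \<Psi> F D"
  shows "B_mat m \<Psi> T = \<Psi> T *\<^sub>R T + perp T ** (D T + transpose (D T)) ** T"
proof -
  have "\<exists>F. C1_extension m \<Psi> F (grad_ext m \<Psi>)"
    unfolding grad_ext_def using F by (intro someI_ex[of "\<lambda>DF. \<exists>F. C1_extension m \<Psi> F DF"]) blast
  then obtain F' where "C1_extension m \<Psi> F' (grad_ext m \<Psi>)" by blast
  from gradient_normal_tangent_unique[OF T this F] show ?thesis
    by (simp add: B_mat_def d_int_def)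
qed

lemma perp_perp [simp]: "perp (perp T) = T"
  by (simp add: perp_def)

lemma perp_in_Grass:
  fixes T :: "real ^ 'n ^ 'n"
  assumes "T \<in> Grass m" "m \<le> CARD('n)"
  shows "perp T \<in> Grass (CARD('n) - m)"
proof -
  have "T *v (T *v y) = T *v y" for y
    using assms(1) by (simp add: Grass_def matrix_vector_mul_assoc)
  then have "perp T ** perp T = perp T"
    by (simp add: matrix_eq perp_def matrix_vector_mul_assoc[symmetric]
        matrix_vector_mult_diff_rdistrib matrix_vector_mult_diff_distrib)
  then show ?thesis
    using assms by (simp add: Grass_def perp_def transpose_diff trace_sub trace_I of_nat_diff)
qed

lemma C1_extension_dual:
  fixes \<Psi> :: "real ^ 'n ^ 'n \<Rightarrow> real"
  assumes F: "C1_extension m \<Psi> F D" and m: "m \<le> CARD('n)"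
  shows "C1_extension (CARD('n) - m) (dual_int \<Psi>) (\<lambda>P. F (perp P)) (\<lambda>P. - D (perp P))"
proof -
  have mem: "perp P \<in> Grass m" if "P \<in> Grass (CARD('n) - m)" for P :: "real ^ 'n ^ 'n"
    using perp_in_Grass[OF that] m by simp
  from F obtain U where U: "open U" "Grass m \<subseteq> U" "\<And>T. T \<in> U \<Longrightarrow> GDERIV F T :> D T"
    "continuous_on U D" and eq: "\<And>T. T \<in> Grass m \<Longrightarrow> F T = \<Psi> T"
    by (auto simp: C1_extension_def)
  have cperp: "continuous_on A (perp :: real ^ 'n ^ 'n \<Rightarrow> _)" for A
    unfolding perp_def by (intro continuous_intros)
  have dperp: "(perp has_derivative (\<lambda>h. - h)) (at P)" for P :: "real ^ 'n ^ 'n"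
    unfolding perp_def by (auto intro!: derivative_eq_intros)
  let ?V = "perp -` U"
  have "open ?V" using cperp[of UNIV] U(1) by (simp add: continuous_on_open_vimage)
  moreover have "Grass (CARD('n) - m) \<subseteq> ?V" using mem U(2) by auto
  moreover have "GDERIV (\<lambda>P. F (perp P)) P :> - D (perp P)" if "P \<in> ?V" for P
  proof -
    have "(F has_derivative (\<lambda>h. h \<bullet> D (perp P))) (at (perp P))"
      using U(3)[of "perp P"] that by (simp add: gderiv_def)
    from has_derivative_compose[OF dperp this] show ?thesis by (simp add: gderiv_def)
  qed
  moreover have "continuous_on ?V (\<lambda>P. - D (perp P))"
    by (intro continuous_on_minus continuous_on_compose2[OF U(4) cperp]) auto
  ultimately show ?thesis
    unfolding C1_extension_def using eq mem by (auto simp: dual_int_def)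
qed

lemma matrix_mul_minus: "A ** (- B) ** C = - (A ** B ** C)" for A B C :: "real ^ 'n ^ 'n"
  by (simp add: vec_eq_iff matrix_matrix_mult_def sum_negf)

lemma B_mat_dual_eq:
  fixes S :: "real ^ 'n ^ 'n"
  assumes S: "S \<in> Grass m" and m: "m \<le> CARD('n)" and F: "C1_extension m \<Psi> F D"
  shows "B_mat (CARD('n) - m) (dual_int \<Psi>) (perp S)
    = \<Psi> S *\<^sub>R perp S - S ** (D S + transpose (D S)) ** perp S"
proof -
  have "- D S + transpose (- D S) = - (D S + transpose (D S))"
    by (simp add: vec_eq_iff transpose_def)
  then show ?thesis
    using B_mat_eq[OF perp_in_Grass[OF S m] C1_extension_dual[OF F m]]
    by (simp only: dual_int_def perp_perp matrix_mul_minus) simp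
qed

end

theory Submission
  imports Defs
begin

text \<open>
  Write \<open>q = 2 - e\<close>. For bases \<open>v\<close>, \<open>w\<close> of the planes \<open>T\<close>, \<open>S\<close> with Pluecker vectors \<open>\<alpha>\<close>, \<open>\<beta>\<close> one finds
  \<open>\<langle>B T, B\<^sup>* S\<^sup>\<bottom>\<rangle> = \<Psi> T * \<Psi> S * (m - \<Sum>i j. A i j * B j i)\<close>, where \<open>A i j\<close> is the pairing of the signed power
  \<open>phi e \<alpha>\<close> with the \<open>m\<close>-vector obtained from \<open>v\<close> by replacing \<open>v i\<close> with \<open>w j\<close>, divided by \<open>\<Sum>I. \<bar>\<alpha> I\<bar> powr q\<close>,
  and \<open>B j i\<close> is the same with the two planes exchanged. This number does not depend on the bases.

  A fixed point of Brouwer's theorem yields weights \<open>x\<close> on the coordinates that dominate the average of the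
  leverage scores of both planes after the planes are rescaled by a power of \<open>x\<close>. In the rescaled picture one
  takes principal bases, and \<open>phi e \<alpha>\<close> becomes a vector \<open>\<eta>\<close> that is close to a multiple of \<open>\<alpha>\<close>: Hadamard's
  inequality bounds \<open>\<eta> I / \<alpha> I\<close> from below and a moment estimate bounds it from above. Writing
  \<open>\<eta> / Z = \<alpha> + f\<close> with \<open>f\<close> orthogonal to \<open>\<alpha>\<close>, the deficit \<open>m - \<Sum>i j. A i j * B j i\<close> splits into a coercive term
  (a quantitative monotonicity of \<open>phi e\<close>), a nonnegative gap \<open>g\<close>, two terms linear in the deviations \<open>f\<close>, \<open>f'\<close> and one
  bilinear term. All error terms are absorbed when \<open>e * m \<le> 7 / 10\<close>. Since \<open>T\<close> and its orthogonal complement have the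
  same Pluecker coordinates up to sign and complementation of the index sets, \<open>m\<close> may be replaced by \<open>N - m\<close>.
\<close>

section \<open>Wedge products and Gram determinants\<close>

text \<open>The ratio \<open>phi e t / t\<close> is \<open>\<bar>t\<bar> powr (- e)\<close>,
  unbounded near zero, so \<open>phi e\<close> of a Pluecker vector need not be close to a multiple
  of that vector. Hadamard's inequality bounds the square of a coordinate by the product of the
  leverage scores over its index set. A compensating power of a product of weights of that size
  makes the ratio bounded below. Above it stays unbounded, but the squared coordinates form a
  probability distribution, under which powers of the ratio are controlled by an elementary
  symmetric sum of weights whose total is about \<open>m\<close>. The pairing mixes both planes, so
  both must be rescaled by the same weights, while the leverage scores are those of the rescaled
  planes; hence a fixed point. Sharing the weights costs a factor \<open>2\<close> per index, the
  origin of \<open>2 ^ m\<close> in \<open>eta_bounds\<close>. The weights are kept above a positive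
  number depending only on the dimension, so that undoing the rescaling costs a constant independent
  of the planes.\<close>

definition ldet :: "nat \<Rightarrow> (nat \<Rightarrow> nat \<Rightarrow> real) \<Rightarrow> real" where
  "ldet m A = (\<Sum>p | p permutes {..<m}. of_int (sign p) * (\<Prod>j<m. A j (p j)))"

lemma ldet_cong:
  "(\<And>j k. j < m \<Longrightarrow> k < m \<Longrightarrow> A j k = B j k) \<Longrightarrow> ldet m A = ldet m B"
  unfolding ldet_def
  by (intro sum.cong refl arg_cong2[where f="(*)"] prod.cong) (auto simp: permutes_in_image[where S="{..<m}", simplified])

lemma ldet_transpose: "ldet m (\<lambda>j k. A k j) = ldet m A"
proof -
  have "ldet m (\<lambda>j k. A k j) = (\<Sum>p | p permutes {..<m}. of_int (sign (inv p)) * (\<Prod>j<m. A (inv p j) j))"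
    unfolding ldet_def
    by (rule sum_permutations_inverse[of "\<lambda>p. of_int (sign p) * (\<Prod>j<m. A (p j) j)"])
  also have "\<dots> = ldet m A"
    unfolding ldet_def
  proof (intro sum.cong refl)
    fix p assume p: "p \<in> {p. p permutes {..<m}}"
    have "sign (inv p) = sign p"
      using p permutation_permutes[of p] by (intro sign_inverse) auto
    moreover have "(\<Prod>j<m. A (inv p j) j) = (\<Prod>j<m. A j (p j))"
      using prod.permutes_inv[of p "{..<m}" "\<lambda>a b. A b a"] p by simp
    ultimately show "of_int (sign (inv p)) * (\<Prod>j<m. A (inv p j) j) = of_int (sign p) * (\<Prod>j<m. A j (p j))"
      by simp
  qed
  finally show ?thesis .
qed

lemma ldet_permute_rows:
  assumes \<sigma>: "\<sigma> permutes {..<m}"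
  shows "ldet m (\<lambda>j. A (\<sigma> j)) = of_int (sign \<sigma>) * ldet m A"
proof -
  have perm: "permutation \<sigma>" using \<sigma> permutation_permutes[of \<sigma>] by auto
  have "ldet m (\<lambda>j. A (\<sigma> j))
      = (\<Sum>p | p permutes {..<m}. of_int (sign (p \<circ> \<sigma>)) * (\<Prod>j<m. A (\<sigma> j) ((p \<circ> \<sigma>) j)))"
    unfolding ldet_def
    by (rule sum_permutations_compose_right[OF \<sigma>, of "\<lambda>p. of_int (sign p) * (\<Prod>j<m. A (\<sigma> j) (p j))"])
  also have "\<dots> = (\<Sum>p | p permutes {..<m}. of_int (sign \<sigma>) * (of_int (sign p) * (\<Prod>j<m. A j (p j))))"
  proof (intro sum.cong refl)
    fix p assume p: "p \<in> {p. p permutes {..<m}}"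
    have "sign (p \<circ> \<sigma>) = sign p * sign \<sigma>"
      using p permutation_permutes[of p] perm by (intro sign_compose) auto
    moreover have "(\<Prod>j<m. A (\<sigma> j) ((p \<circ> \<sigma>) j)) = (\<Prod>j<m. A j (p j))"
      using prod.permute[OF \<sigma>, of "\<lambda>j. A j (p j)"] by (simp add: comp_def)
    ultimately show "of_int (sign (p \<circ> \<sigma>)) * (\<Prod>j<m. A (\<sigma> j) ((p \<circ> \<sigma>) j))
        = of_int (sign \<sigma>) * (of_int (sign p) * (\<Prod>j<m. A j (p j)))"
      by simp
  qed
  finally show ?thesis by (simp add: ldet_def sum_distrib_left)
qed

lemma ldet_identical_rows:
  assumes "i < m" "j < m" "i \<noteq> j" "A i = A j"
  shows "ldet m A = 0"
proof -
  have "(\<lambda>l. A (Transposition.transpose i j l)) = A"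
    using assms(4) by (auto simp: Transposition.transpose_def)
  moreover have "Transposition.transpose i j permutes {..<m}"
    using assms by (intro permutes_swap_id) auto
  ultimately show ?thesis
    using ldet_permute_rows[of "Transposition.transpose i j" m A] assms(3) by (simp add: sign_swap_id)
qed

lemma ldet_zero_row:
  assumes "i < m" "\<And>k. k < m \<Longrightarrow> A i k = 0"
  shows "ldet m A = 0"
  unfolding ldet_def
proof (intro sum.neutral ballI)
  fix p assume p: "p \<in> {p. p permutes {..<m}}"
  have "A i (p i) = 0" using assms p permutes_in_image[of p "{..<m}" i] by simp
  then have "(\<Prod>j<m. A j (p j)) = 0" using assms(1) by (intro prod_zero) auto
  then show "of_int (sign p) * (\<Prod>j<m. A j (p j)) = 0" by simp
qed

lemma ldet_zero_column:
  assumes "i < m" "\<And>j. j < m \<Longrightarrow> A j i = 0"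
  shows "ldet m A = 0"
  using ldet_zero_row[of i m "\<lambda>j k. A k j"] assms ldet_transpose[of m A] by simp

text \<open>A permutation other than \<open>id\<close> moves some \<open>j\<close> and then also
  \<open>p j\<close>, with different images. So at least one moved index is sent to a column other
  than \<open>i\<close>, where it contributes a zero factor.\<close>

lemma ldet_diag_except_column:
  assumes z: "\<And>j k. j < m \<Longrightarrow> k < m \<Longrightarrow> j \<noteq> k \<Longrightarrow> k \<noteq> i \<Longrightarrow> A j k = 0"
  shows "ldet m A = (\<Prod>j<m. A j j)"
proof -
  have "of_int (sign p) * (\<Prod>j<m. A j (p j)) = 0" if p: "p permutes {..<m}" and "p \<noteq> id" for p
  proof -
    obtain j where j: "p j \<noteq> j" using \<open>p \<noteq> id\<close> by (auto simp: fun_eq_iff)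
    have jm: "j < m" using p j by (metis lessThan_iff permutes_not_in)
    have pj: "p j < m" using p jm permutes_in_image[of p "{..<m}" j] by simp
    have "p (p j) \<noteq> p j" using p j by (metis permutes_inverses(2))
    then obtain l where l: "l < m" "p l \<noteq> l" "p l \<noteq> i"
      using j jm pj by metis
    have "p l < m" using p l permutes_in_image[of p "{..<m}" l] by simp
    then have "A l (p l) = 0" using z l by metis
    then have "(\<Prod>j<m. A j (p j)) = 0" using l(1) by (intro prod_zero) auto
    then show ?thesis by simp
  qed
  then have "ldet m A = (\<Sum>p\<in>{id}. of_int (sign p) * (\<Prod>j<m. A j (p j)))"
    unfolding ldet_def
    by (intro sum.mono_neutral_right finite_permutations) (auto simp: permutes_id)
  then show ?thesis by simp
qed

lemma ldet_diag:
  assumes "\<And>j k. j < m \<Longrightarrow> k < m \<Longrightarrow> j \<noteq> k \<Longrightarrow> A j k = 0"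
  shows "ldet m A = (\<Prod>j<m. A j j)"
  \<comment> \<open>The exceptional column is \<open>m\<close>, which lies outside the
    range.\<close>
  using ldet_diag_except_column[of m m A] assms by blast

section \<open>The Cauchy-Binet formula\<close>

lemma bij_betw_nth_sorted_list_of_set:
  assumes "finite I" "card I = m"
  shows "bij_betw ((!) (sorted_list_of_set I)) {..<m} I"
  using assms by (intro bij_betw_nth) auto

text \<open>An injective \<open>g\<close> is the same as its image \<open>I\<close> together with
  the permutation that turns the increasing enumeration of \<open>I\<close> into \<open>g\<close>.
  The reindexing serves both the Cauchy-Binet formula and the bound on elementary symmetric
  sums.\<close>

lemma sum_PiE_injective:
  fixes S :: "'a::linorder set"
  assumes S: "finite S"
    and h0: "\<And>g. g \<in> {..<m} \<rightarrow>\<^sub>E S \<Longrightarrow> \<not> inj_on g {..<m} \<Longrightarrow> h g = (0::real)"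
  shows "(\<Sum>g\<in>{..<m} \<rightarrow>\<^sub>E S. h g)
    = (\<Sum>I | I \<subseteq> S \<and> card I = m. \<Sum>p | p permutes {..<m}. h (\<lambda>j\<in>{..<m}. sorted_list_of_set I ! p j))"
proof -
  let ?P = "{p. p permutes {..<m}}" and ?\<I> = "{I. I \<subseteq> S \<and> card I = m}"
  let ?G = "{g \<in> {..<m} \<rightarrow>\<^sub>E S. inj_on g {..<m}}"
  let ?e = "\<lambda>I. (!) (sorted_list_of_set I)"
  let ?i = "\<lambda>(I, p). \<lambda>j\<in>{..<m}. ?e I (p j)"
  let ?q = "\<lambda>g l. if l < m then inv_into {..<m} (?e (g ` {..<m})) (g l) else l"
  have fin: "finite ({..<m} \<rightarrow>\<^sub>E S)" using S by (intro finite_PiE) auto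
  have "(\<Sum>g\<in>{..<m} \<rightarrow>\<^sub>E S. h g) = (\<Sum>g\<in>?G. h g)"
    using h0 by (intro sum.mono_neutral_right fin) auto
  also have "\<dots> = (\<Sum>(I, p)\<in>?\<I> \<times> ?P. h (\<lambda>j\<in>{..<m}. ?e I (p j)))"
  proof (rule sum.reindex_bij_witness[where i = ?i and j = "\<lambda>g. (g ` {..<m}, ?q g)"])
    fix g assume g: "g \<in> ?G"
    let ?I = "g ` {..<m}"
    have c: "card ?I = m" using g by (simp add: card_image)
    have b: "bij_betw (?e ?I) {..<m} ?I" using c by (intro bij_betw_nth_sorted_list_of_set) auto
    have bi: "bij_betw (inv_into {..<m} (?e ?I)) ?I {..<m}" by (rule bij_betw_inv_into[OF b])
    have bg: "bij_betw g {..<m} ?I" using g by (simp add: bij_betw_def)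
    have "bij_betw (inv_into {..<m} (?e ?I) \<circ> g) {..<m} {..<m}" by (rule bij_betw_trans[OF bg bi])
    then have "bij_betw (?q g) {..<m} {..<m}" by (rule bij_betw_cong[THEN iffD1, rotated]) auto
    then have "?q g permutes {..<m}" by (rule bij_imp_permutes) auto
    then show "(?I, ?q g) \<in> ?\<I> \<times> ?P" using g c by auto
    have "?e ?I (inv_into {..<m} (?e ?I) (g j)) = g j" if "j < m" for j
      using that by (intro bij_betw_inv_into_right[OF b]) auto
    then show *: "?i (?I, ?q g) = g"
      using g by (auto simp: fun_eq_iff PiE_iff extensional_def)
    show "(case (?I, ?q g) of (I, p) \<Rightarrow> h (\<lambda>j\<in>{..<m}. ?e I (p j))) = h g"
      using * by simp
  next
    fix x assume "x \<in> ?\<I> \<times> ?P"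
    then obtain I p where x: "x = (I, p)" and I: "I \<subseteq> S" "card I = m" and p: "p permutes {..<m}" by auto
    have fI: "finite I" using I S finite_subset by blast
    have b: "bij_betw (?e I) {..<m} I" using fI I by (intro bij_betw_nth_sorted_list_of_set) auto
    have bp: "bij_betw p {..<m} {..<m}" using p by (rule permutes_imp_bij)
    have b2: "bij_betw (?e I \<circ> p) {..<m} I" by (rule bij_betw_trans[OF bp b])
    then have b3: "bij_betw (\<lambda>j\<in>{..<m}. ?e I (p j)) {..<m} I"
      by (rule bij_betw_cong[THEN iffD1, rotated]) auto
    have im: "(\<lambda>j\<in>{..<m}. ?e I (p j)) ` {..<m} = I" using b3 by (rule bij_betw_imp_surj_on)
    have pm: "p l < m \<longleftrightarrow> l < m" for l using p permutes_in_image[of p "{..<m}" l] by simp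
    have "?q (\<lambda>j\<in>{..<m}. ?e I (p j)) l = p l" for l
    proof (cases "l < m")
      case True
      then show ?thesis using im bij_betw_inv_into_left[OF b, of "p l"] pm by simp
    next
      case False
      then show ?thesis using p by (simp add: permutes_not_in)
    qed
    then have Q: "?q (\<lambda>j\<in>{..<m}. ?e I (p j)) = p" by (rule ext)
    show "((?i x) ` {..<m}, ?q (?i x)) = x"
      unfolding x prod.case using im Q by (intro prod_eqI; simp only: fst_conv snd_conv)
    have "inj_on (\<lambda>j\<in>{..<m}. ?e I (p j)) {..<m}" using b3 by (rule bij_betw_imp_inj_on)
    moreover have "(\<lambda>j\<in>{..<m}. ?e I (p j)) \<in> {..<m} \<rightarrow>\<^sub>E S"
    proof (rule PiE_I)
      fix j assume "j \<in> {..<m}"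
      then have "(\<lambda>j\<in>{..<m}. ?e I (p j)) j \<in> I" using im by blast
      then show "(\<lambda>j\<in>{..<m}. ?e I (p j)) j \<in> S" using I by blast
    qed auto
    ultimately show "?i x \<in> ?G" using x by simp
  qed
  also have "\<dots> = (\<Sum>I\<in>?\<I>. \<Sum>p\<in>?P. h (\<lambda>j\<in>{..<m}. ?e I (p j)))"
    by (simp add: sum.cartesian_product)
  finally show ?thesis .
qed

lemma ldet_sum_rows:
  assumes S: "finite S"
  shows "ldet m (\<lambda>j k. \<Sum>l\<in>S. c j l * B l k)
    = (\<Sum>g\<in>{..<m} \<rightarrow>\<^sub>E S. (\<Prod>j<m. c j (g j)) * ldet m (\<lambda>j. B (g j)))"
proof -
  have "ldet m (\<lambda>j k. \<Sum>l\<in>S. c j l * B l k)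
      = (\<Sum>p | p permutes {..<m}. \<Sum>g\<in>{..<m} \<rightarrow>\<^sub>E S.
          of_int (sign p) * (\<Prod>j<m. c j (g j) * B (g j) (p j)))"
    unfolding ldet_def using S
    by (intro sum.cong refl) (simp add: prod_sum_PiE sum_distrib_left)
  also have "\<dots> = (\<Sum>g\<in>{..<m} \<rightarrow>\<^sub>E S. (\<Prod>j<m. c j (g j)) * ldet m (\<lambda>j. B (g j)))"
    unfolding ldet_def
    by (subst sum.swap) (simp add: prod.distrib sum_distrib_left mult_ac)
  finally show ?thesis .
qed

text \<open>Cauchy-Binet: in the multilinear expansion a selection with a repetition has two equal
  rows, and for each image \<open>I\<close> the sum over its orderings assembles the minor of
  \<open>c\<close>.\<close>

lemma ldet_sum_rows_injective:
  fixes S :: "'a::linorder set"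
  assumes S: "finite S"
  shows "ldet m (\<lambda>j k. \<Sum>l\<in>S. c j l * B l k)
    = (\<Sum>I | I \<subseteq> S \<and> card I = m. ldet m (\<lambda>j k. c j (sorted_list_of_set I ! k))
         * ldet m (\<lambda>j. B (sorted_list_of_set I ! j)))"
proof -
  have "(\<Prod>j<m. c j (g j)) * ldet m (\<lambda>j. B (g j)) = 0" if "\<not> inj_on g {..<m}" for g
  proof -
    from that obtain i j where "i < m" "j < m" "i \<noteq> j" "g i = g j" by (auto simp: inj_on_def)
    then have "ldet m (\<lambda>j. B (g j)) = 0" by (intro ldet_identical_rows[of i m j]) auto
    then show ?thesis by simp
  qed
  then have "ldet m (\<lambda>j k. \<Sum>l\<in>S. c j l * B l k)
    = (\<Sum>I | I \<subseteq> S \<and> card I = m. \<Sum>p | p permutes {..<m}.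
        (\<Prod>j<m. c j ((\<lambda>j\<in>{..<m}. sorted_list_of_set I ! p j) j))
        * ldet m (\<lambda>j. B ((\<lambda>j\<in>{..<m}. sorted_list_of_set I ! p j) j)))"
    unfolding ldet_sum_rows[OF S] by (intro sum_PiE_injective S) auto
  also have "\<dots> = (\<Sum>I | I \<subseteq> S \<and> card I = m. \<Sum>p | p permutes {..<m}.
        (\<Prod>j<m. c j (sorted_list_of_set I ! p j)) * (of_int (sign p) * ldet m (\<lambda>j. B (sorted_list_of_set I ! j))))"
  proof (intro sum.cong refl arg_cong2[where f="(*)"])
    fix I p assume p: "p \<in> {p. p permutes {..<m}}"
    have "ldet m (\<lambda>j. B ((\<lambda>j\<in>{..<m}. sorted_list_of_set I ! p j) j))
        = ldet m (\<lambda>j. B (sorted_list_of_set I ! p j))"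
      by (rule ldet_cong) auto
    then show "ldet m (\<lambda>j. B ((\<lambda>j\<in>{..<m}. sorted_list_of_set I ! p j) j))
        = of_int (sign p) * ldet m (\<lambda>j. B (sorted_list_of_set I ! j))"
      using ldet_permute_rows[of p m "\<lambda>j. B (sorted_list_of_set I ! j)"] p by simp
  qed auto
  also have "\<dots> = (\<Sum>I | I \<subseteq> S \<and> card I = m. ldet m (\<lambda>j k. c j (sorted_list_of_set I ! k))
         * ldet m (\<lambda>j. B (sorted_list_of_set I ! j)))"
    unfolding ldet_def[of m "\<lambda>j k. c j (sorted_list_of_set _ ! k)"] sum_distrib_right
    by (intro sum.cong refl) simp
  finally show ?thesis .
qed

lemma ldet_mult: "ldet m (\<lambda>j k. \<Sum>l<m. C j l * B l k) = ldet m C * ldet m B"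
proof -
  have "{I. I \<subseteq> {..<m} \<and> card I = m} = {{..<m}}"
    using card_subset_eq[of "{..<m}"] by auto
  moreover have "sorted_list_of_set {..<m} ! k = k" if "k < m" for k
    using that by (simp add: lessThan_atLeast0 del: upt_conv_Nil)
  then have "ldet m (\<lambda>j k. C j (sorted_list_of_set {..<m} ! k)) = ldet m C"
    "ldet m (\<lambda>j. B (sorted_list_of_set {..<m} ! j)) = ldet m B"
    by (auto intro!: ldet_cong)
  ultimately show ?thesis by (simp add: ldet_sum_rows_injective)
qed

text \<open>Indexed by all subsets, with zeros off size \<open>m\<close>, so that
  \<open>m\<close>-vectors live in a Euclidean space that is available as a type.\<close>

definition W :: "nat \<Rightarrow> (nat \<Rightarrow> real ^ 'n::{finite,linorder}) \<Rightarrow> real ^ 'n::{finite,linorder} set" where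
  "W m v = (\<chi> I. wedge m v I)"

lemma wedge_ldet: "card I = m \<Longrightarrow> wedge m v I = ldet m (\<lambda>j k. v j $ (sorted_list_of_set I ! k))"
  by (simp add: wedge_def ldet_def)

lemma wedge_0: "card I \<noteq> m \<Longrightarrow> wedge m v I = 0"
  by (simp add: wedge_def)

lemma wedge_cong: "(\<And>j. j < m \<Longrightarrow> v j = w j) \<Longrightarrow> wedge m v = wedge m w"
  by (auto simp: fun_eq_iff wedge_def)

lemma W_nth [simp]: "W m v $ I = wedge m v I"
  by (simp add: W_def)

lemma W_cong: "(\<And>j. j < m \<Longrightarrow> v j = w j) \<Longrightarrow> W m v = W m w"
  using wedge_cong[of m v w] by (simp add: W_def)

text \<open>Cauchy-Binet for the two coordinate matrices. It lets later pairings of wedges be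
  computed from inner products of vectors, without looking at coordinates.\<close>

lemma W_inner:
  fixes x y :: "nat \<Rightarrow> real ^ 'n::{finite,linorder}"
  shows "W m x \<bullet> W m y = ldet m (\<lambda>j k. x j \<bullet> y k)"
proof -
  have "W m x \<bullet> W m y = (\<Sum>I | card I = m. wedge m x I * wedge m y I)"
    by (auto simp: inner_vec_def intro!: sum.mono_neutral_right wedge_0)
  also have "\<dots> = (\<Sum>I | I \<subseteq> UNIV \<and> card I = m. ldet m (\<lambda>j k. x j $ (sorted_list_of_set I ! k))
         * ldet m (\<lambda>j k. y k $ (sorted_list_of_set I ! j)))"
  proof (intro sum.cong)
    fix I :: "'n set" assume "I \<in> {I. I \<subseteq> UNIV \<and> card I = m}"
    then show "wedge m x I * wedge m y I = ldet m (\<lambda>j k. x j $ (sorted_list_of_set I ! k))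
         * ldet m (\<lambda>j k. y k $ (sorted_list_of_set I ! j))"
      using ldet_transpose[of m "\<lambda>j k. y j $ (sorted_list_of_set I ! k)"]
      by (simp add: wedge_ldet)
  qed auto
  also have "\<dots> = ldet m (\<lambda>j k. \<Sum>i\<in>UNIV. x j $ i * y k $ i)"
    by (rule ldet_sum_rows_injective[symmetric, where B = "\<lambda>i k. y k $ i"]) simp
  finally show ?thesis by (simp add: inner_vec_def)
qed

lemma W_lincomb:
  assumes "\<And>j. j < m \<Longrightarrow> x j = (\<Sum>l<m. G j l *\<^sub>R v l)"
  shows "W m x = ldet m G *\<^sub>R W m v"
proof -
  have "wedge m x I = ldet m G * wedge m v I" for I
  proof (cases "card I = m")
    case True
    have "wedge m x I = ldet m (\<lambda>j k. \<Sum>l<m. G j l * (v l $ (sorted_list_of_set I ! k)))"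
      unfolding wedge_ldet[OF True] by (rule ldet_cong) (simp add: assms)
    then show ?thesis
      using True ldet_mult[of m G "\<lambda>l k. v l $ (sorted_list_of_set I ! k)"] by (simp add: wedge_ldet)
  qed (simp add: wedge_0)
  then show ?thesis by (simp add: vec_eq_iff)
qed

lemma prod_slot:
  fixes v :: "nat \<Rightarrow> real ^ 'n"
  assumes "i < m"
  shows "(\<Prod>j<m. (v(i := x)) j $ r j) = x $ r i * (\<Prod>j\<in>{..<m} - {i}. v j $ r j)"
  using assms by (subst prod.remove[of _ i]) auto

lemma wedge_slot:
  assumes "i < m" "card I = m"
  shows "wedge m (v(i := x)) I = (\<Sum>p | p permutes {..<m}. of_int (sign p) *
    (x $ (sorted_list_of_set I ! p i) * (\<Prod>j\<in>{..<m} - {i}. v j $ (sorted_list_of_set I ! p j))))"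
  unfolding wedge_def using assms(2) by (simp only: prod_slot[OF assms(1)] if_True simp_thms)

lemma linear_W_slot:
  assumes "i < m"
  shows "linear (\<lambda>x. W m (v(i := x)))"
proof (rule linearI)
  show "W m (v(i := x + y)) = W m (v(i := x)) + W m (v(i := y))" for x y
    unfolding vec_eq_iff
  proof
    fix I
    show "W m (v(i := x + y)) $ I = (W m (v(i := x)) + W m (v(i := y))) $ I"
      using assms by (cases "card I = m")
        (simp_all add: wedge_slot wedge_0 algebra_simps sum.distrib[symmetric])
  qed
  show "W m (v(i := c *\<^sub>R x)) = c *\<^sub>R W m (v(i := x))" for c x
    unfolding vec_eq_iff
  proof
    fix I
    show "W m (v(i := c *\<^sub>R x)) $ I = (c *\<^sub>R W m (v(i := x))) $ I"
      using assms by (cases "card I = m")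
        (simp_all add: wedge_slot wedge_0 algebra_simps sum_distrib_left)
  qed
qed

lemma W_identical:
  assumes "i < m" "j < m" "i \<noteq> j" "v i = v j"
  shows "W m v = 0"
proof -
  have "wedge m v I = 0" for I
  proof (cases "card I = m")
    case True
    show ?thesis
      unfolding wedge_ldet[OF True] using assms by (intro ldet_identical_rows[of i m j]) auto
  qed (simp add: wedge_0)
  then show ?thesis by (simp add: vec_eq_iff)
qed

lemma W_slot_other:
  assumes "i < m" "j < m" "i \<noteq> j"
  shows "W m (v(i := v j)) = 0"
  using W_identical[of i m j "v(i := v j)"] assms by simp

lemma has_derivative_wedge:
  fixes v :: "real \<Rightarrow> nat \<Rightarrow> real ^ 'n::{finite,linorder}"
  assumes "\<And>j. j < m \<Longrightarrow> ((\<lambda>t. v t j) has_vector_derivative v' j) (at t)"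
  shows "((\<lambda>t. wedge m (v t) I) has_real_derivative (\<Sum>i<m. wedge m ((v t)(i := v' i)) I)) (at t)"
proof (cases "card I = m")
  case True
  let ?e = "(!) (sorted_list_of_set I)"
  have d: "((\<lambda>t. v t j $ r) has_derivative (\<lambda>h. h * v' j $ r)) (at t)" if "j < m" for j r
    using bounded_linear.has_derivative[OF bounded_linear_vec_nth[of r] assms[OF that, unfolded has_vector_derivative_def]]
    by simp
  have "((\<lambda>t. \<Prod>j<m. v t j $ ?e (p j)) has_derivative
      (\<lambda>h. \<Sum>i<m. (h * v' i $ ?e (p i)) * (\<Prod>j\<in>{..<m} - {i}. v t j $ ?e (p j)))) (at t)" for p
    by (rule has_derivative_prod) (auto intro: d)
  then have "((\<lambda>t. \<Sum>p | p permutes {..<m}. of_int (sign p) * (\<Prod>j<m. v t j $ ?e (p j))) has_derivative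
      (\<lambda>h. \<Sum>p | p permutes {..<m}. of_int (sign p) *
        (\<Sum>i<m. (h * v' i $ ?e (p i)) * (\<Prod>j\<in>{..<m} - {i}. v t j $ ?e (p j))))) (at t)"
    by (intro has_derivative_sum has_derivative_mult_right)
  moreover have "(\<Sum>p | p permutes {..<m}. of_int (sign p) *
        (\<Sum>i<m. (h * v' i $ ?e (p i)) * (\<Prod>j\<in>{..<m} - {i}. v t j $ ?e (p j))))
     = (\<Sum>i<m. wedge m ((v t)(i := v' i)) I) * h" for h
  proof -
    have "(\<Sum>i<m. wedge m ((v t)(i := v' i)) I) = (\<Sum>i<m. \<Sum>p | p permutes {..<m}. of_int (sign p) *
      (v' i $ ?e (p i) * (\<Prod>j\<in>{..<m} - {i}. v t j $ ?e (p j))))"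
      using True by (intro sum.cong) (simp_all add: wedge_slot)
    then show ?thesis
      by (subst (asm) sum.swap) (simp add: sum_distrib_left sum_distrib_right mult_ac)
  qed
  ultimately show ?thesis
    using True by (simp add: has_field_derivative_def wedge_def)
qed (simp add: wedge_0)

section \<open>Leverage scores and Hadamard's inequality\<close>

definition orthonormal :: "nat \<Rightarrow> (nat \<Rightarrow> 'a::real_inner) \<Rightarrow> bool" where
  "orthonormal m v \<longleftrightarrow> (\<forall>i<m. \<forall>j<m. v i \<bullet> v j = (if i = j then 1 else 0))"

lemma norm_W_orthonormal:
  assumes "orthonormal m v"
  shows "W m v \<bullet> W m v = 1"
proof -
  have "W m v \<bullet> W m v = (\<Prod>j<m. v j \<bullet> v j)"
    unfolding W_inner using assms by (intro ldet_diag) (auto simp: orthonormal_def)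
  then show ?thesis using assms by (simp add: orthonormal_def)
qed

text \<open>The left side is the derivation on \<open>m\<close>-vectors induced by the orthogonal
  projection onto the \<open>i\<close>-th axis. It acts diagonally: each term of the Leibniz formula
  is kept only for the one slot that uses coordinate \<open>i\<close>, which exists exactly when
  \<open>i\<close> is in \<open>I\<close>.\<close>

lemma sum_wedge_coordinate_projection:
  assumes I: "card I = m"
  shows "(\<Sum>k<m. wedge m (v(k := axis i (v k $ i))) I) = (if i \<in> I then wedge m v I else 0)"
proof -
  let ?e = "(!) (sorted_list_of_set I)"
  have bij: "bij_betw ?e {..<m} I" using I by (intro bij_betw_nth_sorted_list_of_set) auto
  have "(\<Sum>k<m. wedge m (v(k := axis i (v k $ i))) I)
    = (\<Sum>k<m. \<Sum>p | p permutes {..<m}. of_int (sign p) * (\<Prod>j<m. v j $ ?e (p j)) * (if ?e (p k) = i then 1 else 0))"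
  proof (intro sum.cong refl)
    fix k assume k: "k \<in> {..<m}"
    have "(\<Prod>j<m. v j $ ?e (p j)) = v k $ ?e (p k) * (\<Prod>j\<in>{..<m} - {k}. v j $ ?e (p j))" for p
      using k by (subst prod.remove[of _ k]) auto
    then show "wedge m (v(k := axis i (v k $ i))) I
      = (\<Sum>p | p permutes {..<m}. of_int (sign p) * (\<Prod>j<m. v j $ ?e (p j)) * (if ?e (p k) = i then 1 else 0))"
      using k I by (simp add: wedge_slot axis_def) (intro sum.cong refl, auto)
  qed
  also have "\<dots> = (\<Sum>p | p permutes {..<m}. of_int (sign p) * (\<Prod>j<m. v j $ ?e (p j)) * (if i \<in> I then 1 else 0))"
  proof (subst sum.swap, unfold sum_distrib_left[symmetric], intro sum.cong refl arg_cong2[where f="(*)"])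
    fix p assume "p \<in> {p. p permutes {..<m}}"
    then have b: "bij_betw (\<lambda>k. ?e (p k)) {..<m} I"
      using bij_betw_trans[OF permutes_imp_bij bij] by (simp add: comp_def)
    show "(\<Sum>k<m. if ?e (p k) = i then 1 else 0) = (if i \<in> I then 1 else (0::real))"
      using sum.reindex_bij_betw[OF b, of "\<lambda>x. if x = i then 1 else (0::real)"] by simp
  qed
  also have "\<dots> = (if i \<in> I then wedge m v I else 0)"
    using I by (simp add: wedge_def)
  finally show ?thesis .
qed

text \<open>The squares \<open>(wedge m v I)\<^sup>2\<close> form a probability distribution on
  index sets, and the probability of containing \<open>i\<close> is the leverage score of
  \<open>i\<close>, a diagonal entry of the projection. Both sides equal the pairing of
  \<open>W m v\<close> with its image under the derivation of the preceding lemma.\<close>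

lemma sum_wedge_sq_containing:
  fixes v :: "nat \<Rightarrow> real ^ 'n::{finite,linorder}"
  assumes v: "orthonormal m v"
  shows "(\<Sum>I | i \<in> I. (wedge m v I)\<^sup>2) = (\<Sum>k<m. (v k $ i)\<^sup>2)"
proof -
  have "(\<Sum>k<m. W m v \<bullet> W m (v(k := axis i (v k $ i)))) = (\<Sum>I\<in>UNIV. wedge m v I * (\<Sum>k<m. wedge m (v(k := axis i (v k $ i))) I))"
    by (simp add: inner_vec_def sum_distrib_left) (rule sum.swap)
  also have "\<dots> = (\<Sum>I\<in>UNIV. if i \<in> I then (wedge m v I)\<^sup>2 else 0)"
  proof (intro sum.cong refl)
    fix I :: "'n set"
    show "wedge m v I * (\<Sum>k<m. wedge m (v(k := axis i (v k $ i))) I) = (if i \<in> I then (wedge m v I)\<^sup>2 else 0)"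
      by (cases "card I = m") (auto simp: sum_wedge_coordinate_projection wedge_0 power2_eq_square)
  qed
  also have "\<dots> = (\<Sum>I | i \<in> I. (wedge m v I)\<^sup>2)"
    by (simp add: sum.If_cases)
  finally have "(\<Sum>I | i \<in> I. (wedge m v I)\<^sup>2) = (\<Sum>k<m. W m v \<bullet> W m (v(k := axis i (v k $ i))))" by simp
  also have "\<dots> = (\<Sum>k<m. (v k $ i)\<^sup>2)"
  proof (intro sum.cong refl)
    fix k assume k: "k \<in> {..<m}"
    have "W m v \<bullet> W m (v(k := axis i (v k $ i))) = (\<Prod>j<m. v j \<bullet> (v(k := axis i (v k $ i))) j)"
      unfolding W_inner using v by (intro ldet_diag_except_column[of _ k]) (auto simp: orthonormal_def)
    also have "\<dots> = v k \<bullet> axis i (v k $ i)"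
      using k v by (subst prod.remove[of _ k]) (auto simp: orthonormal_def)
    finally show "W m v \<bullet> W m (v(k := axis i (v k $ i))) = (v k $ i)\<^sup>2"
      by (simp add: inner_axis power2_eq_square)
  qed
  finally show ?thesis .
qed

text \<open>Gram-Schmidt without normalisation: subtracting multiples of earlier vectors does not
  change the wedge and can only shorten the vector. A zero vector among the \<open>z l\<close> gets
  coefficient \<open>0\<close>, since division by zero gives \<open>0\<close>.\<close>

lemma W_orthogonalize:
  fixes y :: "nat \<Rightarrow> real ^ 'n::{finite,linorder}"
  assumes "r \<le> m"
  shows "\<exists>z. W m z = W m y \<and> (\<forall>i<r. \<forall>j<r. i \<noteq> j \<longrightarrow> z i \<bullet> z j = 0) \<and> (\<forall>i<m. norm (z i) \<le> norm (y i))"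
  using assms
proof (induction r)
  case 0
  then show ?case by (intro exI[of _ y]) auto
next
  case (Suc r)
  then obtain z where z: "W m z = W m y" "\<And>i j. i < r \<Longrightarrow> j < r \<Longrightarrow> i \<noteq> j \<Longrightarrow> z i \<bullet> z j = 0"
    "\<And>i. i < m \<Longrightarrow> norm (z i) \<le> norm (y i)" by auto
  define b where "b l = (z r \<bullet> z l) / (z l \<bullet> z l)" for l
  define u where "u = (\<Sum>l<r. b l *\<^sub>R z l)"
  define z' where "z' = z(r := z r - u)"
  have ul: "u \<bullet> z l = z r \<bullet> z l" if "l < r" for l
  proof -
    have "u \<bullet> z l = (\<Sum>k<r. if k = l then b l * (z l \<bullet> z l) else 0)"
      unfolding u_def inner_sum_left using that z(2) by (intro sum.cong) auto
    also have "\<dots> = z r \<bullet> z l" using that by (simp add: b_def)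
    finally show ?thesis .
  qed
  have uu: "u \<bullet> (z r - u) = 0"
  proof -
    have "(z r - u) \<bullet> u = (\<Sum>l<r. b l * ((z r - u) \<bullet> z l))"
      by (simp add: u_def inner_sum_right)
    also have "\<dots> = 0" by (simp add: inner_diff_left ul)
    finally show ?thesis by (simp add: inner_commute)
  qed
  interpret l: linear "\<lambda>x. W m (z(r := x))" using Suc by (intro linear_W_slot) auto
  have "W m z' = W m (z(r := z r)) - (\<Sum>l<r. b l *\<^sub>R W m (z(r := z l)))"
    unfolding z'_def by (simp only: l.diff u_def l.sum l.scale)
  also have "(\<Sum>l<r. b l *\<^sub>R W m (z(r := z l))) = 0"
    using Suc by (intro sum.neutral ballI) (simp add: W_slot_other)
  finally have "W m z' = W m y" using z by simp
  moreover have "z' i \<bullet> z' j = 0" if "i < Suc r" "j < Suc r" "i \<noteq> j" for i j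
    using that z(2) ul by (auto simp: z'_def less_Suc_eq inner_diff_left inner_diff_right inner_commute)
  moreover have "norm (z' i) \<le> norm (y i)" if "i < m" for i
  proof -
    have "z r \<bullet> z r = (z r - u) \<bullet> (z r - u) + u \<bullet> u"
      using uu by (simp add: algebra_simps inner_commute)
    then have "norm (z r - u) \<le> norm (z r)"
      by (simp add: norm_le)
    then show ?thesis using z(3)[OF that] by (auto simp: z'_def)
  qed
  ultimately show ?case by blast
qed

text \<open>Hadamard's inequality: an equality for orthogonal families, whose Gram matrix is
  diagonal, and orthogonalising only shortens the vectors.\<close>

lemma norm_W_le: "norm (W m y) \<le> (\<Prod>i<m. norm (y i))"
proof -
  obtain z where z: "W m z = W m y" "\<And>i j. i < m \<Longrightarrow> j < m \<Longrightarrow> i \<noteq> j \<Longrightarrow> z i \<bullet> z j = 0"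
    "\<And>i. i < m \<Longrightarrow> norm (z i) \<le> norm (y i)" using W_orthogonalize[of m m y] by auto
  have "(norm (W m z))\<^sup>2 = (\<Prod>i<m. z i \<bullet> z i)"
    unfolding power2_norm_eq_inner W_inner using z by (intro ldet_diag) auto
  also have "\<dots> = (\<Prod>i<m. norm (z i))\<^sup>2"
    by (simp add: power2_norm_eq_inner[symmetric] prod_power_distrib)
  finally have "norm (W m z) = (\<Prod>i<m. norm (z i))"
    by (simp add: prod_nonneg power2_eq_iff_nonneg)
  also have "\<dots> \<le> (\<Prod>i<m. norm (y i))" using z by (intro prod_mono) auto
  finally show ?thesis using z by simp
qed

text \<open>Hadamard's inequality for the projections \<open>y l\<close> onto the plane of the basis
  vectors listed in \<open>I\<close>. Their wedge is \<open>wedge m v I\<close> times the unit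
  vector \<open>W m v\<close>, and their squared lengths are leverage scores.\<close>

lemma wedge_sq_le_prod:
  fixes v :: "nat \<Rightarrow> real ^ 'n::{finite,linorder}"
  assumes v: "orthonormal m v" and I: "card I = m"
  shows "(wedge m v I)\<^sup>2 \<le> (\<Prod>i\<in>I. \<Sum>k<m. (v k $ i)\<^sup>2)"
proof -
  let ?e = "(!) (sorted_list_of_set I)"
  have bij: "bij_betw ?e {..<m} I" using I by (intro bij_betw_nth_sorted_list_of_set) auto
  define y where "y l = (\<Sum>k<m. (v k $ ?e l) *\<^sub>R v k)" for l
  have "W m y = ldet m (\<lambda>l k. v k $ ?e l) *\<^sub>R W m v"
    by (rule W_lincomb) (simp add: y_def)
  then have Wy: "W m y = wedge m v I *\<^sub>R W m v"
    using ldet_transpose[of m "\<lambda>l k. v k $ ?e l"] I by (simp add: wedge_ldet)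
  have "norm (W m v) = 1" using norm_W_orthonormal[OF v] by (simp add: norm_eq_1)
  then have "\<bar>wedge m v I\<bar> = norm (W m y)" by (simp add: Wy)
  also have "\<dots> \<le> (\<Prod>l<m. norm (y l))" by (rule norm_W_le)
  finally have "(wedge m v I)\<^sup>2 \<le> (\<Prod>l<m. norm (y l))\<^sup>2"
    by (metis abs_ge_zero power2_abs power_mono)
  also have "\<dots> = (\<Prod>l<m. y l \<bullet> y l)" by (simp add: prod_power_distrib power2_norm_eq_inner)
  also have "\<dots> = (\<Prod>l<m. \<Sum>k<m. (v k $ ?e l)\<^sup>2)"
  proof (intro prod.cong refl)
    fix l
    have "y l \<bullet> y l = (\<Sum>k<m. \<Sum>j<m. (v k $ ?e l) * (v j $ ?e l) * (v k \<bullet> v j))"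
      by (simp add: y_def inner_sum_left inner_sum_right sum_distrib_left inner_commute mult_ac)
    also have "\<dots> = (\<Sum>k<m. \<Sum>j<m. if k = j then (v k $ ?e l)\<^sup>2 else 0)"
      using v by (intro sum.cong) (auto simp: orthonormal_def power2_eq_square)
    finally show "y l \<bullet> y l = (\<Sum>k<m. (v k $ ?e l)\<^sup>2)" by simp
  qed
  also have "\<dots> = (\<Prod>i\<in>I. \<Sum>k<m. (v k $ i)\<^sup>2)"
    using prod.reindex_bij_betw[OF bij, of "\<lambda>i. \<Sum>k<m. (v k $ i)\<^sup>2"] by simp
  finally show ?thesis .
qed

section \<open>A lower bound for principal bases\<close>

lemma bessel_inequality:
  fixes z :: "'k \<Rightarrow> 'a::real_inner"
  assumes K: "finite K" and orth: "\<And>k l. k \<in> K \<Longrightarrow> l \<in> K \<Longrightarrow> k \<noteq> l \<Longrightarrow> z k \<bullet> z l = 0"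
  shows "(\<Sum>k\<in>K. (f \<bullet> z k)\<^sup>2 / (z k \<bullet> z k)) \<le> f \<bullet> f"
proof -
  define b where "b k = (f \<bullet> z k) / (z k \<bullet> z k)" for k
  define u where "u = (\<Sum>k\<in>K. b k *\<^sub>R z k)"
  have fu: "f \<bullet> u = (\<Sum>k\<in>K. (f \<bullet> z k)\<^sup>2 / (z k \<bullet> z k))"
    by (simp add: u_def b_def inner_sum_right power2_eq_square)
  have "u \<bullet> u = (\<Sum>k\<in>K. b k * (z k \<bullet> u))" by (simp add: u_def inner_sum_left)
  also have "\<dots> = (\<Sum>k\<in>K. (f \<bullet> z k)\<^sup>2 / (z k \<bullet> z k))"
  proof (intro sum.cong refl)
    fix k assume k: "k \<in> K"
    have "z k \<bullet> u = (\<Sum>l\<in>K. if l = k then b k * (z k \<bullet> z k) else 0)"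
      unfolding u_def inner_sum_right using orth[OF k] by (intro sum.cong) auto
    then have "z k \<bullet> u = b k * (z k \<bullet> z k)" using K k by simp
    then show "b k * (z k \<bullet> u) = (f \<bullet> z k)\<^sup>2 / (z k \<bullet> z k)"
      by (simp add: b_def power2_eq_square)
  qed
  finally have uu: "u \<bullet> u = (\<Sum>k\<in>K. (f \<bullet> z k)\<^sup>2 / (z k \<bullet> z k))" .
  have "0 \<le> (f - u) \<bullet> (f - u)" by simp
  also have "\<dots> = f \<bullet> f - 2 * (f \<bullet> u) + u \<bullet> u" by (simp add: algebra_simps inner_commute)
  finally show ?thesis using fu uu by simp
qed

text \<open>A rank-one form and a diagonal form, both positive semidefinite and at most
  \<open>X\<close> times the identity, have a difference with spectrum between \<open>- X\<close>
  and \<open>X\<close>. Polarisation turns this into a bilinear bound.\<close>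

lemma rank_one_minus_diagonal_bound:
  fixes w d y y' :: "'k \<Rightarrow> real"
  assumes K: "finite K" and w: "(\<Sum>k\<in>K. (w k)\<^sup>2) \<le> X" and d: "\<And>k. k \<in> K \<Longrightarrow> 0 \<le> d k \<and> d k \<le> X"
  shows "\<bar>(\<Sum>k\<in>K. w k * y k) * (\<Sum>k\<in>K. w k * y' k) - (\<Sum>k\<in>K. d k * (y k * y' k))\<bar>
    \<le> X / 2 * ((\<Sum>k\<in>K. (y k)\<^sup>2) + (\<Sum>k\<in>K. (y' k)\<^sup>2))"
proof -
  define Q where "Q z = (\<Sum>k\<in>K. w k * z k)\<^sup>2 - (\<Sum>k\<in>K. d k * (z k)\<^sup>2)" for z
  have Q: "\<bar>Q z\<bar> \<le> X * (\<Sum>k\<in>K. (z k)\<^sup>2)" for z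
  proof -
    have "(\<Sum>k\<in>K. w k * z k)\<^sup>2 \<le> (\<Sum>k\<in>K. (w k)\<^sup>2) * (\<Sum>k\<in>K. (z k)\<^sup>2)"
      by (rule Cauchy_Schwarz_ineq_sum)
    also have "\<dots> \<le> X * (\<Sum>k\<in>K. (z k)\<^sup>2)" using w by (intro mult_right_mono sum_nonneg) auto
    finally have 1: "(\<Sum>k\<in>K. w k * z k)\<^sup>2 \<le> X * (\<Sum>k\<in>K. (z k)\<^sup>2)" .
    have 2: "0 \<le> (\<Sum>k\<in>K. d k * (z k)\<^sup>2)" using d by (intro sum_nonneg) auto
    have "(\<Sum>k\<in>K. d k * (z k)\<^sup>2) \<le> (\<Sum>k\<in>K. X * (z k)\<^sup>2)" using d by (intro sum_mono mult_right_mono) auto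
    then have 3: "(\<Sum>k\<in>K. d k * (z k)\<^sup>2) \<le> X * (\<Sum>k\<in>K. (z k)\<^sup>2)" by (simp add: sum_distrib_left)
    have 4: "0 \<le> (\<Sum>k\<in>K. w k * z k)\<^sup>2" by simp
    show ?thesis unfolding Q_def abs_le_iff using 1 2 3 4 by linarith
  qed
  let ?M = "(\<Sum>k\<in>K. w k * y k) * (\<Sum>k\<in>K. w k * y' k) - (\<Sum>k\<in>K. d k * (y k * y' k))"
  have "Q (\<lambda>k. y k + y' k) - Q (\<lambda>k. y k - y' k) = 4 * ?M"
  proof -
    have a: "(\<Sum>k\<in>K. w k * (y k + y' k)) = (\<Sum>k\<in>K. w k * y k) + (\<Sum>k\<in>K. w k * y' k)"
      "(\<Sum>k\<in>K. w k * (y k - y' k)) = (\<Sum>k\<in>K. w k * y k) - (\<Sum>k\<in>K. w k * y' k)"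
      by (simp_all add: algebra_simps sum.distrib sum_subtractf)
    have "(\<Sum>k\<in>K. d k * (y k + y' k)\<^sup>2) - (\<Sum>k\<in>K. d k * (y k - y' k)\<^sup>2) = 4 * (\<Sum>k\<in>K. d k * (y k * y' k))"
      by (simp add: sum_subtractf[symmetric] sum_distrib_left power2_eq_square algebra_simps)
    moreover have "(A + B)\<^sup>2 - (A - B)\<^sup>2 = 4 * (A * B)" for A B :: real
      by (simp add: power2_eq_square algebra_simps)
    ultimately show ?thesis unfolding Q_def a by (simp add: algebra_simps)
  qed
  moreover have n: "(\<Sum>k\<in>K. (y k + y' k)\<^sup>2) + (\<Sum>k\<in>K. (y k - y' k)\<^sup>2)
      = 2 * ((\<Sum>k\<in>K. (y k)\<^sup>2) + (\<Sum>k\<in>K. (y' k)\<^sup>2))"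
    by (simp add: power2_sum power2_diff sum.distrib sum_subtractf)
  have "X * (\<Sum>k\<in>K. (y k + y' k)\<^sup>2) + X * (\<Sum>k\<in>K. (y k - y' k)\<^sup>2)
      = X * (2 * ((\<Sum>k\<in>K. (y k)\<^sup>2) + (\<Sum>k\<in>K. (y' k)\<^sup>2)))"
    unfolding n[symmetric] by (rule distrib_left[symmetric])
  ultimately have e: "Q (\<lambda>k. y k + y' k) - Q (\<lambda>k. y k - y' k) = 4 * ?M"
    "X * (\<Sum>k\<in>K. (y k + y' k)\<^sup>2) + X * (\<Sum>k\<in>K. (y k - y' k)\<^sup>2)
      = X * (2 * ((\<Sum>k\<in>K. (y k)\<^sup>2) + (\<Sum>k\<in>K. (y' k)\<^sup>2)))" by blast+
  have "\<bar>M\<bar> \<le> X / 2 * T" if "a - b = 4 * M" "p + r = X * (2 * T)" "\<bar>a\<bar> \<le> p" "\<bar>b\<bar> \<le> r"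
    for a b p r M T :: real
    using that by (simp add: abs_if split: if_splits)
  from this[OF e Q Q] show ?thesis .
qed

text \<open>One induction proves all bounds, since each step uses the others. The last one controls
  twice the second elementary symmetric sum by the gap \<open>\<sigma> - 1 + P\<close>.\<close>

lemma prod_one_minus_bounds:
  fixes x :: "'k \<Rightarrow> real"
  assumes "finite K" "\<And>k. k \<in> K \<Longrightarrow> 0 \<le> x k \<and> x k \<le> 1"
  defines "P \<equiv> \<Prod>k\<in>K. 1 - x k" and "\<sigma> \<equiv> \<Sum>k\<in>K. x k"
  shows "0 \<le> P" "P * (1 + \<sigma>) \<le> 1" "1 - \<sigma> \<le> P"
    "\<sigma>\<^sup>2 - (\<Sum>k\<in>K. (x k)\<^sup>2) \<le> (\<sigma> - 1 + P) * (2 + \<sigma>)"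
proof -
  have "0 \<le> P \<and> P * (1 + \<sigma>) \<le> 1 \<and> 1 - \<sigma> \<le> P \<and> 0 \<le> \<sigma> \<and>
    \<sigma>\<^sup>2 - (\<Sum>k\<in>K. (x k)\<^sup>2) \<le> (\<sigma> - 1 + P) * (2 + \<sigma>)"
    unfolding P_def \<sigma>_def using assms(1,2)
  proof (induction K rule: finite_induct)
    case empty
    then show ?case by simp
  next
    case (insert a K)
    define p s t where "p = (\<Prod>k\<in>K. 1 - x k)" and "s = (\<Sum>k\<in>K. x k)" and "t = (\<Sum>k\<in>K. (x k)\<^sup>2)"
    have xa: "0 \<le> x a" "x a \<le> 1" using insert by auto
    have IH: "0 \<le> p" "p * (1 + s) \<le> 1" "1 - s \<le> p" "0 \<le> s" "s\<^sup>2 - t \<le> (s - 1 + p) * (2 + s)"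
      using insert by (auto simp: p_def s_def t_def)
    have p1: "p \<le> 1" using IH(2) mult_nonneg_nonneg[OF IH(1,4)] unfolding distrib_left by linarith
    have e: "(\<Prod>k\<in>insert a K. 1 - x k) = (1 - x a) * p" "(\<Sum>k\<in>insert a K. x k) = x a + s"
      "(\<Sum>k\<in>insert a K. (x k)\<^sup>2) = (x a)\<^sup>2 + t"
      using insert by (simp_all add: p_def s_def t_def)
    have "p * (x a * (s + x a)) \<ge> 0" using IH xa by simp
    then have 1: "(1 - x a) * p * (1 + (x a + s)) \<le> 1"
      using IH(2) by (simp add: algebra_simps)
    have "x a * p \<le> x a" using xa p1 by (simp add: mult_left_le)
    then have 2: "1 - (x a + s) \<le> (1 - x a) * p" using IH(3) by (simp add: algebra_simps)
    have "x a * (1 - p * (1 + s)) \<ge> 0" "x a * (x a * (1 - p)) \<ge> 0" using xa IH p1 by simp_all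
    then have 3: "(x a + s)\<^sup>2 - ((x a)\<^sup>2 + t) \<le> (x a + s - 1 + (1 - x a) * p) * (2 + (x a + s))"
      using IH(5) by (simp add: algebra_simps power2_eq_square)
    show ?case unfolding e using 1 2 3 IH xa by simp
  qed
  then show "0 \<le> P" "P * (1 + \<sigma>) \<le> 1" "1 - \<sigma> \<le> P"
    "\<sigma>\<^sup>2 - (\<Sum>k\<in>K. (x k)\<^sup>2) \<le> (\<sigma> - 1 + P) * (2 + \<sigma>)"
    by auto
qed

text \<open>Principal vectors of two planes, \<open>c i\<close> being the cosines of the principal
  angles. Gram matrices of mixed families are then diagonal up to at most one row or column, so all
  pairings of wedges are products of cosines.\<close>

locale principal_bases =
  fixes m :: nat and v w :: "nat \<Rightarrow> real ^ 'n::{finite,linorder}" and c :: "nat \<Rightarrow> real"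
  assumes v: "orthonormal m v" and w: "orthonormal m w"
    and vw: "\<And>i j. i < m \<Longrightarrow> j < m \<Longrightarrow> v i \<bullet> w j = (if i = j then c i else 0)"
    and c_nonneg: "\<And>i. i < m \<Longrightarrow> 0 \<le> c i"
begin

lemma swap: "principal_bases m w v c"
  by unfold_locales (use v w c_nonneg in \<open>auto simp: vw inner_commute[of "w _"]\<close>)

lemma vv: "i < m \<Longrightarrow> j < m \<Longrightarrow> v i \<bullet> v j = (if i = j then 1 else 0)"
  and ww: "i < m \<Longrightarrow> j < m \<Longrightarrow> w i \<bullet> w j = (if i = j then 1 else 0)"
  and wv: "i < m \<Longrightarrow> j < m \<Longrightarrow> w i \<bullet> v j = (if i = j then c i else 0)"
  using v w vw[of j i] by (auto simp: orthonormal_def inner_commute)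

text \<open>\<open>x i\<close> is the squared sine of a principal angle, \<open>C\<close> the cosine
  of the angle between the two Pluecker vectors, \<open>X\<close> its squared sine, and
  \<open>g\<close> the excess of the sum of the \<open>x i\<close> over \<open>X\<close>.
  \<open>\<rho>2\<close> is the squared length of the part of the vector \<open>R\<close> below that
  is orthogonal to \<open>W m v\<close>.\<close>

definition "x i = 1 - (c i)\<^sup>2"
definition "C = (\<Prod>i<m. c i)"
definition "X = 1 - C\<^sup>2"
definition "\<sigma> = (\<Sum>i<m. x i)"
definition "g = \<sigma> - X"
definition "P i = (\<Prod>k\<in>{..<m} - {i}. c k)"
definition "\<rho>2 = X\<^sup>2 + 2 * g * X - g - (\<Sum>i<m. (x i)\<^sup>2)"

lemma c_le_1: "i < m \<Longrightarrow> c i \<le> 1"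
  using Cauchy_Schwarz_ineq[of "v i" "w i"] vv[of i i] ww[of i i] vw[of i i] c_nonneg[of i]
  by (simp add: abs_square_le_1)

lemma x_bounds: "i < m \<Longrightarrow> 0 \<le> x i \<and> x i \<le> 1"
  using c_le_1[of i] c_nonneg[of i] by (simp add: x_def abs_square_le_1)

lemma C_P: "i < m \<Longrightarrow> C = c i * P i"
  by (simp add: C_def P_def prod.remove)

lemma P_bounds: "i < m \<Longrightarrow> 0 \<le> P i \<and> P i \<le> 1"
  unfolding P_def using c_nonneg c_le_1 by (auto intro: prod_nonneg prod_le_1)

lemma C_bounds: "0 \<le> C" "C \<le> 1"
  unfolding C_def using c_nonneg c_le_1 by (auto intro: prod_nonneg prod_le_1)

lemma X_bounds: "0 \<le> X" "X \<le> 1"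
  using C_bounds by (simp_all add: X_def abs_square_le_1)

lemma x_le_X:
  assumes "i < m"
  shows "x i \<le> X"
proof -
  have "C \<le> c i" using C_P[OF assms] P_bounds[OF assms] c_nonneg[OF assms] by (simp add: mult_left_le)
  then have "C\<^sup>2 \<le> (c i)\<^sup>2" using C_bounds by (simp add: power_mono)
  then show ?thesis by (simp add: x_def X_def)
qed

lemma X_prod: "1 - X = (\<Prod>i<m. 1 - x i)"
  by (simp add: X_def x_def C_def prod_power_distrib)

lemma g_nonneg: "0 \<le> g"
  using prod_one_minus_bounds(3)[of "{..<m}" x] x_bounds by (simp add: g_def \<sigma>_def X_prod[symmetric])

lemma rho2_le1: "\<rho>2 \<le> X\<^sup>2 + 2 * g * X - g"
  by (simp add: \<rho>2_def sum_nonneg)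

text \<open>This bound vanishes with the gap, the preceding one does not; in the sum of the two the
  isolated \<open>g\<close> cancels.\<close>

lemma rho2_le2: "\<rho>2 \<le> g * (1 + X)"
proof -
  have "\<sigma>\<^sup>2 - (\<Sum>i<m. (x i)\<^sup>2) \<le> (\<sigma> - 1 + (1 - X)) * (2 + \<sigma>)"
    using prod_one_minus_bounds(4)[of "{..<m}" x] x_bounds by (simp add: \<sigma>_def X_prod)
  moreover have "\<sigma> = X + g" by (simp add: g_def)
  ultimately show ?thesis
    by (simp add: \<rho>2_def power2_eq_square algebra_simps)
qed

text \<open>With two angles \<open>g = x 0 * x 1\<close> and \<open>X + g = x 0 + x 1\<close>, so
  everything is explicit.\<close>

lemma rho2_le_plane:
  assumes "m = 2"
  shows "\<rho>2 \<le> ((X + g) / 2)\<^sup>2"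
proof -
  have e: "{..<m} = {0, 1}" using assms by auto
  have g: "g = x 0 * x 1"
    using X_prod by (simp add: g_def \<sigma>_def e algebra_simps)
  have s: "X = x 0 + x 1 - x 0 * x 1" using g by (simp add: g_def \<sigma>_def e)
  have "0 \<le> (x 0 - x 1)\<^sup>2" "0 \<le> (x 0 * x 1)\<^sup>2" by simp_all
  then show ?thesis
    unfolding \<rho>2_def s g e by (simp add: field_simps power2_eq_square)
qed

lemma W_vv: "W m v \<bullet> W m v = 1" and W_ww: "W m w \<bullet> W m w = 1"
  using norm_W_orthonormal v w by auto

lemma W_vw: "W m v \<bullet> W m w = C"
  unfolding W_inner C_def using vw by (subst ldet_diag) auto

lemma W_v_slot:
  assumes "i < m" "j < m"
  shows "W m v \<bullet> W m (v(i := w j)) = (if i = j then c i else 0)"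
proof -
  have "W m v \<bullet> W m (v(i := w j)) = (\<Prod>k<m. v k \<bullet> (v(i := w j)) k)"
    unfolding W_inner using assms by (intro ldet_diag_except_column[of _ i]) (auto simp: vv)
  also have "\<dots> = v i \<bullet> w j" using assms by (subst prod.remove[of _ i]) (auto simp: vv)
  finally show ?thesis using assms by (simp add: vw)
qed

lemma W_w_slot:
  assumes "i < m"
  shows "W m w \<bullet> W m (v(i := w i)) = P i"
proof -
  have "W m w \<bullet> W m (v(i := w i)) = (\<Prod>k<m. w k \<bullet> (v(i := w i)) k)"
    unfolding W_inner using assms by (intro ldet_diag) (auto simp: wv ww)
  also have "\<dots> = P i" using assms by (subst prod.remove[of _ i]) (auto simp: ww wv P_def)
  finally show ?thesis .
qed

lemma W_slot_slot:
  assumes "i < m" "j < m"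
  shows "W m (v(i := w i)) \<bullet> W m (v(j := w j)) = (if i = j then 1 else c i * c j)"
proof -
  have "W m (v(i := w i)) \<bullet> W m (v(j := w j)) = (\<Prod>k<m. (v(i := w i)) k \<bullet> (v(j := w j)) k)"
    unfolding W_inner using assms by (intro ldet_diag) (auto simp: wv ww vw vv)
  also have "\<dots> = (if i = j then 1 else c i * c j)"
  proof (cases "i = j")
    case True
    then show ?thesis by (auto simp: ww vv intro!: prod.neutral)
  next
    case False
    have "(\<Prod>k<m. (v(i := w i)) k \<bullet> (v(j := w j)) k) = w i \<bullet> v i * (v j \<bullet> w j * 1)"
      using assms False
      by (subst prod.remove[of _ i], simp, simp, subst prod.remove[of _ j]) (auto simp: vv intro!: prod.neutral)
    then show ?thesis using assms False by (simp add: vw wv)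
  qed
  finally show ?thesis .
qed

text \<open>Pairing \<open>f\<close> with \<open>R\<close> collects the terms of the deficit that
  are linear in the deviation \<open>f\<close>: the first comes from the pairing with the other
  Pluecker vector, the second from the replacements of \<open>v i\<close> by
  \<open>w i\<close>.\<close>

definition "R = C *\<^sub>R W m w - (\<Sum>i<m. c i *\<^sub>R W m (v(i := w i)))"

text \<open>Since \<open>f\<close> is orthogonal to \<open>W m v\<close>, only the part
  \<open>S\<close> of \<open>R\<close> orthogonal to \<open>W m v\<close> counts. Its squared length
  follows from the Gram determinants.\<close>

lemma R_bound:
  assumes f: "f \<bullet> W m v = 0"
  shows "0 \<le> \<rho>2" "\<bar>f \<bullet> R\<bar> \<le> norm f * sqrt \<rho>2"
proof -
  define u where "u = (\<Sum>i<m. (c i)\<^sup>2)"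
  define q where "q = (\<Sum>i<m. (c i)^4)"
  have "W m v \<bullet> R = C\<^sup>2 - u"
    by (simp add: R_def inner_diff_right inner_sum_right W_vw W_v_slot power2_eq_square u_def)
  then have Rv: "R \<bullet> W m v = C\<^sup>2 - u" by (simp add: inner_commute)
  have "W m w \<bullet> (\<Sum>i<m. c i *\<^sub>R W m (v(i := w i))) = (\<Sum>i<m. C)"
    unfolding inner_sum_right by (intro sum.cong) (simp_all add: W_w_slot C_P)
  then have cr: "(\<Sum>i<m. c i *\<^sub>R W m (v(i := w i))) \<bullet> W m w = m * C"
    by (simp add: inner_commute)
  have "(\<Sum>i<m. c i *\<^sub>R W m (v(i := w i))) \<bullet> (\<Sum>i<m. c i *\<^sub>R W m (v(i := w i)))
      = (\<Sum>i<m. \<Sum>j<m. c i * c j * (if i = j then 1 else c i * c j))"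
    by (subst inner_sum_left, intro sum.cong refl, subst inner_sum_right, intro sum.cong refl)
      (auto simp: W_slot_slot)
  also have "\<dots> = (\<Sum>i<m. \<Sum>j<m. (c i)\<^sup>2 * (c j)\<^sup>2 + (if i = j then (c i)\<^sup>2 - (c i)^4 else 0))"
    by (intro sum.cong refl) (auto simp: power2_eq_square power4_eq_xxxx)
  also have "\<dots> = u\<^sup>2 + u - q"
    by (simp add: sum.distrib sum_distrib_left[symmetric] sum_distrib_right[symmetric] u_def q_def sum_subtractf power2_eq_square)
  finally have ss: "(\<Sum>i<m. c i *\<^sub>R W m (v(i := w i))) \<bullet> (\<Sum>i<m. c i *\<^sub>R W m (v(i := w i))) = u\<^sup>2 + u - q" .
  have RR: "R \<bullet> R = C\<^sup>2 - 2 * m * C\<^sup>2 + u\<^sup>2 + u - q"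
    unfolding R_def inner_diff_left inner_diff_right inner_scaleR_left inner_scaleR_right ss
      inner_commute[of "W m w" "\<Sum>i<m. c i *\<^sub>R W m (v(i := w i))"] cr W_ww by (simp add: power2_eq_square algebra_simps)
  have s: "\<sigma> = m - u" "(\<Sum>i<m. (x i)\<^sup>2) = m - 2 * u + q"
    by (simp_all add: \<sigma>_def x_def u_def q_def sum_subtractf sum.distrib sum_distrib_left
        power2_diff power_mult[symmetric])
  define S where "S = R - (R \<bullet> W m v) *\<^sub>R W m v"
  have SS: "S \<bullet> S = \<rho>2"
  proof -
    have "S \<bullet> S = R \<bullet> R - (R \<bullet> W m v)\<^sup>2"
      by (simp add: S_def algebra_simps inner_commute[of "W m v" R] W_vv power2_eq_square)
    also have "\<dots> = \<rho>2"
      unfolding RR Rv \<rho>2_def g_def X_def s by (simp add: power2_eq_square algebra_simps)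
    finally show ?thesis .
  qed
  then show "0 \<le> \<rho>2" by (metis inner_ge_zero)
  have "f \<bullet> R = f \<bullet> S" using f by (simp add: S_def inner_diff_right)
  then show "\<bar>f \<bullet> R\<bar> \<le> norm f * sqrt \<rho>2"
    using Cauchy_Schwarz_ineq2[of f S] SS by (simp add: norm_eq_sqrt_inner)
qed

text \<open>The part of \<open>w j\<close> orthogonal to the whole plane of \<open>v\<close>,
  because \<open>w j\<close> is already orthogonal to the other \<open>v i\<close>.\<close>

definition "y j = w j - c j *\<^sub>R v j"

lemma vy: "i < m \<Longrightarrow> j < m \<Longrightarrow> v i \<bullet> y j = 0"
  by (simp add: y_def inner_diff_right vv vw)

lemma wy: "i < m \<Longrightarrow> j < m \<Longrightarrow> w i \<bullet> y j = (if i = j then x i else 0)"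
  by (simp add: y_def inner_diff_right ww wv x_def power2_eq_square)

lemma yy: "i < m \<Longrightarrow> j < m \<Longrightarrow> y i \<bullet> y j = (if i = j then x i else 0)"
  using vy[of i j] wy[of i j] by (subst y_def) (simp add: inner_diff_left)

definition "z i j = W m (v(i := y j))"

lemma zz:
  assumes "i < m" "j < m" "k < m" "l < m"
  shows "z i j \<bullet> z k l = (if i = k \<and> j = l then x j else 0)"
proof (cases "i = k")
  case True
  have "z i j \<bullet> z k l = (\<Prod>a<m. (v(i := y j)) a \<bullet> (v(k := y l)) a)"
    unfolding z_def W_inner using assms True vy
    by (intro ldet_diag_except_column[of _ k]) (auto simp: vv inner_commute[of "y _"])
  also have "\<dots> = y j \<bullet> y l"
    using assms True by (subst prod.remove[of _ k]) (auto simp: vv)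
  finally show ?thesis using True assms by (auto simp: yy)
next
  case False
  then have "z i j \<bullet> z k l = 0"
    unfolding z_def W_inner using assms vy by (intro ldet_zero_row[of k]) (auto simp: vv)
  then show ?thesis using False by simp
qed

lemma vz: "i < m \<Longrightarrow> j < m \<Longrightarrow> W m v \<bullet> z i j = 0"
  unfolding z_def W_inner using vy by (intro ldet_zero_column[of i]) auto

lemma wz:
  assumes "i < m" "j < m"
  shows "W m w \<bullet> z i j = (if i = j then x i * P i else 0)"
proof (cases "i = j")
  case True
  have "W m w \<bullet> z i j = (\<Prod>k<m. w k \<bullet> (v(i := y j)) k)"
    unfolding z_def W_inner using assms True by (intro ldet_diag) (auto simp: wy wv)
  also have "\<dots> = x i * P i"
    using assms True by (subst prod.remove[of _ i]) (auto simp: wy wv P_def)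
  finally show ?thesis using True by simp
next
  case False
  then have "W m w \<bullet> z i j = 0"
    unfolding z_def W_inner using assms by (intro ldet_zero_row[of i]) (auto simp: wy wv)
  then show ?thesis using False by simp
qed

text \<open>\<open>W m w\<close> is \<open>C\<close> times \<open>W m v\<close>, plus multiples of
  the diagonal \<open>z i i\<close>, plus a remainder \<open>r\<close> orthogonal to all
  \<open>z i j\<close>. The numbers \<open>F i j\<close> and \<open>t\<close> are the coordinates of
  \<open>f\<close> along the normalised \<open>z i j\<close> and \<open>r\<close>, whose squares
  Bessel's inequality controls.\<close>

lemma slot_coordinates:
  assumes f: "f \<bullet> W m v = 0"
  shows "(\<Sum>i<m. (P i)\<^sup>2 * x i) \<le> X"
    and "\<exists>F t. (\<forall>i<m. \<forall>j<m. f \<bullet> W m (v(i := w j)) = sqrt (x j) * F i j) \<and>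
      f \<bullet> W m w = (\<Sum>i<m. P i * sqrt (x i) * F i i) + sqrt (X - (\<Sum>i<m. (P i)\<^sup>2 * x i)) * t \<and>
      (\<Sum>i<m. \<Sum>j<m. (F i j)\<^sup>2) + t\<^sup>2 \<le> f \<bullet> f"
proof -
  have H: "f \<bullet> W m (v(i := w j)) = f \<bullet> z i j" if ij: "i < m" "j < m" for i j
  proof -
    interpret l: linear "\<lambda>x. W m (v(i := x))" using ij by (intro linear_W_slot)
    have "z i j = W m (v(i := w j)) - c j *\<^sub>R W m (v(i := v j))"
      by (simp add: z_def y_def l.diff l.scale)
    moreover have "f \<bullet> W m (v(i := v j)) = 0"
      using f ij W_slot_other[of i m j v] by (cases "i = j") auto
    ultimately show ?thesis by (simp add: inner_diff_right)
  qed
  define r where "r = W m w - C *\<^sub>R W m v - (\<Sum>i<m. P i *\<^sub>R z i i)"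
  have rz: "r \<bullet> z i j = 0" if "i < m" "j < m" for i j
  proof -
    have "(\<Sum>k<m. P k *\<^sub>R z k k) \<bullet> z i j = (\<Sum>k<m. if k = i then (if i = j then P i * x j else 0) else 0)"
      unfolding inner_sum_left using that by (intro sum.cong) (auto simp: zz)
    then show ?thesis using that by (simp add: r_def inner_diff_left wz vz mult.commute)
  qed
  have rr: "r \<bullet> r = X - (\<Sum>i<m. (P i)\<^sup>2 * x i)"
  proof -
    have "r \<bullet> r = r \<bullet> (W m w - C *\<^sub>R W m v)"
      by (subst (2) r_def) (simp add: inner_diff_right inner_sum_right rz)
    also have "\<dots> = (W m w - C *\<^sub>R W m v) \<bullet> (W m w - C *\<^sub>R W m v)
        - (\<Sum>i<m. P i * (z i i \<bullet> (W m w - C *\<^sub>R W m v)))"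
      by (simp add: r_def inner_diff_left inner_sum_left)
    also have "(W m w - C *\<^sub>R W m v) \<bullet> (W m w - C *\<^sub>R W m v) = X"
      using W_vw by (simp add: inner_diff_left inner_diff_right W_vv W_ww inner_commute[of "W m w" "W m v"] X_def power2_eq_square)
    also have "(\<Sum>i<m. P i * (z i i \<bullet> (W m w - C *\<^sub>R W m v))) = (\<Sum>i<m. (P i)\<^sup>2 * x i)"
      by (intro sum.cong refl)
        (simp add: inner_diff_right inner_commute[of "z _ _"] wz vz power2_eq_square)
    finally show ?thesis .
  qed
  then show "(\<Sum>i<m. (P i)\<^sup>2 * x i) \<le> X" using inner_ge_zero[of r] by linarith
  define F where "F i j = (f \<bullet> z i j) / sqrt (x j)" for i j
  define t where "t = (f \<bullet> r) / norm r"
  have HF: "f \<bullet> z i j = sqrt (x j) * F i j" if "i < m" "j < m" for i j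
  proof (cases "x j = 0")
    case True
    then have "z i j = 0" using zz[OF that that] by simp
    then show ?thesis using True by simp
  qed (simp add: F_def)
  have fr: "f \<bullet> r = norm r * t" by (simp add: t_def)
  have nr: "norm r = sqrt (X - (\<Sum>i<m. (P i)\<^sup>2 * x i))" by (simp add: norm_eq_sqrt_inner rr)
  have "f \<bullet> W m w = (\<Sum>i<m. P i * (f \<bullet> z i i)) + f \<bullet> r"
    using f by (simp add: r_def inner_diff_right inner_sum_right)
  then have fw: "f \<bullet> W m w = (\<Sum>i<m. P i * sqrt (x i) * F i i) + norm r * t"
    using HF fr by (simp add: mult.assoc)
  \<comment> \<open>The pair \<open>(m, m)\<close> is out of range for the \<open>z i j\<close> and
    stands for \<open>r\<close>.\<close>
  define K where "K = insert (m, m) ({..<m} \<times> {..<m})"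
  define e where "e = (\<lambda>(i, j). if i = m then r else z i j)"
  have "(\<Sum>k\<in>K. (f \<bullet> e k)\<^sup>2 / (e k \<bullet> e k)) \<le> f \<bullet> f"
    by (rule bessel_inequality) (auto simp: K_def e_def rz zz inner_commute[of "z _ _" r] split: if_splits)
  also have "(\<Sum>k\<in>K. (f \<bullet> e k)\<^sup>2 / (e k \<bullet> e k))
      = (f \<bullet> r)\<^sup>2 / (r \<bullet> r) + (\<Sum>(i, j)\<in>{..<m} \<times> {..<m}. (f \<bullet> z i j)\<^sup>2 / (z i j \<bullet> z i j))"
    unfolding K_def by (subst sum.insert) (auto simp: e_def intro!: sum.cong)
  also have "(f \<bullet> r)\<^sup>2 / (r \<bullet> r) = t\<^sup>2"
    by (simp add: t_def power_divide power2_norm_eq_inner)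
  also have "(\<Sum>(i, j)\<in>{..<m} \<times> {..<m}. (f \<bullet> z i j)\<^sup>2 / (z i j \<bullet> z i j)) = (\<Sum>i<m. \<Sum>j<m. (F i j)\<^sup>2)"
    unfolding sum.cartesian_product using x_bounds
    by (intro sum.cong refl) (auto simp: F_def power_divide zz)
  finally have "(\<Sum>i<m. \<Sum>j<m. (F i j)\<^sup>2) + t\<^sup>2 \<le> f \<bullet> f" by simp
  moreover have "\<forall>i<m. \<forall>j<m. f \<bullet> W m (v(i := w j)) = sqrt (x j) * F i j" using H HF by simp
  moreover note fw[unfolded nr]
  ultimately show "\<exists>F t. (\<forall>i<m. \<forall>j<m. f \<bullet> W m (v(i := w j)) = sqrt (x j) * F i j) \<and>
      f \<bullet> W m w = (\<Sum>i<m. P i * sqrt (x i) * F i i) + sqrt (X - (\<Sum>i<m. (P i)\<^sup>2 * x i)) * t \<and>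
      (\<Sum>i<m. \<Sum>j<m. (F i j)\<^sup>2) + t\<^sup>2 \<le> f \<bullet> f"
    by blast
qed

end

text \<open>The cross product and the diagonal replacements form a rank-one form minus a diagonal
  one. Each off-diagonal product carries a factor \<open>sqrt (x j) * sqrt (x i) \<le> X\<close>.
  The two parts involve disjoint sets of coordinates of \<open>f\<close> and \<open>f'\<close>, so
  their bounds add up to the full norms.\<close>

lemma (in principal_bases) bilinear_remainder_bound:
  assumes f: "f \<bullet> W m v = 0" and f': "f' \<bullet> W m w = 0"
  shows "\<bar>(f \<bullet> W m w) * (f' \<bullet> W m v)
      - (\<Sum>i<m. \<Sum>j<m. (f \<bullet> W m (v(i := w j))) * (f' \<bullet> W m (w(j := v i))))\<bar>
    \<le> X / 2 * (f \<bullet> f + f' \<bullet> f')"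
proof -
  interpret s: principal_bases m w v c by (rule swap)
  obtain F t where F: "\<And>i j. i < m \<Longrightarrow> j < m \<Longrightarrow> f \<bullet> W m (v(i := w j)) = sqrt (x j) * F i j"
    and fw: "f \<bullet> W m w = (\<Sum>i<m. P i * sqrt (x i) * F i i) + sqrt (X - (\<Sum>i<m. (P i)\<^sup>2 * x i)) * t"
    and Fn: "(\<Sum>i<m. \<Sum>j<m. (F i j)\<^sup>2) + t\<^sup>2 \<le> f \<bullet> f"
    using slot_coordinates(2)[OF f] by blast
  obtain G u where G: "\<And>i j. i < m \<Longrightarrow> j < m \<Longrightarrow> f' \<bullet> W m (w(i := v j)) = sqrt (x j) * G i j"
    and gv: "f' \<bullet> W m v = (\<Sum>i<m. P i * sqrt (x i) * G i i) + sqrt (X - (\<Sum>i<m. (P i)\<^sup>2 * x i)) * u"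
    and Gn: "(\<Sum>i<m. \<Sum>j<m. (G i j)\<^sup>2) + u\<^sup>2 \<le> f' \<bullet> f'"
    using s.slot_coordinates(2)[OF f'] by blast
  define r where "r = sqrt (X - (\<Sum>i<m. (P i)\<^sup>2 * x i))"
  have r2: "r\<^sup>2 = X - (\<Sum>i<m. (P i)\<^sup>2 * x i)" using slot_coordinates(1)[OF f] by (simp add: r_def)
  \<comment> \<open>The additional index \<open>m\<close> carries the remainder coordinates. Its
    diagonal entry is \<open>0\<close>, as the remainder occurs only in the cross product.\<close>
  define a where "a k = (if k = m then r else P k * sqrt (x k))" for k
  define d where "d k = (if k = m then 0 else x k)" for k
  define p q where "p k = (if k = m then t else F k k)" and "q k = (if k = m then u else G k k)" for k
  have e: "{..m} = insert m {..<m}" by auto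
  have sm: "(\<Sum>k\<le>m. h k) = h m + (\<Sum>k<m. h k)" for h :: "nat \<Rightarrow> real"
    unfolding e by simp
  have aw: "(\<Sum>k\<le>m. (a k)\<^sup>2) \<le> X"
  proof -
    have "(\<Sum>k<m. (a k)\<^sup>2) = (\<Sum>k<m. (P k)\<^sup>2 * x k)"
      using x_bounds by (intro sum.cong) (auto simp: a_def power_mult_distrib)
    then show ?thesis by (simp add: sm r2) (simp add: a_def r2)
  qed
  have "\<bar>(\<Sum>k\<le>m. a k * p k) * (\<Sum>k\<le>m. a k * q k) - (\<Sum>k\<le>m. d k * (p k * q k))\<bar>
    \<le> X / 2 * ((\<Sum>k\<le>m. (p k)\<^sup>2) + (\<Sum>k\<le>m. (q k)\<^sup>2))"
    using aw x_bounds x_le_X X_bounds by (intro rank_one_minus_diagonal_bound) (auto simp: d_def)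
  moreover have "(\<Sum>k\<le>m. a k * p k) = f \<bullet> W m w" "(\<Sum>k\<le>m. a k * q k) = f' \<bullet> W m v"
    unfolding sm fw gv r_def[symmetric] by (auto simp: a_def p_def q_def)
  moreover have "(\<Sum>k\<le>m. d k * (p k * q k)) = (\<Sum>k<m. x k * (F k k * G k k))"
    unfolding sm by (auto simp: d_def p_def q_def)
  moreover have "(\<Sum>k\<le>m. (p k)\<^sup>2) = t\<^sup>2 + (\<Sum>k<m. (F k k)\<^sup>2)" "(\<Sum>k\<le>m. (q k)\<^sup>2) = u\<^sup>2 + (\<Sum>k<m. (G k k)\<^sup>2)"
    unfolding sm by (auto simp: p_def q_def)
  ultimately have diag: "\<bar>(f \<bullet> W m w) * (f' \<bullet> W m v) - (\<Sum>k<m. x k * (F k k * G k k))\<bar>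
    \<le> X / 2 * ((t\<^sup>2 + (\<Sum>k<m. (F k k)\<^sup>2)) + (u\<^sup>2 + (\<Sum>k<m. (G k k)\<^sup>2)))"
    by simp
  define H where "H i j = (f \<bullet> W m (v(i := w j))) * (f' \<bullet> W m (w(j := v i)))" for i j
  have Hd: "H k k = x k * (F k k * G k k)" if "k < m" for k
    using that x_bounds[OF that] by (simp add: H_def F G)
  have Ho: "\<bar>H i j\<bar> \<le> X / 2 * ((F i j)\<^sup>2 + (G j i)\<^sup>2)" if ij: "i < m" "j < m" for i j
  proof -
    have "sqrt (x j) * sqrt (x i) \<le> sqrt X * sqrt X"
      using x_le_X ij x_bounds X_bounds by (intro mult_mono) auto
    then have 1: "sqrt (x j) * sqrt (x i) \<le> X" using X_bounds by simp
    have "2 * \<bar>F i j * G j i\<bar> \<le> (F i j)\<^sup>2 + (G j i)\<^sup>2"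
      using sum_squares_bound[of "\<bar>F i j\<bar>" "\<bar>G j i\<bar>"] by (simp add: abs_mult)
    then have 2: "\<bar>F i j * G j i\<bar> \<le> ((F i j)\<^sup>2 + (G j i)\<^sup>2) / 2" by simp
    have "\<bar>H i j\<bar> = (sqrt (x j) * sqrt (x i)) * \<bar>F i j * G j i\<bar>"
      using ij x_bounds by (simp add: H_def F G abs_mult)
    also have "\<dots> \<le> X * (((F i j)\<^sup>2 + (G j i)\<^sup>2) / 2)"
      using 1 2 X_bounds by (intro mult_mono) auto
    finally show ?thesis by simp
  qed
  have split: "(\<Sum>i<m. \<Sum>j<m. h i j) = (\<Sum>i<m. h i i) + (\<Sum>i<m. \<Sum>j\<in>{..<m}-{i}. h i j)" for h :: "nat \<Rightarrow> nat \<Rightarrow> real"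
    unfolding sum.distrib[symmetric] by (intro sum.cong refl) (simp add: sum.remove)
  have "\<bar>\<Sum>i<m. \<Sum>j\<in>{..<m}-{i}. H i j\<bar> \<le> (\<Sum>i<m. \<Sum>j\<in>{..<m}-{i}. \<bar>H i j\<bar>)"
    by (rule order.trans[OF sum_abs]) (intro sum_mono sum_abs)
  also have "\<dots> \<le> (\<Sum>i<m. \<Sum>j\<in>{..<m}-{i}. X / 2 * ((F i j)\<^sup>2 + (G j i)\<^sup>2))"
    by (intro sum_mono Ho) auto
  finally have off: "\<bar>\<Sum>i<m. \<Sum>j\<in>{..<m}-{i}. H i j\<bar>
    \<le> X / 2 * (\<Sum>i<m. \<Sum>j\<in>{..<m}-{i}. (F i j)\<^sup>2 + (G j i)\<^sup>2)" by (simp add: sum_distrib_left)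
  have tot: "(\<Sum>i<m. (F i i)\<^sup>2 + (G i i)\<^sup>2) + (\<Sum>i<m. \<Sum>j\<in>{..<m}-{i}. (F i j)\<^sup>2 + (G j i)\<^sup>2)
     = (\<Sum>i<m. \<Sum>j<m. (F i j)\<^sup>2) + (\<Sum>i<m. \<Sum>j<m. (G i j)\<^sup>2)"
    unfolding split[of "\<lambda>i j. (F i j)\<^sup>2 + (G j i)\<^sup>2", symmetric]
    by (simp add: sum.distrib) (rule sum.swap)
  define o2 where "o2 = (\<Sum>i<m. \<Sum>j\<in>{..<m}-{i}. (F i j)\<^sup>2 + (G j i)\<^sup>2)"
  define dd where "dd = (\<Sum>k<m. (F k k)\<^sup>2) + (\<Sum>k<m. (G k k)\<^sup>2)"
  have HH: "(\<Sum>i<m. \<Sum>j<m. H i j) = (\<Sum>k<m. x k * (F k k * G k k)) + (\<Sum>i<m. \<Sum>j\<in>{..<m}-{i}. H i j)"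
    unfolding split[of H] using Hd by simp
  have le: "t\<^sup>2 + u\<^sup>2 + dd + o2 \<le> f \<bullet> f + f' \<bullet> f'"
    using tot Fn Gn by (simp add: o2_def dd_def sum.distrib)
  have "\<bar>(f \<bullet> W m w) * (f' \<bullet> W m v) - (\<Sum>i<m. \<Sum>j<m. H i j)\<bar>
      \<le> X / 2 * (t\<^sup>2 + u\<^sup>2 + dd) + X / 2 * o2"
  proof -
    have "\<bar>a - (d + e)\<bar> \<le> \<bar>a - d\<bar> + \<bar>e\<bar>" for a d e :: real by linarith
    then have "\<bar>(f \<bullet> W m w) * (f' \<bullet> W m v) - (\<Sum>i<m. \<Sum>j<m. H i j)\<bar>
      \<le> \<bar>(f \<bullet> W m w) * (f' \<bullet> W m v) - (\<Sum>k<m. x k * (F k k * G k k))\<bar>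
        + \<bar>\<Sum>i<m. \<Sum>j\<in>{..<m}-{i}. H i j\<bar>" unfolding HH .
    also have "\<dots> \<le> X / 2 * ((t\<^sup>2 + (\<Sum>k<m. (F k k)\<^sup>2)) + (u\<^sup>2 + (\<Sum>k<m. (G k k)\<^sup>2))) + X / 2 * o2"
      using diag off unfolding o2_def by (rule add_mono)
    finally show ?thesis by (simp add: dd_def algebra_simps)
  qed
  also have "\<dots> \<le> X / 2 * (f \<bullet> f + f' \<bullet> f')"
    unfolding distrib_left[symmetric] using X_bounds le by (intro mult_left_mono) auto
  finally show ?thesis unfolding H_def .
qed

text \<open>The sum of the squared cosines is \<open>m - \<sigma>\<close> with
  \<open>\<sigma> = X + g\<close>. Expanding the products therefore makes the deficit exactly the
  cross term, plus \<open>g\<close>, plus \<open>f \<bullet> R\<close> and its mirror image, plus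
  the bilinear remainder. Only the last three are estimated.\<close>

lemma (in principal_bases) trace_deficit_lower_bound:
  assumes f: "f \<bullet> W m v = 0" and f': "f' \<bullet> W m w = 0"
  shows "m - (\<Sum>i<m. \<Sum>j<m. ((W m v + f) \<bullet> W m (v(i := w j))) * ((W m w + f') \<bullet> W m (w(j := v i))))
    \<ge> (1 - (C + f \<bullet> W m w) * (C + f' \<bullet> W m v)) + g - (norm f + norm f') * sqrt \<rho>2
      - X / 2 * ((norm f)\<^sup>2 + (norm f')\<^sup>2)"
proof -
  \<comment> \<open>Quantities built from \<open>m\<close> and \<open>c\<close> alone, such as
    \<open>\<rho>2\<close>, are common to both interpretations.\<close>
  interpret s: principal_bases m w v c by (rule swap)
  define H H' where "H i j = f \<bullet> W m (v(i := w j))" and "H' j i = f' \<bullet> W m (w(j := v i))" for i j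
  have A: "(W m v + f) \<bullet> W m (v(i := w j)) = (if i = j then c i else 0) + H i j" if "i < m" "j < m" for i j
    using that by (simp add: inner_add_left W_v_slot H_def)
  have B: "(W m w + f') \<bullet> W m (w(j := v i)) = (if i = j then c i else 0) + H' j i" if "i < m" "j < m" for i j
    using that by (simp add: inner_add_left s.W_v_slot H'_def)
  have "(\<Sum>i<m. \<Sum>j<m. ((W m v + f) \<bullet> W m (v(i := w j))) * ((W m w + f') \<bullet> W m (w(j := v i))))
    = (\<Sum>i<m. \<Sum>j<m. ((if i = j then c i else 0) + H i j) * ((if i = j then c i else 0) + H' j i))"
    by (intro sum.cong refl) (simp only: A B lessThan_iff)
  also have "\<dots> = (\<Sum>i<m. \<Sum>j<m. (if i = j then (c i)\<^sup>2 + c i * H i i + c i * H' i i else 0) + H i j * H' j i)"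
    by (intro sum.cong refl) (auto simp: algebra_simps power2_eq_square)
  also have "\<dots> = (\<Sum>i<m. (c i)\<^sup>2) + (\<Sum>i<m. c i * H i i) + (\<Sum>i<m. c i * H' i i) + (\<Sum>i<m. \<Sum>j<m. H i j * H' j i)"
    by (simp add: sum.distrib)
  finally have 1: "(\<Sum>i<m. \<Sum>j<m. ((W m v + f) \<bullet> W m (v(i := w j))) * ((W m w + f') \<bullet> W m (w(j := v i)))) = \<dots>" .
  have 2: "f \<bullet> R = C * (f \<bullet> W m w) - (\<Sum>i<m. c i * H i i)" "f' \<bullet> s.R = C * (f' \<bullet> W m v) - (\<Sum>i<m. c i * H' i i)"
    by (simp_all add: R_def s.R_def inner_diff_right inner_sum_right H_def H'_def)
  have 3: "(\<Sum>i<m. (c i)\<^sup>2) = m - \<sigma>" by (simp add: \<sigma>_def x_def sum_subtractf)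
  have 4: "\<bar>f \<bullet> R\<bar> \<le> norm f * sqrt \<rho>2" "\<bar>f' \<bullet> s.R\<bar> \<le> norm f' * sqrt \<rho>2"
    using R_bound(2)[OF f] s.R_bound(2)[OF f'] by auto
  have 5: "\<bar>(f \<bullet> W m w) * (f' \<bullet> W m v) - (\<Sum>i<m. \<Sum>j<m. H i j * H' j i)\<bar> \<le> X / 2 * ((norm f)\<^sup>2 + (norm f')\<^sup>2)"
    using bilinear_remainder_bound[OF f f'] by (simp add: H_def H'_def power2_norm_eq_inner)
  have 6: "1 - (C + f \<bullet> W m w) * (C + f' \<bullet> W m v) = X - C * (f \<bullet> W m w) - C * (f' \<bullet> W m v) - (f \<bullet> W m w) * (f' \<bullet> W m v)"
    by (simp add: X_def power2_eq_square algebra_simps)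
  show ?thesis
    unfolding 1 3 6 using 2 4 5 by (simp add: g_def abs_le_iff algebra_simps)
qed

section \<open>The weighted power map\<close>

lemma powr_le_affine:
  fixes y \<theta> :: real
  assumes "0 \<le> \<theta>" "\<theta> \<le> 1" "0 < y"
  shows "y powr \<theta> \<le> 1 - \<theta> + \<theta> * y"
  using Youngs_inequality_0[of \<theta> "1 - \<theta>" y 1] assms by simp

lemma powr_ge_affine:
  fixes u r :: real
  assumes "1 \<le> r" "0 < u"
  shows "1 + r * (u - 1) \<le> u powr r"
proof -
  have "(u powr r) powr (1 / r) \<le> 1 - 1 / r + 1 / r * u powr r"
    using assms by (intro powr_le_affine) auto
  then have "u \<le> 1 - 1 / r + u powr r / r" using assms by (simp add: powr_powr)
  then have "r * u \<le> r * (1 - 1 / r + u powr r / r)" using assms by (intro mult_left_mono) auto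
  then show ?thesis using assms by (simp add: algebra_simps)
qed

text \<open>Up to the factor \<open>2 - e\<close> this is the derivative of
  \<open>\<bar>t\<bar> powr (2 - e)\<close>, which is how it enters the matrix of the
  anisotropy.\<close>

definition phi :: "real \<Rightarrow> real \<Rightarrow> real" where
  "phi e t = sgn t * \<bar>t\<bar> powr (1 - e)"

lemma phi_0 [simp]: "phi e 0 = 0" by (simp add: phi_def)

lemma phi_minus [simp]: "phi e (- t) = - phi e t" by (simp add: phi_def sgn_minus)

lemma phi_mult: "phi e (a * b) = phi e a * phi e b"
  by (simp add: phi_def sgn_mult abs_mult powr_mult)

lemma phi_pos: "0 \<le> t \<Longrightarrow> phi e t = t powr (1 - e)"
  by (cases "t = 0") (simp_all add: phi_def)

lemma phi_mult_self: "phi e t * t = \<bar>t\<bar> powr (2 - e)"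
proof -
  have "phi e t * t = \<bar>t\<bar> powr (1 - e) * \<bar>t\<bar>" by (simp add: phi_def sgn_real_def abs_real_def)
  also have "\<dots> = \<bar>t\<bar> powr (1 - e + 1)" by (simp add: powr_mult_base mult.commute[of _ "\<bar>t\<bar>"] add.commute)
  finally show ?thesis by (simp add: algebra_simps)
qed

text \<open>The right side is \<open>1 - e\<close> times the integral of the convex function
  \<open>t powr (- e)\<close> from \<open>y\<close> to \<open>x\<close>, and the mean of a convex
  function is at least its value at the midpoint. The proof avoids integrals: the difference of both
  sides grows with the half length of the interval.\<close>

lemma powr_diff_ge_midpoint:
  fixes x y e :: real
  assumes e: "0 \<le> e" "e < 1" and xy: "0 \<le> y" "y < x"
  shows "(1 - e) * ((x + y) / 2) powr (- e) * (x - y) \<le> x powr (1 - e) - y powr (1 - e)"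
proof -
  define \<mu> \<tau> where "\<mu> = (x + y) / 2" and "\<tau> = (x - y) / 2"
  define h where "h t = (\<mu> + t) powr (1 - e) - (\<mu> - t) powr (1 - e) - 2 * (1 - e) * \<mu> powr (- e) * t" for t
  have mt: "0 < \<mu>" "0 \<le> \<tau>" "\<tau> \<le> \<mu>" using xy by (auto simp: \<mu>_def \<tau>_def)
  have "h 0 \<le> h \<tau>"
  proof (rule DERIV_nonneg_imp_increasing_open[OF mt(2)])
    fix t assume t: "0 < t" "t < \<tau>"
    define a b c where "a = (\<mu> + t) powr (- e)" and "b = (\<mu> - t) powr (- e)" and "c = \<mu> powr (- e)"
    have abc: "0 < a" "0 < b" "0 < c" using t mt by (auto simp: a_def b_def c_def)
    have D1: "((\<lambda>t. (\<mu> + t) powr (1 - e)) has_real_derivative (1 - e) * (\<mu> + t) powr (1 - e - of_nat 1) * 1) (at t)"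
      using t mt by (intro DERIV_fun_powr) (auto intro!: derivative_eq_intros)
    have D2: "((\<lambda>t. (\<mu> - t) powr (1 - e)) has_real_derivative (1 - e) * (\<mu> - t) powr (1 - e - of_nat 1) * (- 1)) (at t)"
      using t mt by (intro DERIV_fun_powr) (auto intro!: derivative_eq_intros)
    have D: "(h has_real_derivative (1 - e) * (a + b - 2 * c)) (at t)"
      unfolding h_def
      by (rule DERIV_cong[OF DERIV_diff[OF DERIV_diff[OF D1 D2] DERIV_cmult[OF DERIV_ident]]])
        (simp add: a_def b_def c_def algebra_simps)
    have "a * b = ((\<mu> + t) * (\<mu> - t)) powr (- e)"
      using t mt by (simp add: a_def b_def powr_mult)
    also have "\<dots> \<ge> (\<mu> * \<mu>) powr (- e)"
    proof (rule powr_mono2')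
      have "(\<mu> + t) * (\<mu> - t) = \<mu> * \<mu> - t * t" by (simp add: algebra_simps)
      then show "(\<mu> + t) * (\<mu> - t) \<le> \<mu> * \<mu>" by simp
    qed (use e t mt in auto)
    finally have "c * c \<le> a * b" using mt by (simp add: c_def powr_mult)
    moreover have "0 \<le> (a - b)\<^sup>2" by simp
    ultimately have "(2 * c)\<^sup>2 \<le> (a + b)\<^sup>2" by (simp add: power2_eq_square algebra_simps)
    then have "2 * c \<le> a + b" by (rule power2_le_imp_le) (use abc in auto)
    then show "\<exists>y. (h has_real_derivative y) (at t) \<and> 0 \<le> y" using D e by auto
  next
    show "continuous_on {0..\<tau>} h"
      unfolding h_def using e mt
      by (intro continuous_intros continuous_on_powr') auto
  qed
  moreover have "\<mu> + \<tau> = x" "\<mu> - \<tau> = y" by (auto simp: \<mu>_def \<tau>_def field_simps)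
  ultimately have "2 * (1 - e) * \<mu> powr (- e) * \<tau> \<le> x powr (1 - e) - y powr (1 - e)" by (simp add: h_def)
  moreover have "(1 - e) * \<mu> powr (- e) * (x - y) = 2 * (1 - e) * \<mu> powr (- e) * \<tau>"
    by (simp add: \<tau>_def field_simps)
  ultimately show ?thesis unfolding \<mu>_def[symmetric] by linarith
qed

lemma powr_subadditive:
  fixes x z s :: real
  assumes "0 \<le> x" "0 \<le> z" "s \<le> 1" "0 < s"
  shows "(x + z) powr s \<le> x powr s + z powr s"
proof (cases "x + z = 0")
  case True
  then show ?thesis using assms by auto
next
  case False
  then have p: "0 < x + z" using assms by auto
  have "x / (x + z) \<le> (x / (x + z)) powr s" "z / (x + z) \<le> (z / (x + z)) powr s"
    using powr_mono'[of s 1 "x / (x + z)"] powr_mono'[of s 1 "z / (x + z)"] assms p by auto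
  then have "x / (x + z) + z / (x + z) \<le> (x powr s + z powr s) / (x + z) powr s"
    using assms p by (simp add: powr_divide add_divide_distrib)
  moreover have "x / (x + z) + z / (x + z) = 1" using False by (simp add: add_divide_distrib[symmetric])
  ultimately show ?thesis using p by (simp add: field_simps)
qed

text \<open>For equal signs this is the midpoint inequality. For opposite signs subadditivity of the
  power reduces to the pair \<open>x - y\<close> and \<open>0\<close>, whose midpoint is still at
  most \<open>M\<close>.\<close>

lemma phi_coercive:
  fixes x y e M :: real
  assumes e: "0 \<le> e" "e < 1" and M: "0 < M" "\<bar>x\<bar> + \<bar>y\<bar> \<le> 2 * M"
  shows "(1 - e) * M powr (- e) * (x - y)\<^sup>2 \<le> (phi e x - phi e y) * (x - y)"
proof -
  have main: "(1 - e) * M powr (- e) * (x - y) \<le> phi e x - phi e y" if "y < x" "\<bar>x\<bar> + \<bar>y\<bar> \<le> 2 * M" for x y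
  proof -
    have mono: "M powr (- e) \<le> \<mu> powr (- e)" if "0 < \<mu>" "\<mu> \<le> M" for \<mu>
      using that e by (intro powr_mono2') auto
    have pos: "(1 - e) * M powr (- e) * (x - y) \<le> x powr (1 - e) - y powr (1 - e)"
      if "0 \<le> y" "y < x" "x + y \<le> 2 * M" for x y
    proof -
      have "(1 - e) * M powr (- e) * (x - y) \<le> (1 - e) * ((x + y) / 2) powr (- e) * (x - y)"
        using that e mono[of "(x + y) / 2"] by (intro mult_right_mono mult_left_mono) auto
      also have "\<dots> \<le> x powr (1 - e) - y powr (1 - e)" by (rule powr_diff_ge_midpoint) (use that e in auto)
      finally show ?thesis .
    qed
    consider "0 \<le> y" | "x \<le> 0" | "y < 0" "0 < x" using \<open>y < x\<close> by linarith
    then show ?thesis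
    proof cases
      case 1
      then show ?thesis using pos[of y x] that by (simp add: phi_pos)
    next
      case 2
      then have "phi e x = - phi e (- x)" "phi e y = - phi e (- y)" by simp_all
      then show ?thesis using 2 pos[of "- x" "- y"] that by (simp add: phi_pos del: phi_minus)
    next
      case 3
      have "(1 - e) * M powr (- e) * (x - y) \<le> (x - y) powr (1 - e)"
        using pos[of 0 "x - y"] 3 that by simp
      also have "\<dots> \<le> x powr (1 - e) + (- y) powr (1 - e)"
        using powr_subadditive[of x "- y" "1 - e"] 3 e by simp
      also have "\<dots> = phi e x - phi e y"
      proof -
        have "phi e y = - phi e (- y)" by simp
        then show ?thesis using 3 by (simp add: phi_pos del: phi_minus)
      qed
      finally show ?thesis .
    qed
  qed
  show ?thesis
  proof (cases x y rule: linorder_cases)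
    case greater
    then have "(1 - e) * M powr (- e) * (x - y) * (x - y) \<le> (phi e x - phi e y) * (x - y)"
      using main[of y x] M by (intro mult_right_mono) auto
    then show ?thesis by (simp add: power2_eq_square mult_ac)
  next
    case less
    then have "(1 - e) * M powr (- e) * (y - x) * (y - x) \<le> (phi e y - phi e x) * (y - x)"
      using main[of x y] M by (intro mult_right_mono) auto
    then show ?thesis by (simp add: power2_eq_square algebra_simps)
  qed simp
qed

text \<open>Where \<open>(\<alpha> $ I)\<^sup>2\<close> equals the product of the weights over
  \<open>I\<close>, the value is \<open>\<alpha> $ I\<close> itself. In general the ratio to
  \<open>\<alpha> $ I\<close> is the power \<open>e / 2\<close> of the quotient of these two
  numbers.\<close>

definition eta :: "real \<Rightarrow> real ^ 'n \<Rightarrow> real ^ 'n set \<Rightarrow> real ^ 'n set" where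
  "eta e x \<alpha> = (\<chi> I. (\<Prod>i\<in>I. x $ i) powr (e / 2) * phi e (\<alpha> $ I))"

text \<open>
  The ratio \<open>a = \<eta> I / \<alpha> I\<close> is at least \<open>2 powr (- 7/20) > 1569/2000\<close>, and \<open>71/50\<close> is slightly above \<open>exp (7/20)\<close>.
  The numbers \<open>110225/100000\<close> and \<open>31775/100000\<close> are the midpoint and the half length of the interval between these
  two bounds.
\<close>

lemma tangent_power_bound:
  fixes a p \<beta> :: real
  assumes a: "1569/2000 \<le> a"
    and b1: "9025/10000 \<le> \<beta> * p" and b2: "6.0492 \<le> \<beta> * p\<^sup>2" and \<beta>: "0 \<le> \<beta>" and p3: "3 \<le> p"
  shows "(a - 110225/100000)\<^sup>2 \<le> (31775/100000)\<^sup>2 + \<beta> * (a / (71/50)) powr p"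
proof (cases "a \<le> 71/50")
  case True
  then have "\<bar>a - 110225/100000\<bar> \<le> \<bar>31775/100000\<bar>" using a by (auto simp: abs_if)
  then have "(a - 110225/100000)\<^sup>2 \<le> (31775/100000)\<^sup>2" by (rule abs_le_square_iff[THEN iffD1])
  moreover have "0 \<le> \<beta> * (a / (71/50)) powr p" using \<beta> by simp
  ultimately show ?thesis by linarith
next
  case False
  define u t r where "u = a / (71/50)" and "t = u - 1" and "r = p / 3"
  have t: "0 \<le> t" "0 < u" using False by (auto simp: t_def u_def field_simps)
  \<comment> \<open>Bernoulli's inequality for a third of the exponent, then cubed, supplies the
    quadratic term that a direct application lacks. The thresholds in \<open>b1\<close> and
    \<open>b2\<close> come from comparing coefficients: \<open>9025/10000\<close> exceeds
    \<open>2 * (31775/100000) * (71/50)\<close>, and \<open>6.0492\<close> is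
    \<open>3 * (71/50)\<^sup>2\<close>.\<close>
  have "1 + r * t \<le> u powr r" unfolding t_def by (rule powr_ge_affine) (use p3 t in \<open>auto simp: r_def\<close>)
  then have "(1 + r * t) ^ 3 \<le> (u powr r) ^ 3" using t p3 by (intro power_mono) (auto simp: r_def)
  also have "(u powr r) ^ 3 = u powr p" using t by (simp add: powr_power r_def)
  finally have 1: "(1 + r * t) ^ 3 \<le> u powr p" .
  have "0 \<le> (r * t) ^ 3" using t p3 by (simp add: r_def)
  moreover have "(1 + r * t) ^ 3 = 1 + 3 * (r * t) + 3 * (r * t)\<^sup>2 + (r * t) ^ 3"
    by (simp add: power3_eq_cube power2_eq_square algebra_simps)
  ultimately have "1 + 3 * (r * t) + 3 * (r * t)\<^sup>2 \<le> u powr p" using 1 by linarith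
  then have "\<beta> * (1 + 3 * (r * t) + 3 * (r * t)\<^sup>2) \<le> \<beta> * u powr p" using \<beta> by (rule mult_left_mono)
  then have 2: "\<beta> + (\<beta> * p) * t + (\<beta> * p\<^sup>2) * t\<^sup>2 / 3 \<le> \<beta> * u powr p"
    by (simp add: r_def power2_eq_square algebra_simps)
  have "9025/10000 * t \<le> (\<beta> * p) * t" "6.0492 * t\<^sup>2 \<le> (\<beta> * p\<^sup>2) * t\<^sup>2"
    using mult_right_mono[OF b1, of t] mult_right_mono[OF b2, of "t\<^sup>2"] t by simp_all
  moreover have "a - 110225/100000 = 31775/100000 + (71/50) * t" by (simp add: t_def u_def field_simps)
  then have "(a - 110225/100000)\<^sup>2 = (31775/100000)\<^sup>2 + 2 * (31775/100000) * (71/50) * t + (71/50)\<^sup>2 * t\<^sup>2"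
    by (simp add: power2_eq_square algebra_simps)
  ultimately show ?thesis using 2 t \<beta> unfolding u_def[symmetric] by (simp add: power2_eq_square)
qed

text \<open>In the expansion of the \<open>m\<close>-th power each index set of size
  \<open>m\<close> arises from \<open>fact m\<close> injective selections; the other terms are
  nonnegative.\<close>

lemma sum_prod_subsets_le:
  fixes x :: "'n::{finite,linorder} \<Rightarrow> real"
  assumes x: "\<And>i. 0 \<le> x i"
  shows "(\<Sum>I | card I = m. \<Prod>i\<in>I. x i) \<le> (\<Sum>i\<in>UNIV. x i) ^ m / fact m"
proof -
  define h where "h g = (if inj_on g {..<m} then \<Prod>j<m. x (g j) else 0)" for g :: "nat \<Rightarrow> 'n"
  have "(\<Sum>g\<in>{..<m} \<rightarrow>\<^sub>E UNIV. h g)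
    = (\<Sum>I | I \<subseteq> UNIV \<and> card I = m. \<Sum>p | p permutes {..<m}. h (\<lambda>j\<in>{..<m}. sorted_list_of_set I ! p j))"
    by (rule sum_PiE_injective) (auto simp: h_def)
  also have "\<dots> = (\<Sum>I | I \<subseteq> UNIV \<and> card I = m. \<Sum>p | p permutes {..<m}. \<Prod>i\<in>I. x i)"
  proof (intro sum.cong refl)
    fix I :: "'n set" and p assume I: "I \<in> {I. I \<subseteq> UNIV \<and> card I = m}" and p: "p \<in> {p. p permutes {..<m}}"
    have "bij_betw (\<lambda>k. sorted_list_of_set I ! p k) {..<m} I"
      using bij_betw_trans[OF permutes_imp_bij bij_betw_nth_sorted_list_of_set, of p m I] I p by (simp add: comp_def)
    then have b: "bij_betw (\<lambda>j\<in>{..<m}. sorted_list_of_set I ! p j) {..<m} I"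
      by (rule bij_betw_cong[THEN iffD1, rotated]) auto
    show "h (\<lambda>j\<in>{..<m}. sorted_list_of_set I ! p j) = (\<Prod>i\<in>I. x i)"
      using bij_betw_imp_inj_on[OF b] prod.reindex_bij_betw[OF b, of x] by (simp add: h_def)
  qed
  also have "\<dots> = fact m * (\<Sum>I | card I = m. \<Prod>i\<in>I. x i)"
    by (simp add: card_permutations[of _ m] sum_distrib_left)
  finally have "fact m * (\<Sum>I | card I = m. \<Prod>i\<in>I. x i) = (\<Sum>g\<in>{..<m} \<rightarrow>\<^sub>E UNIV. h g)" by simp
  also have "\<dots> \<le> (\<Sum>g\<in>{..<m} \<rightarrow>\<^sub>E (UNIV :: 'n set). \<Prod>j<m. x (g j))"
    using x by (intro sum_mono) (auto simp: h_def prod_nonneg)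
  also have "\<dots> = (\<Prod>j<m. \<Sum>i\<in>UNIV. x i)"
    by (subst prod_sum_PiE) auto
  also have "\<dots> = (\<Sum>i\<in>UNIV. x i) ^ m" by simp
  finally show ?thesis by (simp add: field_simps)
qed

text \<open>Under the probability distribution given by the squares of \<open>\<alpha>\<close>, the
  quotient \<open>Q I / (\<alpha> $ I)\<^sup>2\<close> has mean at most \<open>\<kappa>\<close>,
  hence so have its powers with exponent at most one. The exponent \<open>p = 20 * m / 7\<close> is
  the largest for which \<open>e * m \<le> 7/10\<close> guarantees
  \<open>p * e / 2 \<le> 1\<close>.\<close>

lemma eta_bounds:
  fixes x :: "real ^ 'n" and \<alpha> :: "real ^ 'n set"
  assumes x: "\<And>i. 0 < x $ i" and supp: "\<And>I. card I \<noteq> m \<Longrightarrow> \<alpha> $ I = 0"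
    and le: "\<And>I. card I = m \<Longrightarrow> (\<alpha> $ I)\<^sup>2 \<le> 2 ^ m * (\<Prod>i\<in>I. x $ i)"
    and unit: "\<alpha> \<bullet> \<alpha> = 1" and e: "0 \<le> e" "e * m \<le> 7/10" and m: "1 \<le> m"
    and \<kappa>: "(\<Sum>I | card I = m. \<Prod>i\<in>I. x $ i) \<le> \<kappa>" "1 \<le> \<kappa>"
  shows "1569/2000 \<le> eta e x \<alpha> \<bullet> \<alpha>" "eta e x \<alpha> \<bullet> \<alpha> \<le> \<kappa>"
    and "\<lbrakk>0 \<le> \<beta>; p = 20 * real m / 7; 3 \<le> p; 9025/10000 \<le> \<beta> * p; 6.0492 \<le> \<beta> * p\<^sup>2\<rbrakk>
      \<Longrightarrow> (norm (eta e x \<alpha> - (110225/100000) *\<^sub>R \<alpha>))\<^sup>2 \<le> (31775/100000)\<^sup>2 + \<beta> * \<kappa> / (272/100) ^ m"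
proof -
  define Q where "Q I = (\<Prod>i\<in>I. x $ i)" for I
  have Q: "0 < Q I" for I using x by (simp add: Q_def prod_pos)
  define a where "a I = (Q I / (\<alpha> $ I)\<^sup>2) powr (e / 2)" for I
  have eta_a: "eta e x \<alpha> $ I = a I * \<alpha> $ I" for I
  proof (cases "\<alpha> $ I = 0")
    case False
    have "\<bar>\<alpha> $ I\<bar> powr (1 - e) = \<bar>\<alpha> $ I\<bar> / \<bar>\<alpha> $ I\<bar> powr e" using False by (simp add: powr_diff)
    moreover have "((\<alpha> $ I)\<^sup>2) powr (e / 2) = \<bar>\<alpha> $ I\<bar> powr e"
    proof -
      have "(\<alpha> $ I)\<^sup>2 = \<bar>\<alpha> $ I\<bar> powr 2" using False by simp
      then show ?thesis by (simp only: powr_powr) simp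
    qed
    ultimately have "phi e (\<alpha> $ I) = \<alpha> $ I / ((\<alpha> $ I)\<^sup>2) powr (e / 2)"
      by (simp add: phi_def sgn_real_def)
    then show ?thesis using Q[of I] by (simp add: eta_def a_def powr_divide Q_def[symmetric])
  qed (simp add: eta_def)
  have a_ge: "1569/2000 \<le> a I" if "\<alpha> $ I \<noteq> 0" for I
  proof -
    have c: "card I = m" using supp that by blast
    have "(1/2) powr real m = 1 / 2 ^ m" by (simp add: powr_realpow power_one_over)
    also have "\<dots> \<le> Q I / (\<alpha> $ I)\<^sup>2" using le[OF c] that by (simp add: Q_def field_simps)
    finally have "((1/2) powr real m) powr (e / 2) \<le> a I"
      unfolding a_def using e by (intro powr_mono2) auto
    moreover have "((1/2::real) powr real m) powr (e / 2) = (1/2) powr (e * m / 2)" by (simp add: powr_powr mult.commute)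
    moreover have "(1/2::real) powr (7/20) \<le> (1/2) powr (e * m / 2)" using e by (intro powr_mono') auto
    moreover have "1569/2000 \<le> (1/2::real) powr (7/20)"
    proof -
      have "((1569/2000::real) ^ 20) \<le> (1/2) ^ 7" by (simp add: power_numeral_reduce field_simps)
      also have "\<dots> = ((1/2) powr (7/20)) ^ 20" by (simp add: powr_power)
      finally show ?thesis by (rule power_mono_iff[THEN iffD1, rotated 3]) auto
    qed
    ultimately show ?thesis by linarith
  qed
  have sum1: "(\<Sum>I\<in>UNIV. (\<alpha> $ I)\<^sup>2) = 1" using unit by (simp add: inner_vec_def power2_eq_square)
  have "1569/2000 = (\<Sum>I\<in>UNIV. 1569/2000 * (\<alpha> $ I)\<^sup>2)" unfolding sum_distrib_left[symmetric] sum1 by simp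
  also have "\<dots> \<le> (\<Sum>I\<in>UNIV. a I * (\<alpha> $ I)\<^sup>2)"
  proof (rule sum_mono)
    fix I show "1569/2000 * (\<alpha> $ I)\<^sup>2 \<le> a I * (\<alpha> $ I)\<^sup>2"
      using a_ge[of I] by (cases "\<alpha> $ I = 0") (auto intro: mult_right_mono)
  qed
  finally show "1569/2000 \<le> eta e x \<alpha> \<bullet> \<alpha>" by (simp add: inner_vec_def eta_a power2_eq_square mult.assoc)
  have moment: "(\<Sum>I\<in>UNIV. (\<alpha> $ I)\<^sup>2 * (Q I / (\<alpha> $ I)\<^sup>2) powr \<theta>) \<le> \<kappa>" if \<theta>: "0 \<le> \<theta>" "\<theta> \<le> 1" for \<theta>
  proof -
    have "(\<alpha> $ I)\<^sup>2 * (Q I / (\<alpha> $ I)\<^sup>2) powr \<theta> \<le> (1 - \<theta>) * (\<alpha> $ I)\<^sup>2 + \<theta> * (if card I = m then Q I else 0)" for I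
    proof (cases "\<alpha> $ I = 0")
      case True
      then show ?thesis using \<theta> Q[of I] by simp
    next
      case False
      then have c: "card I = m" using supp by blast
      have "(Q I / (\<alpha> $ I)\<^sup>2) powr \<theta> \<le> 1 - \<theta> + \<theta> * (Q I / (\<alpha> $ I)\<^sup>2)"
        using \<theta> Q[of I] False by (intro powr_le_affine) auto
      then have "(\<alpha> $ I)\<^sup>2 * (Q I / (\<alpha> $ I)\<^sup>2) powr \<theta> \<le> (\<alpha> $ I)\<^sup>2 * (1 - \<theta> + \<theta> * (Q I / (\<alpha> $ I)\<^sup>2))"
        by (intro mult_left_mono) auto
      also have "\<dots> = (1 - \<theta>) * (\<alpha> $ I)\<^sup>2 + \<theta> * Q I" using False by (simp add: field_simps)
      finally show ?thesis using c by simp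
    qed
    then have "(\<Sum>I\<in>UNIV. (\<alpha> $ I)\<^sup>2 * (Q I / (\<alpha> $ I)\<^sup>2) powr \<theta>)
      \<le> (\<Sum>I\<in>UNIV. (1 - \<theta>) * (\<alpha> $ I)\<^sup>2 + \<theta> * (if card I = m then Q I else 0))" by (rule sum_mono)
    also have "\<dots> = (1 - \<theta>) + \<theta> * (\<Sum>I | card I = m. Q I)"
      by (simp add: sum.distrib sum_distrib_left[symmetric] sum1 sum.If_cases)
    also have "\<dots> \<le> (1 - \<theta>) * \<kappa> + \<theta> * \<kappa>"
      using \<kappa> \<theta> mult_left_mono[of 1 \<kappa> "1 - \<theta>"] by (intro add_mono mult_left_mono) (auto simp: Q_def)
    finally show ?thesis by (simp add: algebra_simps)
  qed
  have "e \<le> e * m" using e m by (simp add: mult_le_cancel_left1)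
  then have "(\<Sum>I\<in>UNIV. (\<alpha> $ I)\<^sup>2 * a I) \<le> \<kappa>" unfolding a_def using e by (intro moment) auto
  then show "eta e x \<alpha> \<bullet> \<alpha> \<le> \<kappa>" by (simp add: inner_vec_def eta_a power2_eq_square mult_ac)
  assume \<beta>: "0 \<le> \<beta>" and p: "p = 20 * real m / 7" "3 \<le> p"
    and b1: "9025/10000 \<le> \<beta> * p" and b2: "6.0492 \<le> \<beta> * p\<^sup>2"
  define \<theta> where "\<theta> = p * e / 2"
  have "\<theta> = 10 / 7 * (e * m)" by (simp add: \<theta>_def p(1))
  moreover have "0 \<le> e * m" using e by simp
  ultimately have \<theta>: "0 \<le> \<theta>" "\<theta> \<le> 1" using e by linarith+
  have bp: "(272/100) ^ m \<le> (71/50::real) powr p"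
  proof -
    \<comment> \<open>\<open>71/50\<close> is chosen for this inequality. The base
      \<open>272/100\<close> exceeds \<open>exp 1\<close>, so its powers outgrow
      \<open>m ^ m / fact m\<close> in the later estimate.\<close>
    have "(272/100::real) ^ 7 \<le> (71/50) ^ 20" by (simp add: power_numeral_reduce field_simps)
    then have "((272/100::real) ^ 7) powr (m / 7) \<le> ((71/50) ^ 20) powr (m / 7)" by (intro powr_mono2) auto
    moreover have r: "(c ^ n) powr r = c powr (real n * r)" if "0 < c" for c r :: real and n
      by (metis powr_powr powr_realpow that)
    have "((272/100::real) ^ 7) powr (m / 7) = (272/100) powr real m" by (subst r) auto
    moreover have "((71/50::real) ^ 20) powr (m / 7) = (71/50) powr p" by (subst r) (auto simp: p)
    ultimately show ?thesis by (simp add: powr_realpow)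
  qed
  have ineq: "(\<alpha> $ I)\<^sup>2 * (a I / (71/50)) powr p \<le> (\<alpha> $ I)\<^sup>2 * (Q I / (\<alpha> $ I)\<^sup>2) powr \<theta> / (272/100) ^ m" for I
  proof (cases "\<alpha> $ I = 0")
    case False
    have "a I powr p = (Q I / (\<alpha> $ I)\<^sup>2) powr \<theta>" by (simp add: a_def powr_powr \<theta>_def mult.commute)
    then have "(Q I / (\<alpha> $ I)\<^sup>2) powr \<theta> / (71/50) powr p = a I powr p / (71/50) powr p" by (rule arg_cong[symmetric])
    also have "\<dots> = (a I / (71/50)) powr p"
      by (rule powr_divide[symmetric])
    finally have "(a I / (71/50)) powr p = (Q I / (\<alpha> $ I)\<^sup>2) powr \<theta> / (71/50) powr p" by (rule sym)
    also have "\<dots> \<le> (Q I / (\<alpha> $ I)\<^sup>2) powr \<theta> / (272/100) ^ m"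
      using bp by (intro divide_left_mono) auto
    finally have "(\<alpha> $ I)\<^sup>2 * (a I / (71/50)) powr p \<le> (\<alpha> $ I)\<^sup>2 * ((Q I / (\<alpha> $ I)\<^sup>2) powr \<theta> / (272/100) ^ m)"
      by (rule mult_left_mono) simp
    then show ?thesis by (simp only: times_divide_eq_right)
  qed simp
  have "(norm (eta e x \<alpha> - (110225/100000) *\<^sub>R \<alpha>))\<^sup>2 = (\<Sum>I\<in>UNIV. (\<alpha> $ I)\<^sup>2 * (a I - 110225/100000)\<^sup>2)"
    unfolding power2_norm_eq_inner
    by (simp add: inner_vec_def eta_a power2_eq_square algebra_simps)
  also have "\<dots> \<le> (\<Sum>I\<in>UNIV. (\<alpha> $ I)\<^sup>2 * ((31775/100000)\<^sup>2 + \<beta> * (a I / (71/50)) powr p))"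
  proof (rule sum_mono)
    fix I show "(\<alpha> $ I)\<^sup>2 * (a I - 110225/100000)\<^sup>2 \<le> (\<alpha> $ I)\<^sup>2 * ((31775/100000)\<^sup>2 + \<beta> * (a I / (71/50)) powr p)"
    proof (cases "\<alpha> $ I = 0")
      case False
      show ?thesis
        by (rule mult_left_mono[OF tangent_power_bound[OF a_ge[OF False] b1 b2 \<beta> p(2)]]) simp
    qed simp
  qed
  also have "\<dots> = (31775/100000)\<^sup>2 + \<beta> * (\<Sum>I\<in>UNIV. (\<alpha> $ I)\<^sup>2 * (a I / (71/50)) powr p)"
    by (simp add: distrib_left sum.distrib sum_distrib_right[symmetric] sum1 sum_distrib_left mult_ac)
  also have "(\<Sum>I\<in>UNIV. (\<alpha> $ I)\<^sup>2 * (a I / (71/50)) powr p)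
      \<le> (\<Sum>I\<in>UNIV. (\<alpha> $ I)\<^sup>2 * (Q I / (\<alpha> $ I)\<^sup>2) powr \<theta> / (272/100) ^ m)"
    by (rule sum_mono) (rule ineq)
  also have "\<dots> \<le> \<kappa> / (272/100) ^ m"
    unfolding sum_divide_distrib[symmetric] using moment[OF \<theta>] by (rule divide_right_mono) simp
  finally show "(norm (eta e x \<alpha> - (110225/100000) *\<^sub>R \<alpha>))\<^sup>2 \<le> (31775/100000)\<^sup>2 + \<beta> * \<kappa> / (272/100) ^ m"
    using \<beta> by (simp add: mult_left_mono)
qed

text \<open>Coercivity of \<open>phi e\<close> is applied to \<open>\<alpha>\<close> and
  \<open>y = (s * k) *\<^sub>R \<beta>\<close> for both signs \<open>s\<close>. The factor
  \<open>k\<close> is chosen so that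
  \<open>eta e x y \<bullet> y = eta e x \<alpha> \<bullet> \<alpha>\<close>. As
  \<open>\<alpha>\<close> has the smaller value, \<open>k \<le> 1\<close>, so the bound
  \<open>mid\<close> survives the passage from \<open>\<beta>\<close> to \<open>y\<close>. The two
  signs give \<open>\<bar>u\<bar> \<le> 2 - D\<close> for a weighted sum \<open>u\<close> of the two
  normalised pairings, and four times their product is at most \<open>u\<^sup>2\<close>.\<close>

lemma cross_term_bound:
  fixes x :: "real ^ 'n" and \<alpha> \<beta> :: "real ^ 'n set"
  assumes x: "\<And>i. 0 < x $ i"
    and suppa: "\<And>I. card I \<noteq> m \<Longrightarrow> \<alpha> $ I = 0" and suppb: "\<And>I. card I \<noteq> m \<Longrightarrow> \<beta> $ I = 0"
    and mid: "\<And>I. card I = m \<Longrightarrow> \<bar>\<alpha> $ I\<bar> + \<bar>\<beta> $ I\<bar> \<le> 2 * (M * sqrt (\<Prod>i\<in>I. x $ i))"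
    and M: "0 < M" and e: "0 \<le> e" "e < 1" and unit: "\<alpha> \<bullet> \<alpha> = 1" "\<beta> \<bullet> \<beta> = 1"
    and Z: "0 < eta e x \<alpha> \<bullet> \<alpha>" "eta e x \<alpha> \<bullet> \<alpha> \<le> eta e x \<beta> \<bullet> \<beta>"
    and d: "0 \<le> d" "d \<le> (1 - e) * M powr (- e)"
  defines "D \<equiv> d * (1 - (\<alpha> \<bullet> \<beta>)\<^sup>2) / (eta e x \<alpha> \<bullet> \<alpha>)"
  shows "D \<le> 2" "D - D\<^sup>2 / 4
    \<le> 1 - (eta e x \<alpha> \<bullet> \<beta> / (eta e x \<alpha> \<bullet> \<alpha>)) * (eta e x \<beta> \<bullet> \<alpha> / (eta e x \<beta> \<bullet> \<beta>))"
proof -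
  define za zb pa pb where "za = eta e x \<alpha> \<bullet> \<alpha>" and "zb = eta e x \<beta> \<bullet> \<beta>"
    and "pa = eta e x \<alpha> \<bullet> \<beta>" and "pb = eta e x \<beta> \<bullet> \<alpha>"
  define k where "k = (za / zb) powr (1 / (2 - e))"
  have zz: "0 < za" "za \<le> zb" using Z by (auto simp: za_def zb_def)
  have k: "0 < k" "k \<le> 1"
    using zz e by (auto simp: k_def intro!: powr_le1)
  have kz: "k powr (2 - e) * zb = za" using zz e by (simp add: k_def powr_powr)
  have "k powr (2 - e) = k powr ((1 - e) + 1)" by simp
  also have "\<dots> = k powr (1 - e) * k" using k by (simp only: powr_add) simp
  finally have kk: "k powr (1 - e) * k = k powr (2 - e)" by simp
  have kz1: "k powr (1 - e) * zb = za / k" using kz k unfolding kk[symmetric] by (simp add: field_simps)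
  define C where "C = \<alpha> \<bullet> \<beta>"
  have "C\<^sup>2 \<le> 1" using Cauchy_Schwarz_ineq[of \<alpha> \<beta>] unit by (simp add: C_def)
  have sgn: "d * (1 - C\<^sup>2) \<le> 2 * za - s * (k * pa + za / k * (pb / zb))" if s: "s = 1 \<or> s = -1" for s :: real
  proof -
    define y where "y = (s * k) *\<^sub>R \<beta>"
    have ineq: "d * (\<alpha> $ I - y $ I)\<^sup>2 \<le> (eta e x \<alpha> $ I - eta e x y $ I) * (\<alpha> $ I - y $ I)" for I
    proof (cases "card I = m")
      case True
      define Q where "Q = (\<Prod>i\<in>I. x $ i)"
      have Q: "0 < Q" using x by (simp add: Q_def prod_pos)
      have "\<bar>y $ I\<bar> \<le> \<bar>\<beta> $ I\<bar>" using s k by (auto simp: y_def abs_mult mult_left_le_one_le)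
      then have "\<bar>\<alpha> $ I\<bar> + \<bar>y $ I\<bar> \<le> 2 * (M * sqrt Q)" using mid[OF True] by (simp add: Q_def)
      then have "(1 - e) * (M * sqrt Q) powr (- e) * (\<alpha> $ I - y $ I)\<^sup>2
          \<le> (phi e (\<alpha> $ I) - phi e (y $ I)) * (\<alpha> $ I - y $ I)"
        using e M Q by (intro phi_coercive) auto
      then have h1: "Q powr (e / 2) * ((1 - e) * (M * sqrt Q) powr (- e) * (\<alpha> $ I - y $ I)\<^sup>2)
          \<le> Q powr (e / 2) * ((phi e (\<alpha> $ I) - phi e (y $ I)) * (\<alpha> $ I - y $ I))"
        by (intro mult_left_mono) auto
      have qM: "Q powr (e / 2) * (M * sqrt Q) powr (- e) = M powr (- e)"
      proof -
        have "sqrt Q powr (- e) = Q powr (- e / 2)" using Q by (simp add: powr_half_sqrt[symmetric] powr_powr)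
        then show ?thesis using M Q by (simp add: powr_mult powr_add[symmetric])
      qed
      have "d * (\<alpha> $ I - y $ I)\<^sup>2 \<le> (1 - e) * M powr (- e) * (\<alpha> $ I - y $ I)\<^sup>2"
        using d by (intro mult_right_mono) auto
      also have "\<dots> = Q powr (e / 2) * ((1 - e) * (M * sqrt Q) powr (- e) * (\<alpha> $ I - y $ I)\<^sup>2)"
        unfolding qM[symmetric] by (simp only: mult_ac)
      also note h1
      finally show ?thesis by (simp add: eta_def Q_def[symmetric] algebra_simps)
    next
      case False
      then show ?thesis using suppa suppb by (simp add: y_def)
    qed
    have ey: "eta e x y = (s * k powr (1 - e)) *\<^sub>R eta e x \<beta>"
      using s k by (auto simp: vec_eq_iff eta_def y_def phi_mult phi_pos)
    \<comment> \<open>\<open>1 - C\<^sup>2\<close> is the squared distance from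
      \<open>\<alpha>\<close> to the line through \<open>\<beta>\<close>.\<close>
    have "d * (1 - C\<^sup>2) \<le> d * ((\<alpha> - y) \<bullet> (\<alpha> - y))"
    proof (intro mult_left_mono d)
      have "(\<alpha> - y) \<bullet> (\<alpha> - y) = 1 - 2 * (s * k) * C + (s * k)\<^sup>2"
        using unit by (simp add: y_def inner_diff_left inner_diff_right inner_commute[of \<beta> \<alpha>] C_def power2_eq_square algebra_simps)
      moreover have "0 \<le> (s * k - C)\<^sup>2" by simp
      ultimately show "1 - C\<^sup>2 \<le> (\<alpha> - y) \<bullet> (\<alpha> - y)" by (simp add: power2_diff)
    qed
    also have "\<dots> = (\<Sum>I\<in>UNIV. d * (\<alpha> $ I - y $ I)\<^sup>2)"
      by (simp add: inner_vec_def power2_eq_square sum_distrib_left)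
    also have "\<dots> \<le> (\<Sum>I\<in>UNIV. (eta e x \<alpha> $ I - eta e x y $ I) * (\<alpha> $ I - y $ I))"
      by (rule sum_mono) (rule ineq)
    also have "\<dots> = (eta e x \<alpha> - eta e x y) \<bullet> (\<alpha> - y)" by (simp add: inner_vec_def)
    also have "\<dots> = za - s * k * pa - s * k powr (1 - e) * pb + (s * s) * (k powr (1 - e) * k) * zb"
      by (simp add: ey inner_diff_left inner_diff_right za_def zb_def pa_def pb_def) (simp add: y_def algebra_simps)
    also note kk
    also have "za - s * k * pa - s * k powr (1 - e) * pb + (s * s) * k powr (2 - e) * zb
        = 2 * za - s * (k * pa + (k powr (1 - e) * zb) * (pb / zb))"
      using s zz kz by (auto simp: field_simps)
    finally show ?thesis unfolding kz1 .
  qed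
  define u where "u = k * (pa / za) + (pb / zb) / k"
  have uu: "k * pa + za / k * (pb / zb) = za * u" using zz by (simp add: u_def field_simps)
  have D: "D = d * (1 - C\<^sup>2) / za" by (simp add: D_def C_def za_def)
  have D0: "0 \<le> D" using d \<open>C\<^sup>2 \<le> 1\<close> zz by (simp add: D)
  have "D \<le> 2 - u" "D \<le> 2 + u"
    using sgn[of 1] sgn[of "- 1"] zz unfolding uu D by (simp_all add: field_simps)
  then show "D \<le> 2" by linarith
  have "\<bar>u\<bar> \<le> \<bar>2 - D\<bar>" using \<open>D \<le> 2 - u\<close> \<open>D \<le> 2 + u\<close> by linarith
  then have "u\<^sup>2 \<le> (2 - D)\<^sup>2" by (rule abs_le_square_iff[THEN iffD1])
  moreover have "4 * ((pa / za) * (pb / zb)) \<le> u\<^sup>2"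
  proof -
    have "0 \<le> (k * (pa / za) - (pb / zb) / k)\<^sup>2" by simp
    moreover have "(A + B)\<^sup>2 = (A - B)\<^sup>2 + 4 * (A * B)" for A B :: real
      by (simp add: power2_eq_square algebra_simps)
    then have "u\<^sup>2 = (k * (pa / za) - (pb / zb) / k)\<^sup>2 + 4 * (k * (pa / za) * ((pb / zb) / k))"
      by (simp only: u_def)
    moreover have "k * (pa / za) * ((pb / zb) / k) = (pa / za) * (pb / zb)" using k by simp
    ultimately show ?thesis by simp
  qed
  moreover have "(2 - D)\<^sup>2 = 4 - 4 * D + D\<^sup>2" by (simp add: power2_eq_square algebra_simps)
  ultimately show "D - D\<^sup>2 / 4
    \<le> 1 - (eta e x \<alpha> \<bullet> \<beta> / (eta e x \<alpha> \<bullet> \<alpha>)) * (eta e x \<beta> \<bullet> \<alpha> / (eta e x \<beta> \<bullet> \<beta>))"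
    unfolding za_def[symmetric] zb_def[symmetric] pa_def[symmetric] pb_def[symmetric]
    by linarith
qed

text \<open>The larger of \<open>t\<close> and \<open>t'\<close> belongs to the smaller
  normalisation and is the one that \<open>cross_term_bound\<close> controls. As
  \<open>t - t\<^sup>2 / 4\<close> increases up to \<open>2\<close>, the average is no larger. In
  this form each plane pays for its own error terms.\<close>

lemma cross_term_bound_symmetric:
  fixes x :: "real ^ 'n" and \<alpha> \<beta> :: "real ^ 'n set"
  assumes x: "\<And>i. 0 < x $ i"
    and suppa: "\<And>I. card I \<noteq> m \<Longrightarrow> \<alpha> $ I = 0" and suppb: "\<And>I. card I \<noteq> m \<Longrightarrow> \<beta> $ I = 0"
    and mid: "\<And>I. card I = m \<Longrightarrow> \<bar>\<alpha> $ I\<bar> + \<bar>\<beta> $ I\<bar> \<le> 2 * (M * sqrt (\<Prod>i\<in>I. x $ i))"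
    and M: "0 < M" and e: "0 \<le> e" "e < 1" and unit: "\<alpha> \<bullet> \<alpha> = 1" "\<beta> \<bullet> \<beta> = 1"
    and Z: "0 < eta e x \<alpha> \<bullet> \<alpha>" "0 < eta e x \<beta> \<bullet> \<beta>"
    and d: "0 \<le> d" "d \<le> (1 - e) * M powr (- e)"
  defines "t \<equiv> d * (1 - (\<alpha> \<bullet> \<beta>)\<^sup>2) / (eta e x \<alpha> \<bullet> \<alpha>)" and "t' \<equiv> d * (1 - (\<alpha> \<bullet> \<beta>)\<^sup>2) / (eta e x \<beta> \<bullet> \<beta>)"
  shows "t \<le> 2" "t' \<le> 2" "(t - t\<^sup>2 / 4) / 2 + (t' - t'\<^sup>2 / 4) / 2
    \<le> 1 - (eta e x \<alpha> \<bullet> \<beta> / (eta e x \<alpha> \<bullet> \<alpha>)) * (eta e x \<beta> \<bullet> \<alpha> / (eta e x \<beta> \<bullet> \<beta>))"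
proof -
  have X: "0 \<le> 1 - (\<alpha> \<bullet> \<beta>)\<^sup>2" using Cauchy_Schwarz_ineq[of \<alpha> \<beta>] unit by simp
  have avg: "a / 2 + b / 2 \<le> c" if "b \<le> a" "a \<le> c" for a b c :: real using that by simp
  have mono: "a - a\<^sup>2 / 4 \<le> b - b\<^sup>2 / 4" if "a \<le> b" "b \<le> 2" for a b :: real
  proof -
    have "0 \<le> (b - a) * (4 - (a + b))" using that by (intro mult_nonneg_nonneg) auto
    then show ?thesis by (simp add: power2_eq_square algebra_simps)
  qed
  have "t \<le> 2 \<and> t' \<le> 2 \<and> (t - t\<^sup>2 / 4) / 2 + (t' - t'\<^sup>2 / 4) / 2
    \<le> 1 - (eta e x \<alpha> \<bullet> \<beta> / (eta e x \<alpha> \<bullet> \<alpha>)) * (eta e x \<beta> \<bullet> \<alpha> / (eta e x \<beta> \<bullet> \<beta>))"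
  proof (cases "eta e x \<alpha> \<bullet> \<alpha> \<le> eta e x \<beta> \<bullet> \<beta>")
    case True
    have "t' \<le> t" unfolding t_def t'_def using True Z X d by (intro divide_left_mono) auto
    moreover have c: "t \<le> 2" "t - t\<^sup>2 / 4
        \<le> 1 - (eta e x \<alpha> \<bullet> \<beta> / (eta e x \<alpha> \<bullet> \<alpha>)) * (eta e x \<beta> \<bullet> \<alpha> / (eta e x \<beta> \<bullet> \<beta>))"
      unfolding t_def by (rule cross_term_bound[where m = m and M = M]; fact)+
    ultimately have "t' - t'\<^sup>2 / 4 \<le> t - t\<^sup>2 / 4" by (intro mono) auto
    from avg[OF this c(2)] show ?thesis using c(1) \<open>t' \<le> t\<close> by auto
  next
    case False
    have "t \<le> t'" unfolding t_def t'_def using False Z X d by (intro divide_left_mono) auto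
    have mid': "\<And>I. card I = m \<Longrightarrow> \<bar>\<beta> $ I\<bar> + \<bar>\<alpha> $ I\<bar> \<le> 2 * (M * sqrt (\<Prod>i\<in>I. x $ i))"
      using mid by (simp add: add.commute)
    have le: "eta e x \<beta> \<bullet> \<beta> \<le> eta e x \<alpha> \<bullet> \<alpha>" using False by simp
    have c: "t' \<le> 2" "t' - t'\<^sup>2 / 4
        \<le> 1 - (eta e x \<beta> \<bullet> \<alpha> / (eta e x \<beta> \<bullet> \<beta>)) * (eta e x \<alpha> \<bullet> \<beta> / (eta e x \<alpha> \<bullet> \<alpha>))"
      unfolding t'_def inner_commute[of \<alpha> \<beta>] by (rule cross_term_bound[where m = m and M = M]; fact)+
    have "t - t\<^sup>2 / 4 \<le> t' - t'\<^sup>2 / 4" using c \<open>t \<le> t'\<close> by (intro mono) auto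
    from avg[OF this c(2)] show ?thesis using c(1) \<open>t \<le> t'\<close> by (auto simp: mult.commute add.commute)
  qed
  then show "t \<le> 2" "t' \<le> 2" "(t - t\<^sup>2 / 4) / 2 + (t' - t'\<^sup>2 / 4) / 2
    \<le> 1 - (eta e x \<alpha> \<bullet> \<beta> / (eta e x \<alpha> \<bullet> \<alpha>)) * (eta e x \<beta> \<bullet> \<alpha> / (eta e x \<beta> \<bullet> \<beta>))" by auto
qed

section \<open>Numerical estimates\<close>

lemma near_center:
  fixes Z q S :: real
  assumes "q\<^sup>2 \<le> S - (Z - 110225/100000)\<^sup>2" "S \<le> 1512/10000" "1569/2000 \<le> Z"
  shows "Z \<le> 3/2" "Z\<^sup>2 \<le> 9/4"
proof -
  have "0 \<le> q\<^sup>2" by simp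
  then have "(Z - 110225/100000)\<^sup>2 \<le> 1512/10000" using assms by linarith
  also have "\<dots> \<le> (39/100)\<^sup>2" by (simp add: power2_eq_square)
  finally have "(Z - 110225/100000)\<^sup>2 \<le> (39/100)\<^sup>2" .
  then have "\<bar>Z - 110225/100000\<bar> \<le> \<bar>39/100\<bar>" by (rule abs_le_square_iff[THEN iffD2])
  then have "Z - 110225/100000 \<le> \<bar>39/100\<bar>" by (rule abs_le_D1)
  then show "Z \<le> 3/2" by simp
  then have "Z * Z \<le> 3/2 * (3/2)" using assms by (intro mult_mono) auto
  then show "Z\<^sup>2 \<le> 9/4" by (simp add: power2_eq_square)
qed

text \<open>
  The deficit is symmetric in the two planes, so it suffices that the share of one plane is positive. Here \<open>t\<close> comes
  from the coercive term, \<open>\<nu>\<close> is the norm of the deviation \<open>f\<close>, \<open>\<nu>\<^sup>2 * X\<close> bounds the bilinear term and \<open>2 * \<nu> * r\<close> the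
  linear one. For \<open>m = 2\<close> the deviation may be larger, but a better bound for \<open>r\<close> is available.
\<close>

lemma side_bound_plane:
  fixes Z \<nu> X g r :: real
  assumes Z: "1569/2000 \<le> Z" and \<nu>: "0 \<le> \<nu>" and s: "(\<nu> * Z)\<^sup>2 \<le> 1512/10000 - (Z - 110225/100000)\<^sup>2"
    and X: "0 \<le> X" "X \<le> 1" and g: "0 \<le> g" and r: "r \<le> (X + g) / 2"
  defines "t \<equiv> 65/100 * X / Z"
  shows "X / 200 \<le> t - t\<^sup>2 / 4 + g - 2 * \<nu> * r - \<nu>\<^sup>2 * X"
proof -
  note Z2 = near_center[OF s order.refl Z]
  have s': "(\<nu> * Z)\<^sup>2 \<le> 1512/10000 - (Z\<^sup>2 - 2 * (110225/100000) * Z + (110225/100000)\<^sup>2)"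
    using s by (simp only: power2_diff mult_ac)
  have Z0: "0 < Z" using Z by simp
  have \<nu>1: "\<nu> \<le> 1"
  proof -
    have "0 \<le> (Z - 11/10)\<^sup>2" by simp
    then have "(\<nu> * Z)\<^sup>2 \<le> Z\<^sup>2" using s' Z by (simp add: power2_diff power_divide)
    then have "\<nu> * Z \<le> Z" by (rule power2_le_imp_le) (use Z0 in simp)
    then show ?thesis using Z0 by simp
  qed
  define K where "K = 65/100 / Z - (65/100)\<^sup>2 / (4 * Z\<^sup>2) - \<nu> - \<nu>\<^sup>2"
  \<comment> \<open>The resulting bound for \<open>\<nu> * Z * Z\<close> is sharp at
    \<open>\<nu> = 4/11\<close>. The square centred at \<open>104544/100000\<close> sits, up to
    rounding, at the minimiser of the quadratic in \<open>Z\<close> that remains.\<close>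
  have "0 \<le> (11/4 * (\<nu> * Z) - Z)\<^sup>2" by simp
  then have "2 * (11/4) * (\<nu> * Z * Z) \<le> (11/4)\<^sup>2 * (\<nu> * Z)\<^sup>2 + Z\<^sup>2"
    by (simp add: power2_eq_square algebra_simps)
  moreover have "0 \<le> (Z - 104544/100000)\<^sup>2" by simp
  then have "0 \<le> Z\<^sup>2 - 2 * (104544/100000) * Z + (104544/100000)\<^sup>2" by (simp only: power2_diff mult_ac)
  ultimately have "Z\<^sup>2 / 200 \<le> 65/100 * Z - (65/100)\<^sup>2 / 4 - \<nu> * Z * Z - (\<nu> * Z)\<^sup>2"
    using s' Z2 by (simp add: power_divide)
  also have "\<dots> = K * Z\<^sup>2" using Z0 by (simp add: K_def power2_eq_square field_simps)
  finally have K: "1 / 200 \<le> K" using Z0 by (simp add: field_simps)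
  have "\<nu> * r \<le> \<nu> * ((X + g) / 2)" using r \<nu> by (rule mult_left_mono)
  moreover have "\<nu> * g \<le> 1 * g" using \<nu>1 g by (rule mult_right_mono)
  ultimately have 1: "2 * \<nu> * r \<le> \<nu> * X + g" by (simp add: algebra_simps)
  have "X\<^sup>2 \<le> X" using X by (simp add: power2_eq_square mult_left_le)
  then have "(65/100)\<^sup>2 * X\<^sup>2 / (4 * Z\<^sup>2) \<le> (65/100)\<^sup>2 * X / (4 * Z\<^sup>2)"
    by (intro divide_right_mono mult_left_mono) auto
  then have 2: "t\<^sup>2 / 4 \<le> (65/100)\<^sup>2 / (4 * Z\<^sup>2) * X"
    by (simp add: t_def power_divide power_mult_distrib mult.commute)
  have 3: "X * (1 / 200) \<le> X * K" using K X(1) by (rule mult_left_mono)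
  have 4: "X * K = t - (65/100)\<^sup>2 / (4 * Z\<^sup>2) * X - \<nu> * X - \<nu>\<^sup>2 * X"
    by (simp add: K_def t_def right_diff_distrib mult.commute)
  show ?thesis using 1 2 3 unfolding 4 by linarith
qed

lemma side_bound:
  fixes Z \<nu> X g r :: real
  assumes Z: "1569/2000 \<le> Z" and \<nu>: "0 \<le> \<nu>" and s: "(\<nu> * Z)\<^sup>2 \<le> 1246/10000 - (Z - 110225/100000)\<^sup>2"
    and X: "0 \<le> X" "X \<le> 1" and g: "0 \<le> g" and r: "0 \<le> r" "r\<^sup>2 \<le> X\<^sup>2 + 2 * g * X - g" "r\<^sup>2 \<le> g * (1 + X)"
  defines "t \<equiv> 704/1000 * X / Z"
  shows "X / 200 \<le> t - t\<^sup>2 / 4 + g - 2 * \<nu> * r - \<nu>\<^sup>2 * X"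
proof -
  have s': "(\<nu> * Z)\<^sup>2 \<le> 1246/10000 - (Z\<^sup>2 - 2 * (110225/100000) * Z + (110225/100000)\<^sup>2)"
    using s by (simp only: power2_diff mult_ac)
  have Z0: "0 < Z" using Z by simp
  note Z2 = near_center[OF s _ Z, simplified]
  have t2: "t\<^sup>2 / 4 = (704/1000)\<^sup>2 / (4 * Z\<^sup>2) * X\<^sup>2"
    by (simp add: t_def power_divide power_mult_distrib mult.commute)
  show ?thesis
  \<comment> \<open>For small \<open>X\<close> the two bounds on \<open>r\<close> are added. For
    large \<open>X\<close> the second one alone is used, and the remaining expression is concave in
    \<open>X\<close>, so the ends \<open>1/2\<close> and \<open>1\<close> decide.\<close>
  proof (cases "X \<le> 1/2")
    case True
    \<comment> \<open>Small enough for \<open>sqrt 2 * \<nu> * (3/2) \<le> 1\<close>, by which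
      \<open>g\<close> absorbs its share of the linear term.\<close>
    have \<nu>1: "\<nu> \<le> 47/100"
    proof -
      have "0 \<le> (Z - 9/10)\<^sup>2" by simp
      then have "(\<nu> * Z)\<^sup>2 \<le> (47/100)\<^sup>2 * Z\<^sup>2"
        using s' Z Z2 by (simp add: power2_diff power_divide)
      then have "\<nu> * Z \<le> 47/100 * Z" using Z0 unfolding power_mult_distrib[of "47/100", symmetric] by (rule_tac power2_le_imp_le) auto
      then show ?thesis using Z0 by simp
    qed
    define r2 where "r2 = sqrt (2::real)"
    have "sqrt 2 \<le> 141422/100000" by (rule real_le_lsqrt) (auto simp: power_divide)
    then have r2: "0 \<le> r2" "r2 * r2 = 2" "r2 \<le> 141422/100000" by (auto simp: r2_def)
    have "2 * r\<^sup>2 \<le> X\<^sup>2 + 3 * (g * X)" using r(2,3) by (simp add: algebra_simps)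
    also have "\<dots> \<le> (X + 3/2 * g)\<^sup>2" by (simp add: power2_eq_square algebra_simps)
    finally have "(r2 * r)\<^sup>2 \<le> (X + 3/2 * g)\<^sup>2" using r2 by (simp add: power_mult_distrib power2_eq_square[of r2])
    then have rr: "r2 * r \<le> X + 3/2 * g" by (rule power2_le_imp_le) (use X g in auto)
    have "2 * \<nu> * r = r2 * \<nu> * (r2 * r)" using r2(2) by (simp add: mult.assoc[symmetric])
    also have "\<dots> \<le> r2 * \<nu> * (X + 3/2 * g)" using rr r2 \<nu> by (intro mult_left_mono) auto
    also have "\<dots> \<le> r2 * \<nu> * X + g"
    proof -
      have "r2 * \<nu> \<le> 141422/100000 * (47/100)" using r2 \<nu> \<nu>1 by (intro mult_mono) auto
      then have "r2 * \<nu> * (3/2) \<le> 1" by simp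
      then have "r2 * \<nu> * (3/2) * g \<le> 1 * g" using g by (rule mult_right_mono)
      then show ?thesis by (simp add: algebra_simps)
    qed
    finally have 1: "2 * \<nu> * r \<le> r2 * \<nu> * X + g" .
    define K where "K = 704/1000 / Z - (704/1000)\<^sup>2 / (8 * Z\<^sup>2) - r2 * \<nu> - \<nu>\<^sup>2"
    have "0 \<le> (3 * (\<nu> * Z) - Z)\<^sup>2" by simp
    then have a: "6 * (\<nu> * Z * Z) \<le> 9 * (\<nu> * Z)\<^sup>2 + Z\<^sup>2"
      by (simp add: power2_eq_square algebra_simps)
    have b: "r2 * (\<nu> * Z * Z) \<le> 141422/100000 * (\<nu> * Z * Z)" using r2 \<nu> Z0 by (intro mult_right_mono) auto
    have "0 \<le> (Z - 107/100)\<^sup>2" by simp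
    then have c: "0 \<le> Z\<^sup>2 - 2 * (107/100) * Z + (107/100)\<^sup>2" by (simp only: power2_diff mult_ac)
    have "Z\<^sup>2 / 200 \<le> 704/1000 * Z - (704/1000)\<^sup>2 / 8 - r2 * (\<nu> * Z * Z) - (\<nu> * Z)\<^sup>2"
      using a b c s' Z2 by (simp add: power_divide)
    also have "\<dots> = K * Z\<^sup>2" using Z0 by (simp add: K_def power2_eq_square field_simps)
    finally have K: "1 / 200 \<le> K" using Z0 by (simp add: field_simps)
    have "X\<^sup>2 \<le> 1/2 * X" unfolding power2_eq_square using X True by (intro mult_right_mono) auto
    then have "(704/1000)\<^sup>2 / (4 * Z\<^sup>2) * X\<^sup>2 \<le> (704/1000)\<^sup>2 / (4 * Z\<^sup>2) * (1/2 * X)"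
      by (intro mult_left_mono) auto
    then have 2: "t\<^sup>2 / 4 \<le> (704/1000)\<^sup>2 / (8 * Z\<^sup>2) * X" unfolding t2 by simp
    have 3: "X * (1 / 200) \<le> X * K" using K X(1) by (rule mult_left_mono)
    have 4: "X * K = t - (704/1000)\<^sup>2 / (8 * Z\<^sup>2) * X - r2 * \<nu> * X - \<nu>\<^sup>2 * X"
      by (simp add: K_def t_def right_diff_distrib mult.commute)
    show ?thesis using 1 2 3 unfolding 4 by linarith
  next
    case False
    have "0 \<le> (\<nu> * (1 + X) - r)\<^sup>2" by simp
    then have "2 * \<nu> * r * (1 + X) \<le> \<nu>\<^sup>2 * (1 + X)\<^sup>2 + r\<^sup>2" by (simp add: power2_eq_square algebra_simps)
    also have "\<dots> \<le> (\<nu>\<^sup>2 * (1 + X) + g) * (1 + X)" using r(3) by (simp add: power2_eq_square algebra_simps)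
    finally have 1: "2 * \<nu> * r \<le> \<nu>\<^sup>2 * (1 + X) + g" by (rule mult_right_le_imp_le) (use X in simp)
    define E where "E = t - t\<^sup>2 / 4 - \<nu>\<^sup>2 * (1 + 2 * X)"
    define q where "q = 1246/10000 - (Z\<^sup>2 - 2 * (110225/100000) * Z + (110225/100000)\<^sup>2)"
    have "0 \<le> (Z - 1014/1000)\<^sup>2" "0 \<le> (Z - 985/1000)\<^sup>2" by simp_all
    then have z: "0 \<le> Z\<^sup>2 - 2 * (1014/1000) * Z + (1014/1000)\<^sup>2" "0 \<le> Z\<^sup>2 - 2 * (985/1000) * Z + (985/1000)\<^sup>2"
      by (simp_all only: power2_diff mult_ac)
    have f1: "2/100 \<le> 352/1000 * Z - (704/1000)\<^sup>2 / 16 - 2 * q"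
      using z(1) Z2 by (simp add: q_def power_divide)
    have f2: "2/100 \<le> 704/1000 * Z - (704/1000)\<^sup>2 / 4 - 3 * q"
      using z(2) Z by (simp add: q_def power_divide)
    \<comment> \<open>A concave quadratic in \<open>X\<close> is its chord between
      \<open>1/2\<close> and \<open>1\<close> plus a nonnegative multiple of
      \<open>(X - 1/2) * (1 - X)\<close>. The two chord ends are bounded in \<open>f1\<close> and
      \<open>f2\<close>.\<close>
    have interp: "a * X * Z - D * X\<^sup>2 / 4 - q * (1 + 2 * X)
        = (2 - 2 * X) * (a / 2 * Z - D / 16 - 2 * q) + (2 * X - 1) * (a * Z - D / 4 - 3 * q)
          + D / 4 * ((X - 1/2) * (1 - X))" for a D :: real
      by (simp add: power2_eq_square field_simps)
    have "(2 - 2 * X) * (2/100) \<le> (2 - 2 * X) * (704/1000 / 2 * Z - (704/1000)\<^sup>2 / 16 - 2 * q)"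
      using f1 X by (intro mult_left_mono) auto
    moreover have "(2 * X - 1) * (2/100) \<le> (2 * X - 1) * (704/1000 * Z - (704/1000)\<^sup>2 / 4 - 3 * q)"
      using f2 False by (intro mult_left_mono) auto
    moreover have "0 \<le> (704/1000)\<^sup>2 / 4 * ((X - 1/2) * (1 - X))" using X False by (intro mult_nonneg_nonneg) auto
    moreover have "2/100 \<le> a + b + c"
      if "(2 - 2 * X) * (2/100) \<le> a" "(2 * X - 1) * (2/100) \<le> b" "0 \<le> c" for a b c :: real
      using that unfolding left_diff_distrib by simp
    ultimately have "2/100 \<le> 704/1000 * X * Z - (704/1000)\<^sup>2 * X\<^sup>2 / 4 - q * (1 + 2 * X)"
      unfolding interp by blast
    also have "\<dots> \<le> 704/1000 * X * Z - (704/1000)\<^sup>2 * X\<^sup>2 / 4 - (\<nu> * Z)\<^sup>2 * (1 + 2 * X)"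
    proof -
      have "(\<nu> * Z)\<^sup>2 * (1 + 2 * X) \<le> q * (1 + 2 * X)"
        by (rule mult_right_mono) (use s' X in \<open>auto simp: q_def\<close>)
      then show ?thesis by linarith
    qed
    also have "\<dots> = E * Z\<^sup>2"
      unfolding E_def t2 using Z0 by (simp add: t_def power2_eq_square field_simps)
    finally have "2/100 \<le> E * Z\<^sup>2" .
    moreover have "X * Z\<^sup>2 \<le> 1 * (9/4)" using X Z2 by (intro mult_mono) auto
    ultimately have "X / 200 * Z\<^sup>2 \<le> E * Z\<^sup>2" by simp
    then have "X / 200 \<le> E" by (rule mult_right_le_imp_le) (use Z0 in simp)
    then show ?thesis using 1 unfolding E_def by (simp add: algebra_simps)
  qed
qed

text \<open>Two factors are treated jointly through \<open>(a k + b k) * (a l + b l)\<close> and the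
  inequality of means; the other \<open>m - 2\<close> are bounded one by one by
  \<open>2 * x i\<close>. This halves the constant \<open>2 powr (m / 2)\<close> that separate
  bounds for \<open>A\<close> and \<open>B\<close> would give.\<close>

lemma prod_pair_bound:
  fixes a b x :: "'k \<Rightarrow> real"
  assumes I: "finite I" "card I = m" "2 \<le> m"
    and ab: "\<And>i. i \<in> I \<Longrightarrow> 0 \<le> a i \<and> 0 \<le> b i \<and> a i + b i \<le> 2 * x i"
    and A: "0 \<le> A" "A\<^sup>2 \<le> (\<Prod>i\<in>I. a i)" and B: "0 \<le> B" "B\<^sup>2 \<le> (\<Prod>i\<in>I. b i)"
  shows "A + B \<le> 2 * (2 powr (m / 2 - 1) * sqrt (\<Prod>i\<in>I. x i))"
proof -
  obtain k where k: "k \<in> I" using I by fastforce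
  then have "card (I - {k}) = m - 1" using I by simp
  then obtain l where l: "l \<in> I - {k}" using I by (metis card.empty ex_in_conv diff_is_0_eq not_one_le_zero Suc_1 not_less_eq_eq One_nat_def)
  define J where "J = I - {k} - {l}"
  have cJ: "card J = m - 2" using I k l by (simp add: J_def)
  have split: "(\<Prod>i\<in>I. h i) = h k * h l * (\<Prod>i\<in>J. h i)" for h :: "'k \<Rightarrow> real"
    using I k l prod.remove[of I k h] prod.remove[of "I - {k}" l h] by (simp add: J_def)
  define L where "L = (\<Prod>i\<in>J. 2 * x i)"
  have L: "(\<Prod>i\<in>J. a i) \<le> L" "(\<Prod>i\<in>J. b i) \<le> L"
    unfolding L_def using ab by (intro prod_mono; force simp: J_def)+
  have x0: "0 \<le> x i" if "i \<in> I" for i using ab[OF that] by linarith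
  have L0: "0 \<le> L" unfolding L_def using x0 by (intro prod_nonneg) (auto simp: J_def)
  have kl: "0 \<le> a k" "0 \<le> b k" "0 \<le> a l" "0 \<le> b l" "a k + b k \<le> 2 * x k" "a l + b l \<le> 2 * x l"
    using ab k l by auto
  have A2: "A\<^sup>2 \<le> a k * a l * L" using A(2) L kl unfolding split[of a] by (meson mult_left_mono mult_nonneg_nonneg order_trans)
  have B2: "B\<^sup>2 \<le> b k * b l * L" using B(2) L kl unfolding split[of b] by (meson mult_left_mono mult_nonneg_nonneg order_trans)
  have AB: "A * B \<le> L * ((a k * b l + b k * a l) / 2)"
  proof (rule power2_le_imp_le)
    have "(A * B)\<^sup>2 \<le> (a k * a l * L) * (b k * b l * L)"
      unfolding power_mult_distrib using A2 B2 kl L0 by (intro mult_mono) auto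
    also have "\<dots> = L\<^sup>2 * ((a k * b l) * (b k * a l))" by (simp add: power2_eq_square)
    also have "\<dots> \<le> L\<^sup>2 * ((a k * b l + b k * a l) / 2)\<^sup>2"
    proof (rule mult_left_mono)
      have "0 \<le> (a k * b l - b k * a l)\<^sup>2" by simp
      then show "(a k * b l) * (b k * a l) \<le> ((a k * b l + b k * a l) / 2)\<^sup>2"
        by (simp add: power2_eq_square field_simps)
    qed simp
    finally show "(A * B)\<^sup>2 \<le> (L * ((a k * b l + b k * a l) / 2))\<^sup>2" by (simp only: power_mult_distrib)
  qed (use L0 kl in auto)
  have "(A + B)\<^sup>2 \<le> L * ((a k + b k) * (a l + b l))"
    using A2 B2 AB by (simp add: power2_sum algebra_simps)
  also have "\<dots> \<le> L * ((2 * x k) * (2 * x l))" using kl L0 by (intro mult_left_mono mult_mono) auto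
  also have "\<dots> = 2 ^ m * (\<Prod>i\<in>I. x i)"
  proof -
    have "L * ((2 * x k) * (2 * x l)) = (\<Prod>i\<in>I. 2 * x i)" by (simp add: split[of "\<lambda>i. 2 * x i"] L_def)
    then show ?thesis using I by (simp add: prod.distrib)
  qed
  also have "\<dots> = (2 * (2 powr (m / 2 - 1) * sqrt (\<Prod>i\<in>I. x i)))\<^sup>2"
  proof -
    have "0 \<le> (\<Prod>i\<in>I. x i)" using x0 by (rule prod_nonneg)
    moreover have "(2 powr (m / 2 - 1))\<^sup>2 * 4 = (2::real) ^ m"
    proof -
      have "(2 powr (m / 2 - 1))\<^sup>2 = 2 powr (m / 2 - 1) * (2::real) powr (m / 2 - 1)" by (simp add: power2_eq_square)
      also have "\<dots> = 2 powr (real m - 2)" by (simp add: powr_add[symmetric])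
      also have "\<dots> = 2 ^ m / 4" by (simp add: powr_diff powr_realpow)
      finally show ?thesis by simp
    qed
    ultimately show ?thesis by (simp add: power_mult_distrib mult_ac)
  qed
  finally show ?thesis by (rule power2_le_imp_le) (use x0 in \<open>simp add: prod_nonneg\<close>)
qed

text \<open>The quotient of consecutive left sides is \<open>(1 + 1 / m) ^ m\<close>, less than
  \<open>exp 1\<close>. The constant is the value at \<open>m = 3\<close> after division by
  \<open>(272/100) ^ 3\<close>, rounded up.\<close>

lemma power_self_over_fact:
  assumes "3 \<le> m"
  shows "real m ^ m / fact m \<le> 22362/100000 * (272/100) ^ m"
  using assms
proof (induction m rule: dec_induct)
  case base
  then show ?case by (simp add: fact_numeral power3_eq_cube)
next
  case (step m)
  have "(1 + 1 / real m) ^ m \<le> exp 1" using step by (intro exp_ge_one_plus_x_over_n_power_n) auto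
  then have 1: "(1 + 1 / real m) ^ m \<le> 272/100" using e_less_272 by linarith
  have "real (Suc m) ^ Suc m / fact (Suc m) = real (Suc m) ^ m / fact m"
    unfolding power_Suc fact_Suc of_nat_mult by (rule mult_divide_mult_cancel_left) simp
  also have "\<dots> = (real m * (1 + 1 / real m)) ^ m / fact m" using step by (simp add: distrib_left add.commute)
  also have "\<dots> = real m ^ m / fact m * (1 + 1 / real m) ^ m"
    by (simp add: power_mult_distrib)
  also have "\<dots> \<le> 22362/100000 * (272/100) ^ m * (272/100)"
    using step.IH 1 by (intro mult_mono) auto
  finally show ?case by simp
qed

text \<open>The exponent of \<open>2\<close> is at least \<open>e - 7/20\<close>, and the resulting
  lower bound decreases in \<open>e\<close>, so the extreme case is \<open>m = 3\<close> and
  \<open>e = 7/30\<close>. The true value there is about 0.707; the rest is lost in the linear bound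
  for the exponential.\<close>

lemma coercivity_constant:
  fixes e :: real
  assumes m: "3 \<le> m" and e: "0 \<le> e" "e * real m \<le> 7/10"
  shows "704/1000 \<le> (1 - e) * (2 powr (real m / 2 - 1)) powr (- e)"
proof -
  define y where "y = e * real m / 2 - e"
  have "e * 3 \<le> e * real m" using m e by (intro mult_left_mono) auto
  then have e3: "e \<le> 7/30" using e by linarith
  have y: "0 \<le> y" "y \<le> 7/20 - e" using e \<open>e * 3 \<le> e * real m\<close> by (auto simp: y_def)
  have "(2 powr (real m / 2 - 1)) powr (- e) = exp (- (y * ln 2))"
    by (simp add: powr_powr powr_def y_def algebra_simps)
  also have "\<dots> \<ge> 1 - y * ln 2" using exp_ge_add_one_self[of "- (y * ln 2)"] by simp
  finally have 1: "1 - y * ln 2 \<le> (2 powr (real m / 2 - 1)) powr (- e)" .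
  have "y * ln 2 \<le> (7/20 - e) * (25/36)" using y ln2_le_25_over_36 by (intro mult_mono) auto
  then have 2: "1 - (7/20 - e) * (25/36) \<le> (2 powr (real m / 2 - 1)) powr (- e)" using 1 by linarith
  have "0 \<le> e * (7/30 - e)" using e e3 by simp
  then have "e\<^sup>2 \<le> 7/30 * e" by (simp add: power2_eq_square algebra_simps)
  moreover have "(1 - e) * (1 - (7/20 - e) * (25/36)) = 1 - 35/144 - e / 16 - 25/36 * e\<^sup>2"
    by (simp add: power2_eq_square field_simps)
  ultimately have "704/1000 \<le> (1 - e) * (1 - (7/20 - e) * (25/36))" using e3 e by linarith
  also have "\<dots> \<le> (1 - e) * (2 powr (real m / 2 - 1)) powr (- e)" using 2 e3 by (intro mult_left_mono) auto
  finally show ?thesis .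
qed

text \<open>The whole estimate in the rescaled picture, where the given bases are principal. The
  slack \<open>1001/1000\<close> in \<open>sum\<close> pays for the positive lower bound imposed on
  the weights.\<close>

lemma weighted_trace_deficit:
  fixes v w :: "nat \<Rightarrow> real ^ 'n::{finite,linorder}" and y :: "real ^ 'n::{finite,linorder}"
  assumes pb: "principal_bases m v w c" and m: "1 \<le> m" and e: "0 \<le> e" "e * real m \<le> 7/10"
    and y: "\<And>i. 0 < y $ i" and lev: "\<And>i. (\<Sum>k<m. (v k $ i)\<^sup>2) + (\<Sum>k<m. (w k $ i)\<^sup>2) \<le> 2 * y $ i"
    and sum: "(\<Sum>i\<in>UNIV. y $ i) ^ m \<le> 1001/1000 * real m ^ m"
  defines "Z \<equiv> eta e y (W m v) \<bullet> W m v" and "Z' \<equiv> eta e y (W m w) \<bullet> W m w"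
  shows "0 < Z" "0 < Z'" "(1 - (W m v \<bullet> W m w)\<^sup>2) / 200
    \<le> m - (\<Sum>i<m. \<Sum>j<m. (eta e y (W m v) \<bullet> W m (v(i := w j)) / Z) * (eta e y (W m w) \<bullet> W m (w(j := v i)) / Z'))"
proof -
  interpret pb: principal_bases m v w c by (rule pb)
  define \<alpha> \<beta> where "\<alpha> = W m v" and "\<beta> = W m w"
  define \<eta> \<eta>' where "\<eta> = eta e y \<alpha>" and "\<eta>' = eta e y \<beta>"
  have ZZ: "Z = \<eta> \<bullet> \<alpha>" "Z' = \<eta>' \<bullet> \<beta>" by (auto simp: Z_def Z'_def \<eta>_def \<eta>'_def \<alpha>_def \<beta>_def)
  have unit: "\<alpha> \<bullet> \<alpha> = 1" "\<beta> \<bullet> \<beta> = 1" using pb.W_vv pb.W_ww by (auto simp: \<alpha>_def \<beta>_def)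
  have supp: "\<alpha> $ I = 0" "\<beta> $ I = 0" if "card I \<noteq> m" for I using that by (simp_all add: \<alpha>_def \<beta>_def wedge_0)
  define la lb where "la i = (\<Sum>k<m. (v k $ i)\<^sup>2)" and "lb i = (\<Sum>k<m. (w k $ i)\<^sup>2)" for i
  have l0: "0 \<le> la i" "0 \<le> lb i" "la i + lb i \<le> 2 * y $ i" for i
    using lev[of i] by (auto simp: la_def lb_def intro: sum_nonneg)
  have sqa: "(\<alpha> $ I)\<^sup>2 \<le> (\<Prod>i\<in>I. la i)" and sqb: "(\<beta> $ I)\<^sup>2 \<le> (\<Prod>i\<in>I. lb i)" if "card I = m" for I
    using wedge_sq_le_prod[OF pb.v that] wedge_sq_le_prod[OF pb.w that]
    by (auto simp: \<alpha>_def \<beta>_def la_def lb_def)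
  have pw: "(\<Prod>i\<in>I. la i) \<le> 2 ^ m * (\<Prod>i\<in>I. y $ i)" "(\<Prod>i\<in>I. lb i) \<le> 2 ^ m * (\<Prod>i\<in>I. y $ i)" if "card I = m" for I
  proof -
    have "la i \<le> 2 * y $ i" "lb i \<le> 2 * y $ i" for i using l0[of i] by linarith+
    then have "(\<Prod>i\<in>I. la i) \<le> (\<Prod>i\<in>I. 2 * y $ i)" "(\<Prod>i\<in>I. lb i) \<le> (\<Prod>i\<in>I. 2 * y $ i)"
      using l0 by (auto intro!: prod_mono)
    then show "(\<Prod>i\<in>I. la i) \<le> 2 ^ m * (\<Prod>i\<in>I. y $ i)" "(\<Prod>i\<in>I. lb i) \<le> 2 ^ m * (\<Prod>i\<in>I. y $ i)"
      using that by (simp_all add: prod.distrib)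
  qed
  define \<kappa> where "\<kappa> = 1001/1000 * (real m ^ m / fact m)"
  have \<kappa>: "(\<Sum>I | card I = m. \<Prod>i\<in>I. y $ i) \<le> \<kappa>" "1 \<le> \<kappa>"
  proof -
    have "(\<Sum>I | card I = m. \<Prod>i\<in>I. y $ i) \<le> (\<Sum>i\<in>UNIV. y $ i) ^ m / fact m"
      by (rule sum_prod_subsets_le) (simp add: less_imp_le y)
    also have "\<dots> \<le> (1001/1000 * real m ^ m) / fact m" using sum by (rule divide_right_mono) simp
    finally show "(\<Sum>I | card I = m. \<Prod>i\<in>I. y $ i) \<le> \<kappa>" by (simp add: \<kappa>_def)
    have "fact m \<le> real m ^ m" using fact_le_power[of m, where 'a = real] by simp
    then have "1 \<le> real m ^ m / fact m" by simp
    then show "1 \<le> \<kappa>" unfolding \<kappa>_def by linarith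
  qed
  have lea: "\<And>I. card I = m \<Longrightarrow> (\<alpha> $ I)\<^sup>2 \<le> 2 ^ m * (\<Prod>i\<in>I. y $ i)"
    by (rule order_trans[OF sqa pw(1)])
  have leb: "\<And>I. card I = m \<Longrightarrow> (\<beta> $ I)\<^sup>2 \<le> 2 ^ m * (\<Prod>i\<in>I. y $ i)"
    by (rule order_trans[OF sqb pw(2)])
  have ea: "1569/2000 \<le> Z" "Z \<le> \<kappa>"
    unfolding ZZ \<eta>_def by (rule eta_bounds[where m = m]; fact)+
  have ea3: "(norm (\<eta> - (110225/100000) *\<^sub>R \<alpha>))\<^sup>2 \<le> (31775/100000)\<^sup>2 + b * \<kappa> / (272/100) ^ m"
    if "0 \<le> b" "p = 20 * real m / 7" "3 \<le> p" "9025/10000 \<le> b * p" "6.0492 \<le> b * p\<^sup>2" for b p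
    unfolding \<eta>_def by (rule eta_bounds(3)[where m = m]; fact)
  have eb: "1569/2000 \<le> Z'" "Z' \<le> \<kappa>"
    unfolding ZZ \<eta>'_def by (rule eta_bounds[where m = m]; fact)+
  have eb3: "(norm (\<eta>' - (110225/100000) *\<^sub>R \<beta>))\<^sup>2 \<le> (31775/100000)\<^sup>2 + b * \<kappa> / (272/100) ^ m"
    if "0 \<le> b" "p = 20 * real m / 7" "3 \<le> p" "9025/10000 \<le> b * p" "6.0492 \<le> b * p\<^sup>2" for b p
    unfolding \<eta>'_def by (rule eta_bounds(3)[where m = m]; fact)
  have Zl: "1569/2000 \<le> Z" "1569/2000 \<le> Z'" and Zu: "Z \<le> \<kappa>" "Z' \<le> \<kappa>"
    using ea(1,2) eb(1,2) by auto
  then show Z0: "0 < Z" "0 < Z'" by auto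
  define f f' where "f = (1 / Z) *\<^sub>R \<eta> - \<alpha>" and "f' = (1 / Z') *\<^sub>R \<eta>' - \<beta>"
  have f: "f \<bullet> W m v = 0" "f' \<bullet> W m w = 0"
    using Z0 unit by (auto simp: f_def f'_def inner_diff_left \<alpha>_def[symmetric] \<beta>_def[symmetric] ZZ[symmetric])
  have af: "W m v + f = (1 / Z) *\<^sub>R \<eta>" "W m w + f' = (1 / Z') *\<^sub>R \<eta>'" by (simp_all add: f_def f'_def \<alpha>_def \<beta>_def)
  have X: "pb.X = 1 - (\<alpha> \<bullet> \<beta>)\<^sup>2" "0 \<le> pb.X" "pb.X \<le> 1"
    using pb.X_bounds by (auto simp: pb.X_def pb.W_vw \<alpha>_def \<beta>_def)
  have p: "pb.C + f \<bullet> W m w = \<eta> \<bullet> \<beta> / Z" "pb.C + f' \<bullet> W m v = \<eta>' \<bullet> \<alpha> / Z'"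
    using pb.W_vw by (simp_all add: f_def f'_def inner_diff_left \<alpha>_def \<beta>_def inner_commute[of "W m w" "W m v"])
  have F: "(1 - (\<eta> \<bullet> \<beta> / Z) * (\<eta>' \<bullet> \<alpha> / Z')) + pb.g - (norm f + norm f') * sqrt pb.\<rho>2
      - pb.X / 2 * ((norm f)\<^sup>2 + (norm f')\<^sup>2)
    \<le> m - (\<Sum>i<m. \<Sum>j<m. (\<eta> \<bullet> W m (v(i := w j)) / Z) * (\<eta>' \<bullet> W m (w(j := v i)) / Z'))"
    using pb.trace_deficit_lower_bound[OF f] unfolding af p by simp
  \<comment> \<open>Pythagoras: the distance from \<open>\<eta>\<close> to the line through
    \<open>\<alpha>\<close> is attained at \<open>Z *\<^sub>R \<alpha>\<close>, so measuring from
    any other multiple of \<open>\<alpha>\<close> adds exactly the subtracted square.\<close>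
  have dev: "(norm f * Z)\<^sup>2 = (norm (\<eta> - (110225/100000) *\<^sub>R \<alpha>))\<^sup>2 - (Z - 110225/100000)\<^sup>2"
    "(norm f' * Z')\<^sup>2 = (norm (\<eta>' - (110225/100000) *\<^sub>R \<beta>))\<^sup>2 - (Z' - 110225/100000)\<^sup>2"
  proof -
    have gen: "(norm ((1 / z) *\<^sub>R h - a) * z)\<^sup>2 = (norm (h - l *\<^sub>R a))\<^sup>2 - (z - l)\<^sup>2"
      if "z = h \<bullet> a" "a \<bullet> a = 1" "0 < z" for z l and h a :: "real ^ 'n set"
    proof -
      have "norm ((1 / z) *\<^sub>R h - a) * z = norm (z *\<^sub>R ((1 / z) *\<^sub>R h - a))" using that by simp
      also have "z *\<^sub>R ((1 / z) *\<^sub>R h - a) = h - z *\<^sub>R a" using that by (simp add: scaleR_diff_right)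
      finally have 1: "(norm ((1 / z) *\<^sub>R h - a) * z)\<^sup>2 = (norm (h - z *\<^sub>R a))\<^sup>2" by simp
      have 2: "(norm (h - k *\<^sub>R a))\<^sup>2 = h \<bullet> h - 2 * k * z + k\<^sup>2" for k
        unfolding power2_norm_eq_inner using that
        by (simp add: inner_diff_left inner_diff_right inner_commute[of a h] power2_eq_square algebra_simps)
      show ?thesis unfolding 1 2 by (simp add: power2_eq_square algebra_simps)
    qed
    show "(norm f * Z)\<^sup>2 = (norm (\<eta> - (110225/100000) *\<^sub>R \<alpha>))\<^sup>2 - (Z - 110225/100000)\<^sup>2"
      unfolding f_def by (rule gen) (use ZZ unit Z0 in auto)
    show "(norm f' * Z')\<^sup>2 = (norm (\<eta>' - (110225/100000) *\<^sub>R \<beta>))\<^sup>2 - (Z' - 110225/100000)\<^sup>2"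
      unfolding f'_def by (rule gen) (use ZZ unit Z0 in auto)
  qed
  have cross: "(t - t\<^sup>2 / 4) / 2 + (t' - t'\<^sup>2 / 4) / 2 \<le> 1 - (\<eta> \<bullet> \<beta> / Z) * (\<eta>' \<bullet> \<alpha> / Z')" "t \<le> 2" "t' \<le> 2"
    if "t = d * pb.X / Z" "t' = d * pb.X / Z'" "0 \<le> d" "d \<le> (1 - e) * M powr (- e)" "0 < M"
      "\<And>I. card I = m \<Longrightarrow> \<bar>\<alpha> $ I\<bar> + \<bar>\<beta> $ I\<bar> \<le> 2 * (M * sqrt (\<Prod>i\<in>I. y $ i))" for d M t t'
  proof -
    have "e * 1 \<le> e * real m" using m e by (intro mult_left_mono) auto
    then have e1: "e < 1" using e by linarith
    have Zp: "0 < eta e y \<alpha> \<bullet> \<alpha>" "0 < eta e y \<beta> \<bullet> \<beta>" using Z0 unfolding ZZ \<eta>_def \<eta>'_def by auto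
    show "(t - t\<^sup>2 / 4) / 2 + (t' - t'\<^sup>2 / 4) / 2 \<le> 1 - (\<eta> \<bullet> \<beta> / Z) * (\<eta>' \<bullet> \<alpha> / Z')" "t \<le> 2" "t' \<le> 2"
      unfolding that(1,2) X(1) ZZ \<eta>_def \<eta>'_def
      by (rule cross_term_bound_symmetric(3,1,2)[where m = m and M = M]; fact)+
  qed
  have goal: "pb.X / 200 \<le> m - (\<Sum>i<m. \<Sum>j<m. (\<eta> \<bullet> W m (v(i := w j)) / Z) * (\<eta>' \<bullet> W m (w(j := v i)) / Z'))"
  proof -
    have combine: ?thesis
      if "pb.X / 200 \<le> t - t\<^sup>2 / 4 + pb.g - 2 * norm f * sqrt pb.\<rho>2 - (norm f)\<^sup>2 * pb.X"
        "pb.X / 200 \<le> t' - t'\<^sup>2 / 4 + pb.g - 2 * norm f' * sqrt pb.\<rho>2 - (norm f')\<^sup>2 * pb.X"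
        "(t - t\<^sup>2 / 4) / 2 + (t' - t'\<^sup>2 / 4) / 2 \<le> 1 - (\<eta> \<bullet> \<beta> / Z) * (\<eta>' \<bullet> \<alpha> / Z')" for t t'
    proof -
      have lin: "x \<le> c + g - (n + n') * r - X / 2 * (k + k')"
        if "x \<le> s + g - 2 * n * r - k * X" "x \<le> s' + g - 2 * n' * r - k' * X" "s / 2 + s' / 2 \<le> c"
        for x s s' g n n' r k k' X c :: real
      proof -
        have e: "2 * n * r = 2 * (n * r)" "2 * n' * r = 2 * (n' * r)" "(n + n') * r = n * r + n' * r"
          "X / 2 * (k + k') = (k * X) / 2 + (k' * X) / 2" by (simp_all add: algebra_simps)
        show ?thesis using that unfolding e by linarith
      qed
      show ?thesis by (rule order_trans[OF lin[OF that] F])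
    qed
    have pair: "\<bar>\<alpha> $ I\<bar> + \<bar>\<beta> $ I\<bar> \<le> 2 * (2 powr (m / 2 - 1) * sqrt (\<Prod>i\<in>I. y $ i))" if "card I = m" "2 \<le> m" for I
      by (rule prod_pair_bound[of I m la lb]) (use that l0 sqa sqb in auto)
    have \<rho>2_nonneg: "0 \<le> pb.\<rho>2" using pb.R_bound(1)[OF f(1)] .
    consider "m = 1" | "m = 2" | "3 \<le> m" using m by linarith
    then show ?thesis
    proof cases
      \<comment> \<open>Replacing the only vector gives the Pluecker vector of the other plane, so
        the deficit is the cross term itself and no deviation has to be estimated. The factor
        \<open>3/10\<close> is a lower bound for \<open>1 - e\<close>.\<close>
      case 1
      have lin: "\<bar>\<alpha> $ I\<bar> + \<bar>\<beta> $ I\<bar> \<le> 2 * (1 * sqrt (\<Prod>i\<in>I. y $ i))" if I: "card I = m" for I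
      proof -
        obtain i where i: "I = {i}" using I 1 card_1_singletonE by blast
        have "(\<alpha> $ I)\<^sup>2 + (\<beta> $ I)\<^sup>2 \<le> 2 * y $ i" using sqa[OF I] sqb[OF I] l0[of i] by (simp add: i)
        moreover have "0 \<le> (\<bar>\<alpha> $ I\<bar> - \<bar>\<beta> $ I\<bar>)\<^sup>2" by simp
        ultimately have "(\<bar>\<alpha> $ I\<bar> + \<bar>\<beta> $ I\<bar>)\<^sup>2 \<le> 4 * y $ i"
          unfolding power2_sum power2_diff power2_abs by linarith
        also have "\<dots> = (2 * sqrt (y $ i))\<^sup>2" using y[of i] by (simp add: power_mult_distrib)
        finally have "\<bar>\<alpha> $ I\<bar> + \<bar>\<beta> $ I\<bar> \<le> 2 * sqrt (y $ i)"
          by (rule power2_le_imp_le) (use y[of i] in auto)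
        then show ?thesis by (simp add: i)
      qed
      define t t' where "t = 3/10 * pb.X / Z" and "t' = 3/10 * pb.X / Z'"
      have c: "(t - t\<^sup>2 / 4) / 2 + (t' - t'\<^sup>2 / 4) / 2 \<le> 1 - (\<eta> \<bullet> \<beta> / Z) * (\<eta>' \<bullet> \<alpha> / Z')" "t \<le> 2" "t' \<le> 2"
        using cross[OF t_def t'_def _ _ _ lin] e 1 by auto
      have tl: "pb.X / 50 \<le> s - s\<^sup>2 / 4" if "s = 3/10 * pb.X / z" "0 < z" "z \<le> 2" "s \<le> 2" for s z
      proof -
        have "3/10 * pb.X / 2 \<le> s" unfolding that(1) using that X by (intro divide_left_mono) auto
        moreover have "0 \<le> s" using that X by simp
        moreover then have "s * s \<le> 2 * s" using that by (intro mult_right_mono) auto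
        ultimately show ?thesis using X by (simp add: power2_eq_square)
      qed
      have "\<kappa> \<le> 2" by (simp add: \<kappa>_def 1)
      then have tt: "pb.X / 50 \<le> t - t\<^sup>2 / 4" "pb.X / 50 \<le> t' - t'\<^sup>2 / 4"
        using tl[OF t_def _ _ c(2)] tl[OF t'_def _ _ c(3)] Z0 Zu by auto
      have "W m (v(0 := w 0)) = \<beta>" "W m (w(0 := v 0)) = \<alpha>"
        unfolding \<alpha>_def \<beta>_def by (rule W_cong; simp add: 1)+
      then have S: "(\<Sum>i<m. \<Sum>j<m. (\<eta> \<bullet> W m (v(i := w j)) / Z) * (\<eta>' \<bullet> W m (w(j := v i)) / Z'))
          = (\<eta> \<bullet> \<beta> / Z) * (\<eta>' \<bullet> \<alpha> / Z')" by (simp add: 1)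
      have "real m = 1" by (simp add: 1)
      moreover have "x / 200 \<le> r - p"
        if "r = 1" "x / 50 \<le> a" "x / 50 \<le> b" "a / 2 + b / 2 \<le> 1 - p" "0 \<le> x" for x r a b p :: real
        using that by linarith
      ultimately show ?thesis unfolding S using tt c(1) X(2) by blast
    next
      case 2
      \<comment> \<open>For \<open>m = 2\<close> the constant \<open>M\<close> is \<open>1\<close>,
        so \<open>65/100\<close> is a lower bound for \<open>1 - e\<close>. At
        \<open>p = 40/7\<close> the quadratic constraint on \<open>b\<close> is the binding one;
        \<open>1853/10000\<close> is its threshold rounded up.\<close>
      have e2: "e \<le> 35/100" using e 2 by simp
      have S: "\<kappa> * (1853/10000) / (272/100) ^ m \<le> 1512/10000 - (31775/100000)\<^sup>2"
        by (simp add: \<kappa>_def 2 power2_eq_square)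
      have b: "3 \<le> 20 * real m / 7" "9025/10000 \<le> 1853/10000 * (20 * real m / 7)"
        "6.0492 \<le> 1853/10000 * (20 * real m / 7)\<^sup>2" by (simp_all add: 2 power2_eq_square)
      have sa: "(norm f * Z)\<^sup>2 \<le> 1512/10000 - (Z - 110225/100000)\<^sup>2"
        using ea3[OF _ refl b, simplified] S unfolding dev(1) \<eta>_def by (simp add: mult.commute)
      have sb: "(norm f' * Z')\<^sup>2 \<le> 1512/10000 - (Z' - 110225/100000)\<^sup>2"
        using eb3[OF _ refl b, simplified] S unfolding dev(2) \<eta>'_def by (simp add: mult.commute)
      have r: "sqrt pb.\<rho>2 \<le> (pb.X + pb.g) / 2"
        using pb.rho2_le_plane[OF 2] X pb.g_nonneg by (intro real_le_lsqrt) auto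
      show ?thesis
      proof (rule combine)
        show "pb.X / 200 \<le> 65/100 * pb.X / Z - (65/100 * pb.X / Z)\<^sup>2 / 4 + pb.g - 2 * norm f * sqrt pb.\<rho>2 - (norm f)\<^sup>2 * pb.X"
          by (rule side_bound_plane[OF Zl(1) norm_ge_zero sa X(2,3) pb.g_nonneg r])
        show "pb.X / 200 \<le> 65/100 * pb.X / Z' - (65/100 * pb.X / Z')\<^sup>2 / 4 + pb.g - 2 * norm f' * sqrt pb.\<rho>2 - (norm f')\<^sup>2 * pb.X"
          by (rule side_bound_plane[OF Zl(2) norm_ge_zero sb X(2,3) pb.g_nonneg r])
        show "(65/100 * pb.X / Z - (65/100 * pb.X / Z)\<^sup>2 / 4) / 2 + (65/100 * pb.X / Z' - (65/100 * pb.X / Z')\<^sup>2 / 4) / 2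
            \<le> 1 - (\<eta> \<bullet> \<beta> / Z) * (\<eta>' \<bullet> \<alpha> / Z')"
          by (rule cross[OF refl refl _ _ _ pair]) (use e2 2 in auto)
      qed
    next
      case 3
      \<comment> \<open>From \<open>p \<ge> 60/7\<close> on the linear constraint on
        \<open>b\<close> is the binding one; \<open>1053/10000\<close> is its threshold at
        \<open>60/7\<close> rounded up.\<close>
      have "\<kappa> * (1053/10000) \<le> 1001/1000 * (22362/100000 * (272/100) ^ m) * (1053/10000)"
        unfolding \<kappa>_def using power_self_over_fact[OF 3] by (intro mult_right_mono mult_left_mono) auto
      moreover have "k * (1053/10000) \<le> (1246/10000 - (31775/100000)\<^sup>2) * Y"
        if "k * (1053/10000) \<le> 1001/1000 * (22362/100000 * Y) * (1053/10000)" "0 < Y" for k Y :: real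
        using that by (simp add: power2_eq_square)
      ultimately have "\<kappa> * (1053/10000) \<le> (1246/10000 - (31775/100000)\<^sup>2) * (272/100) ^ m"
        by simp
      then have S: "\<kappa> * (1053/10000) / (272/100) ^ m \<le> 1246/10000 - (31775/100000)\<^sup>2"
        by (simp add: divide_le_eq power2_eq_square)
      have p: "60/7 \<le> 20 * real m / 7" using 3 by simp
      then have "60/7 * (60/7) \<le> (20 * real m / 7)\<^sup>2" unfolding power2_eq_square by (intro mult_mono) auto
      then have "1053/10000 * (60/7 * (60/7)) \<le> 1053/10000 * (20 * real m / 7)\<^sup>2" by (rule mult_left_mono) simp
      then have "6.0492 \<le> 1053/10000 * (20 * real m / 7)\<^sup>2" by (rule order_trans[rotated]) simp
      then have b: "3 \<le> 20 * real m / 7" "9025/10000 \<le> 1053/10000 * (20 * real m / 7)"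
        "6.0492 \<le> 1053/10000 * (20 * real m / 7)\<^sup>2" using p by linarith+
      have sa: "(norm f * Z)\<^sup>2 \<le> 1246/10000 - (Z - 110225/100000)\<^sup>2"
        using ea3[OF _ refl b, simplified] S unfolding dev(1) \<eta>_def by (simp add: mult.commute)
      have sb: "(norm f' * Z')\<^sup>2 \<le> 1246/10000 - (Z' - 110225/100000)\<^sup>2"
        using eb3[OF _ refl b, simplified] S unfolding dev(2) \<eta>'_def by (simp add: mult.commute)
      have r: "0 \<le> sqrt pb.\<rho>2" "(sqrt pb.\<rho>2)\<^sup>2 \<le> pb.X\<^sup>2 + 2 * pb.g * pb.X - pb.g" "(sqrt pb.\<rho>2)\<^sup>2 \<le> pb.g * (1 + pb.X)"
        using \<rho>2_nonneg pb.rho2_le1 pb.rho2_le2 by auto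
      show ?thesis
      proof (rule combine)
        show "pb.X / 200 \<le> 704/1000 * pb.X / Z - (704/1000 * pb.X / Z)\<^sup>2 / 4 + pb.g - 2 * norm f * sqrt pb.\<rho>2 - (norm f)\<^sup>2 * pb.X"
          by (rule side_bound[OF Zl(1) norm_ge_zero sa X(2,3) pb.g_nonneg r])
        show "pb.X / 200 \<le> 704/1000 * pb.X / Z' - (704/1000 * pb.X / Z')\<^sup>2 / 4 + pb.g - 2 * norm f' * sqrt pb.\<rho>2 - (norm f')\<^sup>2 * pb.X"
          by (rule side_bound[OF Zl(2) norm_ge_zero sb X(2,3) pb.g_nonneg r])
        show "(704/1000 * pb.X / Z - (704/1000 * pb.X / Z)\<^sup>2 / 4) / 2 + (704/1000 * pb.X / Z' - (704/1000 * pb.X / Z')\<^sup>2 / 4) / 2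
            \<le> 1 - (\<eta> \<bullet> \<beta> / Z) * (\<eta>' \<bullet> \<alpha> / Z')"
          by (rule cross[OF refl refl _ coercivity_constant[OF 3 e] _ pair]) (use 3 in auto)
      qed
    qed
  qed
  then show "(1 - (W m v \<bullet> W m w)\<^sup>2) / 200
    \<le> m - (\<Sum>i<m. \<Sum>j<m. (eta e y (W m v) \<bullet> W m (v(i := w j)) / Z) * (eta e y (W m w) \<bullet> W m (w(j := v i)) / Z'))"
    unfolding X(1) \<eta>_def \<eta>'_def \<alpha>_def \<beta>_def .
qed

section \<open>Principal vectors and joint weights\<close>

lemma orthonormal_inj_on:
  assumes "orthonormal m v"
  shows "inj_on v {..<m}"
proof (rule inj_onI)
  fix i j assume "i \<in> {..<m}" "j \<in> {..<m}" "v i = v j"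
  then show "i = j" using assms unfolding orthonormal_def by (metis lessThan_iff zero_neq_one)
qed

lemma orthonormal_independent:
  fixes v :: "nat \<Rightarrow> 'a::euclidean_space"
  assumes "orthonormal m v"
  shows "independent (v ` {..<m})"
proof (rule pairwise_orthogonal_independent)
  show "pairwise orthogonal (v ` {..<m})"
    using assms by (auto simp: pairwise_def orthogonal_def orthonormal_def)
  show "0 \<notin> v ` {..<m}"
    using assms by (auto simp: orthonormal_def) (metis inner_zero_left zero_neq_one)
qed

lemma dim_orthonormal:
  fixes v :: "nat \<Rightarrow> 'a::euclidean_space"
  assumes "orthonormal m v"
  shows "dim (v ` {..<m}) = m"
  using dim_eq_card_independent[OF orthonormal_independent[OF assms]] orthonormal_inj_on[OF assms]
  by (simp add: card_image)

lemma span_orthonormal: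
  fixes v :: "nat \<Rightarrow> 'a::euclidean_space"
  assumes v: "orthonormal m v" and V: "subspace V" "dim V = m" "\<And>i. i < m \<Longrightarrow> v i \<in> V"
  shows "span (v ` {..<m}) = V"
proof (rule subspace_dim_equal)
  show "span (v ` {..<m}) \<subseteq> V" using V by (intro span_minimal) auto
  show "dim V \<le> dim (span (v ` {..<m}))" using V dim_orthonormal[OF v] by (simp del: dim_span add: dim_span)
qed (use V in auto)

lemma span_family_lincomb:
  fixes v :: "nat \<Rightarrow> 'a::real_vector"
  assumes "x \<in> span (v ` {..<m})"
  shows "\<exists>g. x = (\<Sum>k<m. g k *\<^sub>R v k)"
  using assms
proof (induction rule: span_induct_alt)
  case base
  show ?case by (intro exI[of _ "\<lambda>_. 0"]) simp
next
  case (step c x y)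
  then obtain i g where i: "i < m" "x = v i" and g: "y = (\<Sum>k<m. g k *\<^sub>R v k)" by auto
  have "(\<Sum>k<m. (g(i := g i + c)) k *\<^sub>R v k) = (\<Sum>k<m. g k *\<^sub>R v k + (if k = i then c *\<^sub>R v i else 0))"
    by (intro sum.cong) (auto simp: scaleR_add_left)
  also have "\<dots> = c *\<^sub>R x + y" using i by (simp add: sum.distrib g)
  finally show ?case by metis
qed

text \<open>The first-order condition at a maximiser of the inner product with \<open>y\<close> on
  the unit sphere: the length of \<open>x + t *\<^sub>R u\<close> grows only quadratically in
  \<open>t\<close>, so a nonzero linear term \<open>t * b\<close> would win for small
  \<open>t\<close>.\<close>

lemma maximizer_orthogonal:
  fixes x u y :: "'a::real_inner"
  assumes x: "x \<bullet> x = 1" and xu: "x \<bullet> u = 0" and c: "0 \<le> x \<bullet> y"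
    and max: "\<And>t. (x + t *\<^sub>R u) \<bullet> y \<le> (x \<bullet> y) * norm (x + t *\<^sub>R u)"
  shows "u \<bullet> y = 0"
proof (rule ccontr)
  define c b a where "c = x \<bullet> y" and "b = u \<bullet> y" and "a = u \<bullet> u"
  assume "u \<bullet> y \<noteq> 0"
  then have b: "b \<noteq> 0" by (simp add: b_def)
  have c0: "0 \<le> c" "0 \<le> a" using c by (auto simp: c_def a_def)
  have le: "t * b \<le> c * a * t\<^sup>2" for t
  proof -
    have "(norm (x + t *\<^sub>R u))\<^sup>2 = 1 + a * t\<^sup>2"
      unfolding power2_norm_eq_inner using x xu
      by (simp add: inner_add_left inner_add_right inner_commute[of u x] a_def power2_eq_square)
    also have "\<dots> \<le> (1 + a * t\<^sup>2)\<^sup>2" using c0 by (simp add: power2_eq_square distrib_left distrib_right)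
    finally have "norm (x + t *\<^sub>R u) \<le> 1 + a * t\<^sup>2" by (rule power2_le_imp_le) (use c0 in simp)
    then have "c * norm (x + t *\<^sub>R u) \<le> c * (1 + a * t\<^sup>2)" using c0 by (rule_tac mult_left_mono)
    then show ?thesis using max[of t] by (simp add: inner_add_left c_def b_def algebra_simps)
  qed
  define t where "t = b / (2 * (c * a + 1))"
  have p: "0 < c * a + 1" using c0 by (simp add: add_nonneg_pos)
  have t: "t * (2 * (c * a + 1)) = b" using p by (simp add: t_def)
  have "t \<noteq> 0" using b p by (simp add: t_def)
  then have t2: "0 < t\<^sup>2" by simp
  have "t * b = (2 * (c * a + 1)) * t\<^sup>2" using t by (simp add: power2_eq_square mult.commute mult.left_commute)
  with le[of t] have "(2 * (c * a + 1)) * t\<^sup>2 \<le> (c * a) * t\<^sup>2" by simp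
  then have "2 * (c * a + 1) \<le> c * a" using t2 by simp
  moreover have "\<not> 2 * (d + 1) \<le> d" if "0 \<le> d" for d :: real using that by simp
  ultimately show False using mult_nonneg_nonneg[OF c0] by blast
qed

text \<open>A pair of unit vectors maximising the inner product is split off. By the first-order
  condition each of them is orthogonal to what remains of the other subspace, so the induction
  hypothesis applies to the two remainders. With \<open>V = U\<close> this also produces orthonormal
  bases.\<close>

lemma principal_vectors_exist:
  fixes V U :: "('a::euclidean_space) set"
  assumes "subspace V" "subspace U" "dim V = m" "dim U = m"
  shows "\<exists>v w c. orthonormal m v \<and> orthonormal m w \<and> (\<forall>i<m. v i \<in> V \<and> w i \<in> U \<and> 0 \<le> c i) \<and>
    (\<forall>i<m. \<forall>j<m. v i \<bullet> w j = (if i = j then c i else (0::real)))"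
  using assms
proof (induction m arbitrary: V U)
  case 0
  then show ?case by (simp add: orthonormal_def)
next
  case (Suc m)
  let ?S = "\<lambda>V. V \<inter> sphere (0::'a) 1"
  have ne: "?S V \<noteq> {}" if "subspace V" "dim V = Suc m" for V
  proof -
    have "\<not> V \<subseteq> {0}" using that by (metis dim_eq_0 nat.distinct(1))
    then obtain z where z: "z \<in> V" "z \<noteq> 0" by auto
    then have "(1 / norm z) *\<^sub>R z \<in> ?S V" using that by (auto intro: subspace_mul)
    then show ?thesis by blast
  qed
  have cmp: "compact (?S V)" if "subspace V" for V
    using closed_subspace[OF that] by (intro closed_Int_compact) auto
  have "\<exists>p\<in>?S V \<times> ?S U. \<forall>q\<in>?S V \<times> ?S U. fst q \<bullet> snd q \<le> fst p \<bullet> snd p"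
    using Suc.prems ne cmp
    by (intro continuous_attains_sup compact_Times continuous_intros) auto
  then obtain x y where xy: "x \<in> V" "y \<in> U" "norm x = 1" "norm y = 1"
    and max: "\<And>x' y'. x' \<in> V \<Longrightarrow> y' \<in> U \<Longrightarrow> norm x' = 1 \<Longrightarrow> norm y' = 1 \<Longrightarrow> x' \<bullet> y' \<le> x \<bullet> y"
    by (auto simp: dist_norm)
  have c0: "0 \<le> x \<bullet> y"
    using max[of "- x" y] max[of x y] xy Suc.prems by (simp add: subspace_neg)
  have maxv: "z \<bullet> y \<le> (x \<bullet> y) * norm z" if "z \<in> V" for z
  proof (cases "z = 0")
    case False
    then have "((1 / norm z) *\<^sub>R z) \<bullet> y \<le> x \<bullet> y"
      using that xy Suc.prems by (intro max) (auto intro: subspace_mul)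
    then show ?thesis using False by (simp add: field_simps)
  qed simp
  have maxu: "z \<bullet> x \<le> (y \<bullet> x) * norm z" if "z \<in> U" for z
  proof (cases "z = 0")
    case False
    then have "x \<bullet> ((1 / norm z) *\<^sub>R z) \<le> x \<bullet> y"
      using that xy Suc.prems by (intro max) (auto intro: subspace_mul)
    then show ?thesis using False by (simp add: field_simps inner_commute)
  qed simp
  define V' U' where "V' = {u \<in> V. \<forall>a\<in>span {x}. orthogonal a u}" and "U' = {u \<in> U. \<forall>a\<in>span {y}. orthogonal a u}"
  have x0: "x \<noteq> 0" "y \<noteq> 0" using xy by auto
  have sub: "subspace V'" "subspace U'"
    using Suc.prems by (auto simp: V'_def U'_def subspace_def orthogonal_def inner_add_right)
  have "dim V' + dim (span {x}) = dim V" "dim U' + dim (span {y}) = dim U"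
    unfolding V'_def U'_def using Suc.prems xy
    by (intro dim_subspace_orthogonal_to_vectors; auto intro: span_minimal[THEN subsetD])+
  then have dims: "dim V' = m" "dim U' = m" using x0 Suc.prems by auto
  have Vx: "u \<in> V" "x \<bullet> u = 0" if "u \<in> V'" for u
    using that span_base[of x "{x}"] by (auto simp: V'_def orthogonal_def)
  have Uy: "u \<in> U" "y \<bullet> u = 0" if "u \<in> U'" for u
    using that span_base[of y "{y}"] by (auto simp: U'_def orthogonal_def)
  have Vy: "u \<bullet> y = 0" if "u \<in> V'" for u
    using that Vx[OF that] xy c0 Suc.prems
    by (intro maximizer_orthogonal[of x u y] maxv) (auto simp: norm_eq_1 intro: subspace_add subspace_mul)
  have Ux: "u \<bullet> x = 0" if "u \<in> U'" for u
    using that Uy[OF that] xy c0 Suc.prems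
    by (intro maximizer_orthogonal[of y u x] maxu) (auto simp: norm_eq_1 inner_commute intro: subspace_add subspace_mul)
  from Suc.IH[OF sub dims] obtain v w c where vwc: "orthonormal m v" "orthonormal m w"
    "\<And>i. i < m \<Longrightarrow> v i \<in> V'" "\<And>i. i < m \<Longrightarrow> w i \<in> U'" "\<And>i. i < m \<Longrightarrow> 0 \<le> c i"
    "\<And>i j. i < m \<Longrightarrow> j < m \<Longrightarrow> v i \<bullet> w j = (if i = j then c i else 0)" by blast
  have xx: "x \<bullet> x = 1" "y \<bullet> y = 1" using xy by (auto simp: norm_eq_1)
  have "orthonormal (Suc m) (v(m := x))" "orthonormal (Suc m) (w(m := y))"
    using vwc(1,2) xx Vx(2)[OF vwc(3)] Uy(2)[OF vwc(4)]
    by (auto simp: orthonormal_def less_Suc_eq inner_commute)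
  moreover have "\<forall>i<Suc m. (v(m := x)) i \<in> V \<and> (w(m := y)) i \<in> U \<and> 0 \<le> (c(m := x \<bullet> y)) i"
    using vwc(3-5) Vx(1) Uy(1) xy c0 by (auto simp: less_Suc_eq)
  moreover have "\<forall>i<Suc m. \<forall>j<Suc m. (v(m := x)) i \<bullet> (w(m := y)) j = (if i = j then (c(m := x \<bullet> y)) i else 0)"
    using vwc(6) Vy[OF vwc(3)] Ux[OF vwc(4)] by (auto simp: less_Suc_eq inner_commute)
  ultimately show ?case by blast
qed

lemma principal_bases_exist:
  fixes V U :: "(real ^ 'n::{finite,linorder}) set"
  assumes "subspace V" "subspace U" "dim V = m" "dim U = m"
  obtains v w c where "principal_bases m v w c" "span (v ` {..<m}) = V" "span (w ` {..<m}) = U"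
proof -
  obtain v w c where *: "orthonormal m v" "orthonormal m w" "\<And>i. i < m \<Longrightarrow> v i \<in> V"
    "\<And>i. i < m \<Longrightarrow> w i \<in> U" "\<And>i. i < m \<Longrightarrow> 0 \<le> c i"
    "\<And>i j. i < m \<Longrightarrow> j < m \<Longrightarrow> v i \<bullet> w j = (if i = j then c i else (0::real))"
    using principal_vectors_exist[OF assms] by blast
  show ?thesis
  proof (rule that)
    show "principal_bases m v w c" using * by (unfold_locales) auto
    show "span (v ` {..<m}) = V" "span (w ` {..<m}) = U"
      by (rule span_orthonormal[OF *(1) assms(1,3) *(3)], assumption)
        (rule span_orthonormal[OF *(2) assms(2,4) *(4)], assumption)
  qed
qed

section \<open>Diagonal rescaling of the coordinates\<close>

definition scale :: "real ^ 'n \<Rightarrow> real ^ 'n \<Rightarrow> real ^ 'n" where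
  "scale r u = (\<chi> i. r $ i * u $ i)"

lemma scale_nth [simp]: "scale r u $ i = r $ i * u $ i"
  by (simp add: scale_def)

lemma linear_scale: "linear (scale r)"
  by (intro linearI) (simp_all add: vec_eq_iff algebra_simps)

lemma scale_scale_inverse:
  assumes "\<And>i. r $ i \<noteq> 0"
  shows "scale r (scale (\<chi> i. 1 / r $ i) u) = u" "scale (\<chi> i. 1 / r $ i) (scale r u) = u"
  using assms by (simp_all add: vec_eq_iff)

lemma wedge_scale:
  fixes v :: "nat \<Rightarrow> real ^ 'n::{finite,linorder}"
  shows "wedge m (\<lambda>j. scale r (v j)) I = (\<Prod>i\<in>I. r $ i) * wedge m v I"
proof (cases "card I = m")
  case True
  have "(\<Prod>j<m. scale r (v j) $ (sorted_list_of_set I ! p j))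
      = (\<Prod>i\<in>I. r $ i) * (\<Prod>j<m. v j $ (sorted_list_of_set I ! p j))" if p: "p permutes {..<m}" for p
  proof -
    have "bij_betw (\<lambda>k. sorted_list_of_set I ! p k) {..<m} I"
      using bij_betw_trans[OF permutes_imp_bij bij_betw_nth_sorted_list_of_set, of p m I] True p by (simp add: comp_def)
    from prod.reindex_bij_betw[OF this, of "\<lambda>i. r $ i"] show ?thesis by (simp add: prod.distrib)
  qed
  then show ?thesis using True by (simp add: wedge_def sum_distrib_left mult_ac)
qed (simp add: wedge_0)

text \<open>
  Passing to the rescaled planes turns \<open>phi e\<close> into \<open>eta e x\<close> and leaves the pairing unchanged, because
  \<open>r i powr (2 - e) = x i powr (- e / 2)\<close>.
\<close>

definition weight_scale :: "real \<Rightarrow> real ^ 'n \<Rightarrow> real ^ 'n" where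
  "weight_scale e x = (\<chi> i. x $ i powr (- e / (2 * (2 - e))))"

lemma eta_scaled_inner:
  fixes v u :: "nat \<Rightarrow> real ^ 'n::{finite,linorder}"
  assumes x: "\<And>i. 0 < x $ i" and e: "e < 1"
  shows "eta e x (W m (\<lambda>j. scale (weight_scale e x) (v j))) \<bullet> W m (\<lambda>j. scale (weight_scale e x) (u j))
    = (\<chi> I. phi e (wedge m v I)) \<bullet> W m u"
proof -
  have "((\<Prod>i\<in>I. x $ i) powr (e / 2)) * phi e (\<Prod>i\<in>I. weight_scale e x $ i) * (\<Prod>i\<in>I. weight_scale e x $ i) = 1" for I
  proof -
    have r: "0 < weight_scale e x $ i" for i using x[of i] by (simp add: weight_scale_def)
    define P where "P = (\<Prod>i\<in>I. weight_scale e x $ i)"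
    have "0 < P" unfolding P_def using r by (intro prod_pos) auto
    then have "phi e P * P = P powr (2 - e)" by (simp add: phi_mult_self)
    also have "P powr (2 - e) = (\<Prod>i\<in>I. weight_scale e x $ i powr (2 - e))"
      unfolding P_def using r by (simp add: prod_powr_distrib less_imp_le)
    also have "\<dots> = (\<Prod>i\<in>I. x $ i powr (- e / 2))"
    proof (intro prod.cong refl)
      have "- e / (2 * (2 - e)) * (2 - e) = - e / 2" using e by (simp add: field_simps)
      then show "weight_scale e x $ i powr (2 - e) = x $ i powr (- e / 2)" for i
        by (simp only: weight_scale_def vec_lambda_beta powr_powr)
    qed
    also have "\<dots> = (\<Prod>i\<in>I. x $ i) powr (- e / 2)" using x by (simp add: prod_powr_distrib less_imp_le)
    finally have "phi e P * P = (\<Prod>i\<in>I. x $ i) powr (- e / 2)" .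
    moreover have "0 < (\<Prod>i\<in>I. x $ i)" using x by (intro prod_pos) auto
    ultimately show ?thesis unfolding P_def[symmetric] by (simp add: mult.assoc powr_add[symmetric] less_imp_neq[THEN not_sym])
  qed
  then have "eta e x (W m (\<lambda>j. scale (weight_scale e x) (v j))) $ I * W m (\<lambda>j. scale (weight_scale e x) (u j)) $ I
    = phi e (wedge m v I) * wedge m u I" for I
    unfolding eta_def by (simp add: wedge_scale phi_mult)
      (metis (no_types, opaque_lifting) mult.assoc mult.commute mult.left_commute mult_1)
  then show ?thesis by (simp add: inner_vec_def)
qed

text \<open>The leverage score of the rescaled plane, by \<open>leverage_eq\<close>. Written with
  the Pluecker coordinates of a fixed basis it is visibly continuous in \<open>x\<close>, with no
  orthonormal basis of the rescaled plane to be chosen.\<close>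

definition leverage :: "nat \<Rightarrow> real \<Rightarrow> (nat \<Rightarrow> real ^ 'n::{finite,linorder}) \<Rightarrow> real ^ 'n::{finite,linorder} \<Rightarrow> 'n \<Rightarrow> real" where
  "leverage m e v x i =
    (\<Sum>I | i \<in> I. (wedge m (\<lambda>j. scale (weight_scale e x) (v j)) I)\<^sup>2)
      / (\<Sum>I\<in>UNIV. (wedge m (\<lambda>j. scale (weight_scale e x) (v j)) I)\<^sup>2)"

lemma weight_scale_bounds:
  assumes x: "h \<le> x $ i" "x $ i \<le> 1" and h: "0 < h" and e: "0 \<le> e" "e < 1"
  shows "1 \<le> weight_scale e x $ i" "weight_scale e x $ i \<le> h powr (- e / (2 * (2 - e)))"
proof -
  have a: "- e / (2 * (2 - e)) \<le> 0" using e by (simp add: divide_nonpos_pos)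
  have "x $ i powr (- e / (2 * (2 - e))) \<ge> 1 powr (- e / (2 * (2 - e)))"
    using a x h by (intro powr_mono2') auto
  then show "1 \<le> weight_scale e x $ i" by (simp add: weight_scale_def)
  show "weight_scale e x $ i \<le> h powr (- e / (2 * (2 - e)))"
    unfolding weight_scale_def using a x h by (simp add: powr_mono2')
qed

lemma sum_sq_wedge_scaled_pos:
  assumes v: "orthonormal m v" and r: "\<And>i. 1 \<le> r $ i"
  shows "1 \<le> (\<Sum>I\<in>UNIV. (wedge m (\<lambda>j. scale r (v j)) I)\<^sup>2)"
proof -
  have "1 = (\<Sum>I\<in>UNIV. (wedge m v I)\<^sup>2)"
    using norm_W_orthonormal[OF v] by (simp add: inner_vec_def power2_eq_square)
  also have "\<dots> \<le> (\<Sum>I\<in>UNIV. (wedge m (\<lambda>j. scale r (v j)) I)\<^sup>2)"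
  proof (rule sum_mono)
    fix I
    have "1 \<le> (\<Prod>i\<in>I. r $ i)" using r by (intro prod_ge_1) auto
    then have "1 \<le> (\<Prod>i\<in>I. r $ i)\<^sup>2" by (simp add: one_le_power)
    then have "1 * (wedge m v I)\<^sup>2 \<le> (\<Prod>i\<in>I. r $ i)\<^sup>2 * (wedge m v I)\<^sup>2" by (intro mult_right_mono) auto
    then show "(wedge m v I)\<^sup>2 \<le> (wedge m (\<lambda>j. scale r (v j)) I)\<^sup>2" by (simp add: wedge_scale power_mult_distrib)
  qed
  finally show ?thesis .
qed

text \<open>Brouwer's theorem on the cube of weights between \<open>h\<close> and \<open>1\<close>.
  Leverage scores are at most \<open>1\<close>, so the map preserves the cube; the cutoff
  \<open>h\<close> keeps the negative powers of the weights continuous and bounded.\<close>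

lemma joint_weights_exist:
  fixes v w :: "nat \<Rightarrow> real ^ 'n::{finite,linorder}"
  assumes v: "orthonormal m v" and w: "orthonormal m w" and h: "0 < h" "h \<le> 1" and e: "0 \<le> e" "e < 1"
  obtains x :: "(real, 'n) vec" where "\<And>i. h \<le> x $ i" "\<And>i. x $ i \<le> 1"
    "\<And>i. x $ i = max h ((leverage m e v x i + leverage m e w x i) / 2)"
proof -
  let ?B = "cbox (\<chi> i. h) (\<chi> i. 1) :: ((real, 'n) vec) set"
  let ?f = "\<lambda>x. \<chi> i. max h ((leverage m e v x i + leverage m e w x i) / 2)"
  have B: "x \<in> ?B \<longleftrightarrow> (\<forall>i. h \<le> x $ i \<and> x $ i \<le> 1)" for x by (simp add: mem_box_cart)
  have pos: "1 \<le> (\<Sum>I\<in>UNIV. (wedge m (\<lambda>j. scale (weight_scale e x) (u j)) I)\<^sup>2)"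
    if "orthonormal m u" "x \<in> ?B" for u x
  proof (rule sum_sq_wedge_scaled_pos[OF that(1)])
    fix i
    have "h \<le> x $ i" "x $ i \<le> 1" using that(2) B by auto
    then show "1 \<le> weight_scale e x $ i" using h(1) e by (rule weight_scale_bounds(1))
  qed
  have cont: "continuous_on ?B (\<lambda>x. leverage m e u x i)" if u: "orthonormal m u" for u i
    unfolding leverage_def
  proof (intro continuous_on_divide continuous_on_sum continuous_on_power ballI)
    fix I
    have ne: "x $ j \<noteq> 0" if "x \<in> ?B" for x j using that h B by (metis less_le_not_le)
    show "continuous_on ?B (\<lambda>x. wedge m (\<lambda>j. scale (weight_scale e x) (u j)) I)"
      unfolding wedge_scale weight_scale_def vec_lambda_beta using ne
      by (intro continuous_intros) auto
    then show "continuous_on ?B (\<lambda>x. wedge m (\<lambda>j. scale (weight_scale e x) (u j)) I)" .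
  next
    fix x assume "x \<in> ?B"
    then show "(\<Sum>I\<in>UNIV. (wedge m (\<lambda>j. scale (weight_scale e x) (u j)) I)\<^sup>2) \<noteq> 0"
      using pos[OF u] by fastforce
  qed
  have le1: "leverage m e u x i \<le> 1" if "orthonormal m u" "x \<in> ?B" for u x i
  proof -
    have "(\<Sum>I | i \<in> I. (wedge m (\<lambda>j. scale (weight_scale e x) (u j)) I)\<^sup>2)
      \<le> (\<Sum>I\<in>UNIV. (wedge m (\<lambda>j. scale (weight_scale e x) (u j)) I)\<^sup>2)" by (intro sum_mono2) auto
    then show ?thesis using pos[OF that] by (simp add: leverage_def divide_le_eq)
  qed
  obtain x where x: "x \<in> ?B" "?f x = x"
  proof (rule brouwer[of ?B ?f])
    have "(\<chi> i. 1) \<in> ?B" unfolding B using h by simp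
    then show "?B \<noteq> {}" by blast
    show "continuous_on ?B ?f"
      by (intro continuous_on_vec_lambda continuous_on_max continuous_on_const continuous_on_divide
          continuous_on_add cont v w) auto
    show "?f \<in> ?B \<rightarrow> ?B"
    proof
      fix x assume x: "x \<in> ?B"
      have "leverage m e v x i + leverage m e w x i \<le> 2" for i
        using le1[OF v x, of i] le1[OF w x, of i] by linarith
      then show "?f x \<in> ?B" unfolding B using h by simp
    qed
  qed auto
  have fx: "max h ((leverage m e v x i + leverage m e w x i) / 2) = x $ i" for i
    using arg_cong[OF x(2), of "\<lambda>y. y $ i"] by simp
  show ?thesis
    by (rule that[of x]) (use x(1) B fx in auto)
qed

lemma W_same_span:
  assumes "\<And>i. i < m \<Longrightarrow> p i \<in> span (v ` {..<m})"
  shows "\<exists>k. W m p = k *\<^sub>R W m v"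
proof -
  have "\<forall>i. \<exists>g. i < m \<longrightarrow> p i = (\<Sum>k<m. g k *\<^sub>R v k)"
    using assms span_family_lincomb by blast
  then obtain G where G: "\<And>i. i < m \<longrightarrow> p i = (\<Sum>k<m. G i k *\<^sub>R v k)" by metis
  have "W m p = ldet m G *\<^sub>R W m v" by (rule W_lincomb) (use G in blast)
  then show ?thesis by blast
qed

text \<open>Bases of the same plane have proportional Pluecker vectors, and the factor cancels in
  the quotient. For the orthonormal basis \<open>p\<close> the score is given by
  \<open>sum_wedge_sq_containing\<close>.\<close>

lemma leverage_eq:
  fixes v p :: "nat \<Rightarrow> real ^ 'n::{finite,linorder}"
  assumes p: "orthonormal m p" and span: "\<And>i. i < m \<Longrightarrow> p i \<in> span ((\<lambda>j. scale (weight_scale e x) (v j)) ` {..<m})"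
  shows "leverage m e v x i = (\<Sum>k<m. (p k $ i)\<^sup>2)"
proof -
  let ?u = "\<lambda>j. scale (weight_scale e x) (v j)"
  obtain k where k: "W m p = k *\<^sub>R W m ?u" using W_same_span[where p = p, OF span] by blast
  have wk: "(wedge m p I)\<^sup>2 = k\<^sup>2 * (wedge m ?u I)\<^sup>2" for I
    using arg_cong[OF k, of "\<lambda>z. (z $ I)\<^sup>2"] by (simp add: power_mult_distrib)
  have "1 = (\<Sum>I\<in>UNIV. (wedge m p I)\<^sup>2)"
    using norm_W_orthonormal[OF p] by (simp add: inner_vec_def power2_eq_square)
  then have 1: "k\<^sup>2 * (\<Sum>I\<in>UNIV. (wedge m ?u I)\<^sup>2) = 1" by (simp add: wk sum_distrib_left)
  have "(\<Sum>k<m. (p k $ i)\<^sup>2) = (\<Sum>I | i \<in> I. (wedge m p I)\<^sup>2)" using sum_wedge_sq_containing[OF p] by simp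
  also have "\<dots> = k\<^sup>2 * (\<Sum>I | i \<in> I. (wedge m ?u I)\<^sup>2)" by (simp add: wk sum_distrib_left)
  also have "\<dots> = leverage m e v x i"
  proof -
    have n0: "(\<Sum>I\<in>UNIV. (wedge m ?u I)\<^sup>2) \<noteq> 0" using 1 by auto
    have "k\<^sup>2 = 1 / (\<Sum>I\<in>UNIV. (wedge m ?u I)\<^sup>2)"
      using nonzero_divide_eq_eq[OF n0, THEN iffD2, OF 1[symmetric]] by simp
    then show ?thesis unfolding leverage_def by simp
  qed
  finally show ?thesis by simp
qed

text \<open>Lagrange's identity writes the defect in the Cauchy-Schwarz inequality as half the sum
  of all squared 2 by 2 minors, and scaling multiplies the minor of \<open>k\<close> and
  \<open>l\<close> by \<open>r k * r l\<close>, which is at least \<open>1\<close>.\<close>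

lemma lagrange_scaled:
  fixes a b r :: "'k \<Rightarrow> real"
  assumes K: "finite K" and r: "\<And>k. k \<in> K \<Longrightarrow> 1 \<le> r k"
  shows "(\<Sum>k\<in>K. (a k)\<^sup>2) * (\<Sum>k\<in>K. (b k)\<^sup>2) - (\<Sum>k\<in>K. a k * b k)\<^sup>2
    \<le> (\<Sum>k\<in>K. (r k * a k)\<^sup>2) * (\<Sum>k\<in>K. (r k * b k)\<^sup>2) - (\<Sum>k\<in>K. (r k * a k) * (r k * b k))\<^sup>2"
proof -
  have lag: "2 * ((\<Sum>k\<in>K. (a k)\<^sup>2) * (\<Sum>k\<in>K. (b k)\<^sup>2) - (\<Sum>k\<in>K. a k * b k)\<^sup>2)
    = (\<Sum>k\<in>K. \<Sum>l\<in>K. (a k * b l - a l * b k)\<^sup>2)" for a b :: "'k \<Rightarrow> real"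
  proof -
    have "(\<Sum>k\<in>K. \<Sum>l\<in>K. (a k * b l - a l * b k)\<^sup>2)
      = (\<Sum>k\<in>K. \<Sum>l\<in>K. (a k)\<^sup>2 * (b l)\<^sup>2) + (\<Sum>k\<in>K. \<Sum>l\<in>K. (b k)\<^sup>2 * (a l)\<^sup>2)
        - 2 * (\<Sum>k\<in>K. \<Sum>l\<in>K. (a k * b k) * (a l * b l))"
      by (simp add: power2_diff sum.distrib sum_subtractf sum_distrib_left power_mult_distrib mult_ac)
    also have "\<dots> = 2 * ((\<Sum>k\<in>K. (a k)\<^sup>2) * (\<Sum>k\<in>K. (b k)\<^sup>2) - (\<Sum>k\<in>K. a k * b k)\<^sup>2)"
      by (simp add: sum_product[symmetric] power2_eq_square[of "sum _ _"])
    finally show ?thesis by simp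
  qed
  have "(\<Sum>k\<in>K. \<Sum>l\<in>K. (a k * b l - a l * b k)\<^sup>2)
    \<le> (\<Sum>k\<in>K. \<Sum>l\<in>K. ((r k * a k) * (r l * b l) - (r l * a l) * (r k * b k))\<^sup>2)"
  proof (intro sum_mono)
    fix k l assume kl: "k \<in> K" "l \<in> K"
    have "1 * 1 \<le> r k * r l" using r kl by (intro mult_mono) (auto intro: order_trans[of 0 1])
    then have "1 \<le> (r k * r l)\<^sup>2" by (simp add: one_le_power)
    then have "1 * (a k * b l - a l * b k)\<^sup>2 \<le> (r k * r l)\<^sup>2 * (a k * b l - a l * b k)\<^sup>2"
      by (intro mult_right_mono) auto
    also have "\<dots> = ((r k * a k) * (r l * b l) - (r l * a l) * (r k * b k))\<^sup>2"
    proof -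
      have "(r k * a k) * (r l * b l) - (r l * a l) * (r k * b k) = (r k * r l) * (a k * b l - a l * b k)"
        by (simp add: algebra_simps)
      then show ?thesis by (simp only: power_mult_distrib)
    qed
    finally show "(a k * b l - a l * b k)\<^sup>2 \<le> ((r k * a k) * (r l * b l) - (r l * a l) * (r k * b k))\<^sup>2" by simp
  qed
  then show ?thesis unfolding lag[symmetric] by simp
qed

text \<open>Carries the angle estimate back to the original planes. Scaling can only enlarge the
  Cauchy-Schwarz defect of the two unit Pluecker vectors, and normalising afterwards divides by two
  squared lengths of at most \<open>(B ^ CARD('n))\<^sup>2\<close> each.\<close>

lemma scaled_angle_bound:
  fixes v w p q :: "nat \<Rightarrow> real ^ 'n::{finite,linorder}"
  assumes v: "orthonormal m v" and w: "orthonormal m w" and p: "orthonormal m p" and q: "orthonormal m q"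
    and pv: "\<And>i. i < m \<Longrightarrow> p i \<in> span ((\<lambda>j. scale r (v j)) ` {..<m})"
    and qw: "\<And>i. i < m \<Longrightarrow> q i \<in> span ((\<lambda>j. scale r (w j)) ` {..<m})"
    and r: "\<And>i. 1 \<le> r $ i" "\<And>i. r $ i \<le> B"
  shows "1 - (W m v \<bullet> W m w)\<^sup>2 \<le> (B ^ CARD('n)) ^ 4 * (1 - (W m p \<bullet> W m q)\<^sup>2)"
proof -
  define R where "R I = (\<Prod>i\<in>I. r $ i)" for I
  have R1: "1 \<le> R I" for I unfolding R_def using r by (intro prod_ge_1) auto
  have B1: "1 \<le> B" using r(1)[of undefined] r(2)[of undefined] by linarith
  have RB: "R I \<le> B ^ CARD('n)" for I
  proof -
    have "R I \<le> (\<Prod>i\<in>I. B)" unfolding R_def using r by (intro prod_mono) (auto intro: order_trans[of 0 1])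
    also have "\<dots> \<le> B ^ CARD('n)" using B1 by (simp add: power_increasing card_mono)
    finally show ?thesis .
  qed
  obtain k where k: "W m p = k *\<^sub>R W m (\<lambda>j. scale r (v j))" using W_same_span[where p = p, OF pv] by blast
  obtain l where l: "W m q = l *\<^sub>R W m (\<lambda>j. scale r (w j))" using W_same_span[where p = q, OF qw] by blast
  define a b where "a I = wedge m v I" and "b I = wedge m w I" for I
  have kp: "wedge m p I = k * (R I * a I)" and lq: "wedge m q I = l * (R I * b I)" for I
    using arg_cong[OF k, of "\<lambda>z. z $ I"] arg_cong[OF l, of "\<lambda>z. z $ I"] by (simp_all add: wedge_scale R_def a_def b_def)
  have n: "(\<Sum>I\<in>UNIV. (a I)\<^sup>2) = 1" "(\<Sum>I\<in>UNIV. (b I)\<^sup>2) = 1"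
    using norm_W_orthonormal[OF v] norm_W_orthonormal[OF w]
    by (simp_all add: inner_vec_def power2_eq_square a_def b_def)
  define A2 B2 C2 where "A2 = (\<Sum>I\<in>UNIV. (R I * a I)\<^sup>2)" and "B2 = (\<Sum>I\<in>UNIV. (R I * b I)\<^sup>2)"
    and "C2 = (\<Sum>I\<in>UNIV. (R I * a I) * (R I * b I))"
  have kk: "k\<^sup>2 * A2 = 1" "l\<^sup>2 * B2 = 1"
    using norm_W_orthonormal[OF p] norm_W_orthonormal[OF q]
    by (simp_all add: inner_vec_def kp lq A2_def B2_def sum_distrib_left power2_eq_square mult_ac)
  have c: "W m p \<bullet> W m q = k * l * C2"
    by (simp add: inner_vec_def kp lq C2_def sum_distrib_left mult_ac)
  have Y: "1 - (W m p \<bullet> W m q)\<^sup>2 = k\<^sup>2 * l\<^sup>2 * (A2 * B2 - C2\<^sup>2)"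
  proof -
    have "k\<^sup>2 * l\<^sup>2 * (A2 * B2 - C2\<^sup>2) = (k\<^sup>2 * A2) * (l\<^sup>2 * B2) - (k * l * C2)\<^sup>2"
      by (simp add: power_mult_distrib algebra_simps)
    then show ?thesis unfolding kk c by simp
  qed
  have "1 - (W m v \<bullet> W m w)\<^sup>2 \<le> A2 * B2 - C2\<^sup>2"
    using lagrange_scaled[of UNIV R a b] R1 n by (simp add: A2_def B2_def C2_def inner_vec_def a_def b_def)
  also have "A2 * B2 - C2\<^sup>2 = A2 * B2 * (1 - (W m p \<bullet> W m q)\<^sup>2)"
  proof -
    have "A2 * B2 * (1 - (W m p \<bullet> W m q)\<^sup>2) = (k\<^sup>2 * A2) * (l\<^sup>2 * B2) * (A2 * B2 - C2\<^sup>2)"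
      unfolding Y by (simp only: mult_ac)
    then show ?thesis unfolding kk by simp
  qed
  also have "\<dots> \<le> (B ^ CARD('n)) ^ 4 * (1 - (W m p \<bullet> W m q)\<^sup>2)"
  proof (rule mult_right_mono)
    have sq: "(R I)\<^sup>2 \<le> (B ^ CARD('n))\<^sup>2" for I using RB[of I] R1[of I] by (intro power_mono) auto
    have "A2 \<le> (\<Sum>I\<in>UNIV. (B ^ CARD('n))\<^sup>2 * (a I)\<^sup>2)" "B2 \<le> (\<Sum>I\<in>UNIV. (B ^ CARD('n))\<^sup>2 * (b I)\<^sup>2)"
      unfolding A2_def B2_def power_mult_distrib[of "R _"] using sq by (intro sum_mono mult_right_mono; simp)+
    then have "A2 \<le> (B ^ CARD('n))\<^sup>2" "B2 \<le> (B ^ CARD('n))\<^sup>2"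
      unfolding sum_distrib_left[symmetric] n by simp_all
    moreover have "0 \<le> A2" "0 \<le> B2" unfolding A2_def B2_def by (auto intro: sum_nonneg)
    ultimately have "A2 * B2 \<le> (B ^ CARD('n))\<^sup>2 * (B ^ CARD('n))\<^sup>2" by (intro mult_mono) auto
    then show "A2 * B2 \<le> (B ^ CARD('n)) ^ 4" by (simp add: power_add[symmetric])
    have "(W m p \<bullet> W m q)\<^sup>2 \<le> (W m p \<bullet> W m p) * (W m q \<bullet> W m q)" by (rule Cauchy_Schwarz_ineq)
    then show "0 \<le> 1 - (W m p \<bullet> W m q)\<^sup>2" using norm_W_orthonormal[OF p] norm_W_orthonormal[OF q] by simp
  qed
  finally show ?thesis .
qed

definition phiW :: "real \<Rightarrow> nat \<Rightarrow> (nat \<Rightarrow> real ^ 'n::{finite,linorder}) \<Rightarrow> real ^ 'n::{finite,linorder} set" where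
  "phiW e m v = (\<chi> I. phi e (wedge m v I))"

text \<open>The bases \<open>v'\<close> and \<open>w'\<close> are the principal bases of the
  rescaled planes carried back by the inverse scaling; in general they are not orthonormal. The
  constant is fixed before the planes, which is the uniformity that \<open>USAC\<close>
  demands.\<close>

lemma trace_deficit_uniform:
  assumes m: "1 \<le> m" and e: "0 \<le> e" "e * real m \<le> 7/10"
  obtains k where "0 < k" "\<And>v w :: nat \<Rightarrow> real ^ 'n::{finite,linorder}. orthonormal m v \<Longrightarrow> orthonormal m w \<Longrightarrow>
    \<exists>v' w'. span (v' ` {..<m}) = span (v ` {..<m}) \<and> span (w' ` {..<m}) = span (w ` {..<m}) \<and>
      0 < phiW e m v' \<bullet> W m v' \<and> 0 < phiW e m w' \<bullet> W m w' \<and>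
      k * (1 - (W m v \<bullet> W m w)\<^sup>2) \<le> m - (\<Sum>i<m. \<Sum>j<m.
        (phiW e m v' \<bullet> W m (v'(i := w' j)) / (phiW e m v' \<bullet> W m v')) *
        (phiW e m w' \<bullet> W m (w'(j := v' i)) / (phiW e m w' \<bullet> W m w')))"
proof -
  have "e * 1 \<le> e * real m" using m e by (intro mult_left_mono) auto
  then have e1: "e < 1" using e by linarith
  \<comment> \<open>Raising the weights to at least \<open>h\<close> adds at most
    \<open>ln (1001/1000)\<close> to their sum \<open>m\<close>, hence at most a factor
    \<open>1001/1000\<close> to its \<open>m\<close>-th power.\<close>
  define h where "h = ln (1001/1000) / real CARD('n)"
  have h: "0 < h" by (simp add: h_def)
  have "ln (1001/1000) \<le> (1001/1000 - 1 :: real)" by (rule ln_le_minus_one) simp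
  moreover have "1 \<le> real CARD('n)" by (simp add: Suc_leI)
  ultimately have "ln (1001/1000) \<le> 1 * real CARD('n)" by linarith
  then have h1: "h \<le> 1" by (simp add: h_def divide_le_eq)
  define B where "B = h powr (- e / (2 * (2 - e)))"
  have "- e / (2 * (2 - e)) \<le> 0" using e e1 by (simp add: divide_nonpos_pos)
  then have B: "1 \<le> B" using powr_mono2'[of "- e / (2 * (2 - e))" h 1] h h1 by (simp add: B_def)
  define k where "k = 1 / (200 * (B ^ CARD('n)) ^ 4)"
  have BB: "0 < (B ^ CARD('n)) ^ 4" using B by simp
  show ?thesis
  proof (rule that[of k])
    show "0 < k" using BB by (simp add: k_def)
    fix v w :: "nat \<Rightarrow> (real, 'n) vec" assume v: "orthonormal m v" and w: "orthonormal m w"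
    obtain x :: "(real, 'n) vec" where x: "\<And>i. h \<le> x $ i" "\<And>i. x $ i \<le> 1"
      "\<And>i. x $ i = max h ((leverage m e v x i + leverage m e w x i) / 2)"
      using joint_weights_exist[OF v w h h1 e(1) e1] by blast
    have x0: "0 < x $ i" for i using x(1)[of i] h by linarith
    define r where "r = weight_scale e x"
    have r: "1 \<le> r $ i" "r $ i \<le> B" for i
      using weight_scale_bounds[OF x(1) x(2) h e(1) e1] by (auto simp: r_def B_def)
    have r0: "r $ i \<noteq> 0" for i using r(1)[of i] by auto
    define s where "s = (\<chi> i. 1 / r $ i)"
    have rs: "scale r (scale s u) = u" "scale s (scale r u) = u" for u
      using scale_scale_inverse[of r u] r0 by (auto simp: s_def)
    have inj: "inj (scale r)" using rs(2) by (metis injI)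
    let ?V = "scale r ` span (v ` {..<m})" and ?U = "scale r ` span (w ` {..<m})"
    have sp: "?V = span ((\<lambda>j. scale r (v j)) ` {..<m})" "?U = span ((\<lambda>j. scale r (w j)) ` {..<m})"
      using linear_span_image[OF linear_scale, of r "v ` {..<m}"] linear_span_image[OF linear_scale, of r "w ` {..<m}"]
      by (simp_all add: image_image)
    have dims: "dim ?V = m" "dim ?U = m"
      using dim_image_eq[OF linear_scale[of r], of "span (v ` {..<m})"]
        dim_image_eq[OF linear_scale[of r], of "span (w ` {..<m})"] inj dim_orthonormal[OF v] dim_orthonormal[OF w]
      by (auto simp: inj_on_subset)
    obtain p q c where pq: "principal_bases m p q c" "span (p ` {..<m}) = ?V" "span (q ` {..<m}) = ?U"
      by (rule principal_bases_exist[of ?V ?U m]) (use dims in \<open>auto intro!: linear_subspace_image[OF linear_scale] subspace_span\<close>)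
    interpret pb: principal_bases m p q c by (rule pq(1))
    have pin: "p i \<in> span ((\<lambda>j. scale r (v j)) ` {..<m})" and qin: "q i \<in> span ((\<lambda>j. scale r (w j)) ` {..<m})" if "i < m" for i
      using that span_base[of "p i" "p ` {..<m}"] span_base[of "q i" "q ` {..<m}"] pq(2,3) unfolding sp by auto
    have lev: "leverage m e v x i = (\<Sum>k<m. (p k $ i)\<^sup>2)" "leverage m e w x i = (\<Sum>k<m. (q k $ i)\<^sup>2)" for i
      using leverage_eq[OF pb.v, of e x v] leverage_eq[OF pb.w, of e x w] pin qin by (auto simp: r_def)
    have total: "(\<Sum>i\<in>UNIV. \<Sum>k<m. (u k $ i)\<^sup>2) = m" if "orthonormal m u" for u :: "nat \<Rightarrow> (real, 'n) vec"
    proof -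
      have "(\<Sum>i\<in>UNIV. \<Sum>k<m. (u k $ i)\<^sup>2) = (\<Sum>k<m. u k \<bullet> u k)"
        by (subst sum.swap) (simp add: inner_vec_def power2_eq_square)
      then show ?thesis using that by (simp add: orthonormal_def)
    qed
    have "(\<Sum>i\<in>UNIV. x $ i) \<le> (\<Sum>i\<in>UNIV. h + (leverage m e v x i + leverage m e w x i) / 2)"
    proof (rule sum_mono)
      fix i
      have "0 \<le> leverage m e v x i" "0 \<le> leverage m e w x i" unfolding lev by (auto intro: sum_nonneg)
      then have t: "0 \<le> (leverage m e v x i + leverage m e w x i) / 2" by simp
      have "max h t \<le> h + t" if "0 \<le> t" for t using that h by simp
      from this[OF t] show "x $ i \<le> h + (leverage m e v x i + leverage m e w x i) / 2"
        by (simp only: x(3)[of i, symmetric])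
    qed
    also have "\<dots> = real CARD('n) * h + m"
      using total[OF pb.v] total[OF pb.w] by (simp add: sum.distrib sum_divide_distrib[symmetric] lev)
    also have "real CARD('n) * h = ln (1001/1000)" by (simp add: h_def)
    finally have sx: "(\<Sum>i\<in>UNIV. x $ i) \<le> real m * (1 + ln (1001/1000) / real m)" using m by (simp add: distrib_left add.commute)
    have "(\<Sum>i\<in>UNIV. x $ i) ^ m \<le> (real m * (1 + ln (1001/1000) / real m)) ^ m"
      using sx x0 by (intro power_mono sum_nonneg) (auto intro: less_imp_le)
    also have "\<dots> = real m ^ m * (1 + ln (1001/1000) / real m) ^ m" by (simp add: power_mult_distrib)
    also have "\<dots> \<le> real m ^ m * exp (ln (1001/1000))"
    proof (intro mult_left_mono exp_ge_one_plus_x_over_n_power_n)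
      have "0 \<le> ln (1001/1000 :: real)" by simp
      then show "- real m \<le> ln (1001/1000)" by linarith
    qed (use m in auto)
    finally have sum: "(\<Sum>i\<in>UNIV. x $ i) ^ m \<le> 1001/1000 * real m ^ m" by simp
    have lev2: "(\<Sum>k<m. (p k $ i)\<^sup>2) + (\<Sum>k<m. (q k $ i)\<^sup>2) \<le> 2 * x $ i" for i
    proof -
      have "t \<le> 2 * max h (t / 2)" for t :: real by (simp add: max_def)
      from this[of "leverage m e v x i + leverage m e w x i"]
      have "leverage m e v x i + leverage m e w x i \<le> 2 * x $ i" by (simp only: x(3)[of i, symmetric])
      then show ?thesis by (simp only: lev)
    qed
    note wd = weighted_trace_deficit[OF pq(1) m e x0 lev2 sum]
    define v' w' where "v' = (\<lambda>i. scale s (p i))" and "w' = (\<lambda>i. scale s (q i))"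
    have pv: "p = (\<lambda>j. scale r (v' j))" and qw: "q = (\<lambda>j. scale r (w' j))" by (auto simp: v'_def w'_def rs)
    have inn: "eta e x (W m p) \<bullet> W m (\<lambda>j. scale r (u j)) = phiW e m v' \<bullet> W m u"
      "eta e x (W m q) \<bullet> W m (\<lambda>j. scale r (u j)) = phiW e m w' \<bullet> W m u" for u
      using eta_scaled_inner[OF x0 e1, of m v' u] eta_scaled_inner[OF x0 e1, of m w' u]
      unfolding r_def[symmetric] pv[symmetric] qw[symmetric] phiW_def by auto
    have upd: "p(i := q j) = (\<lambda>a. scale r ((v'(i := w' j)) a))" "q(j := p i) = (\<lambda>a. scale r ((w'(j := v' i)) a))" for i j
      by (auto simp: fun_eq_iff v'_def w'_def rs)
    have i1: "eta e x (W m p) \<bullet> W m p = phiW e m v' \<bullet> W m v'" "eta e x (W m q) \<bullet> W m q = phiW e m w' \<bullet> W m w'"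
      using inn(1)[of v'] inn(2)[of w'] unfolding pv[symmetric] qw[symmetric] by auto
    have i2: "eta e x (W m p) \<bullet> W m (p(i := q j)) = phiW e m v' \<bullet> W m (v'(i := w' j))"
      "eta e x (W m q) \<bullet> W m (q(j := p i)) = phiW e m w' \<bullet> W m (w'(j := v' i))" for i j
      unfolding upd by (rule inn)+
    have unscale: "span ((\<lambda>i. scale s (g i)) ` {..<m}) = Y" if "span (g ` {..<m}) = scale r ` Y" for g Y
    proof -
      have "span ((\<lambda>i. scale s (g i)) ` {..<m}) = scale s ` span (g ` {..<m})"
        using linear_span_image[OF linear_scale, of s "g ` {..<m}"] by (simp add: image_image)
      also have "\<dots> = Y" unfolding that by (simp add: image_image rs)
      finally show ?thesis .
    qed
    have "k * (1 - (W m v \<bullet> W m w)\<^sup>2) \<le> k * ((B ^ CARD('n)) ^ 4 * (1 - (W m p \<bullet> W m q)\<^sup>2))"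
      using scaled_angle_bound[OF v w pb.v pb.w pin qin r] \<open>0 < k\<close> by (intro mult_left_mono) auto
    also have "\<dots> = (1 - (W m p \<bullet> W m q)\<^sup>2) / 200" using BB by (simp add: k_def)
    finally have fin: "k * (1 - (W m v \<bullet> W m w)\<^sup>2) \<le> (1 - (W m p \<bullet> W m q)\<^sup>2) / 200" .
    show "\<exists>v' w'. span (v' ` {..<m}) = span (v ` {..<m}) \<and> span (w' ` {..<m}) = span (w ` {..<m}) \<and>
      0 < phiW e m v' \<bullet> W m v' \<and> 0 < phiW e m w' \<bullet> W m w' \<and>
      k * (1 - (W m v \<bullet> W m w)\<^sup>2) \<le> m - (\<Sum>i<m. \<Sum>j<m.
        (phiW e m v' \<bullet> W m (v'(i := w' j)) / (phiW e m v' \<bullet> W m v')) *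
        (phiW e m w' \<bullet> W m (w'(j := v' i)) / (phiW e m w' \<bullet> W m w')))"
      using unscale[OF pq(2)] unscale[OF pq(3)] wd(1,2) order_trans[OF fin wd(3)] unfolding i1 i2
      by (intro exI[of _ v'] exI[of _ w']) (auto simp: v'_def w'_def)
  qed
qed

section \<open>The anisotropy on the Grassmannian\<close>

lemma Grass_sym:
  assumes "T \<in> Grass m"
  shows "a \<bullet> (T *v b) = (T *v a) \<bullet> b"
  using assms unfolding Grass_def by (metis (mono_tags, lifting) dot_lmul_matrix mem_Collect_eq vector_transpose_matrix)

lemma Grass_idem:
  assumes "T \<in> Grass m"
  shows "T *v (T *v x) = T *v x"
  using assms by (simp add: Grass_def matrix_vector_mul_assoc)

lemma Grass_range:
  assumes "T \<in> Grass m"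
  shows "x \<in> range ((*v) T) \<longleftrightarrow> T *v x = x"
  using Grass_idem[OF assms] by (metis rangeE rangeI)

lemma subspace_range_matrix: "subspace (range ((*v) (T :: real ^ 'n ^ 'n)))"
  by (intro linear_subspace_image matrix_vector_mul_linear subspace_UNIV)

lemma orthonormal_expansion:
  assumes v: "orthonormal m v" and x: "x \<in> span (v ` {..<m})"
  shows "x = (\<Sum>k<m. (v k \<bullet> x) *\<^sub>R v k)"
proof -
  obtain g where g: "x = (\<Sum>k<m. g k *\<^sub>R v k)" using span_family_lincomb[OF x] by blast
  have "v k \<bullet> x = g k" if "k < m" for k
  proof -
    have "v k \<bullet> x = (\<Sum>l<m. if l = k then g k else 0)"
      unfolding g inner_sum_right using v that by (intro sum.cong) (auto simp: orthonormal_def)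
    then show ?thesis using that by simp
  qed
  then show ?thesis by (subst (1) g) (auto intro!: sum.cong)
qed

lemma matrix_sum_outer_mult: "(\<Sum>k\<in>K. outer (a k) (b k)) *v x = (\<Sum>k\<in>K. (b k \<bullet> x) *\<^sub>R a k)"
  by (induction K rule: infinite_finite_induct)
    (simp_all add: matrix_vector_mult_add_rdistrib outer_mult_vec)

lemma Grass_sum_outer:
  fixes T :: "real ^ 'n ^ 'n"
  assumes T: "T \<in> Grass k" and v: "orthonormal m v" and sp: "span (v ` {..<m}) = range ((*v) T)"
  shows "T = (\<Sum>k<m. outer (v k) (v k))"
proof -
  have "T *v x = (\<Sum>k<m. outer (v k) (v k)) *v x" for x
  proof -
    have vk: "T *v v k = v k" if "k < m" for k
      using Grass_range[OF T, of "v k"] span_base[of "v k" "v ` {..<m}"] that unfolding sp by auto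
    have "T *v x = (\<Sum>k<m. (v k \<bullet> (T *v x)) *\<^sub>R v k)"
      by (rule orthonormal_expansion[OF v]) (simp add: sp)
    also have "\<dots> = (\<Sum>k<m. (v k \<bullet> x) *\<^sub>R v k)"
      using vk by (intro sum.cong refl) (simp add: Grass_sym[OF T])
    finally show ?thesis by (simp add: matrix_sum_outer_mult)
  qed
  then show ?thesis by (simp add: matrix_eq)
qed

lemma dim_range_Grass:
  fixes T :: "real ^ 'n ^ 'n"
  assumes T: "T \<in> Grass m"
  shows "dim (range ((*v) T)) = m"
proof -
  let ?V = "range ((*v) T)"
  obtain v where v: "orthonormal (dim ?V) v" "\<And>i. i < dim ?V \<Longrightarrow> v i \<in> ?V"
    using principal_vectors_exist[OF subspace_range_matrix subspace_range_matrix refl refl, of T] by blast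
  have sp: "span (v ` {..<dim ?V}) = ?V"
    by (rule span_orthonormal[OF v(1) subspace_range_matrix refl v(2)])
  have "trace (\<Sum>k\<in>K. outer (v k) (v k)) = (\<Sum>k\<in>K. v k \<bullet> v k)" for K
    by (induction K rule: infinite_finite_induct) (simp_all add: trace_add trace_outer trace_0[unfolded mat_0])
  then have "trace T = (\<Sum>k<dim ?V. v k \<bullet> v k)"
    using Grass_sum_outer[OF T v(1) sp] by metis
  also have "\<dots> = dim ?V" using v(1) by (simp add: orthonormal_def)
  finally show ?thesis using T by (simp add: Grass_def)
qed

lemma Grass_orthonormal_basis:
  fixes T :: "real ^ 'n ^ 'n"
  assumes T: "T \<in> Grass m"
  obtains v where "orthonormal m v" "span (v ` {..<m}) = range ((*v) T)"
proof -
  obtain v where v: "orthonormal m v" "\<And>i. i < m \<Longrightarrow> v i \<in> range ((*v) T)"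
    using principal_vectors_exist[OF subspace_range_matrix subspace_range_matrix dim_range_Grass[OF T] dim_range_Grass[OF T]]
    by blast
  show ?thesis
    by (rule that[OF v(1) span_orthonormal[OF v(1) subspace_range_matrix dim_range_Grass[OF T] v(2)]])
qed

definition lq_sum :: "real \<Rightarrow> nat \<Rightarrow> (nat \<Rightarrow> real ^ 'n::{finite,linorder}) \<Rightarrow> real" where
  "lq_sum q m v = (\<Sum>I\<in>UNIV. \<bar>wedge m v I\<bar> powr q)"

lemma lq_sum_pos:
  assumes "W m v \<noteq> 0"
  shows "0 < lq_sum q m v"
proof -
  obtain I where "wedge m v I \<noteq> 0" using assms by (auto simp: vec_eq_iff)
  then have "0 < \<bar>wedge m v I\<bar> powr q" by simp
  also have "\<dots> \<le> lq_sum q m v" unfolding lq_sum_def by (intro member_le_sum) auto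
  finally show ?thesis .
qed

lemma norm_W_sq: "(norm (W m v))\<^sup>2 = (\<Sum>I | card I = m. (wedge m v I)\<^sup>2)"
proof -
  have "(norm (W m v))\<^sup>2 = (\<Sum>I\<in>UNIV. (wedge m v I)\<^sup>2)"
    unfolding power2_norm_eq_inner by (simp add: inner_vec_def power2_eq_square)
  also have "\<dots> = (\<Sum>I | card I = m. (wedge m v I)\<^sup>2)"
    by (intro sum.mono_neutral_right) (auto simp: wedge_0)
  finally show ?thesis .
qed

lemma lq_anisotropy_orthonormal:
  fixes T :: "real ^ 'n::{finite,linorder} ^ 'n::{finite,linorder}"
  assumes T: "T \<in> Grass m" and u: "orthonormal m u" "span (u ` {..<m}) = range ((*v) T)"
  shows "lq_anisotropy m q T = lq_sum q m u powr (1 / q)"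
proof -
  have n1: "norm (W m u) = 1" using norm_W_orthonormal[OF u(1)] by (simp add: norm_eq_1)
  have "unit_simple_spanning m T (wedge m u)"
    unfolding unit_simple_spanning_def using u n1 norm_W_sq[of m u] by auto
  then have "unit_simple_spanning m T (xi m T)" unfolding xi_def by (rule someI[of "unit_simple_spanning m T"])
  then obtain u' where u': "xi m T = wedge m u'" "span (u' ` {..<m}) = range ((*v) T)"
    "sqrt (\<Sum>I | card I = m. (wedge m u' I)\<^sup>2) = 1"
    unfolding unit_simple_spanning_def by auto
  have n2: "norm (W m u') = 1" using u'(3) unfolding norm_W_sq[symmetric] by simp
  have "u' i \<in> span (u ` {..<m})" if "i < m" for i
    using that span_base[of "u' i" "u' ` {..<m}"] unfolding u(2) u'(2) by auto
  then obtain k where k: "W m u' = k *\<^sub>R W m u" using W_same_span[of m u' u] by blast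
  then have "\<bar>k\<bar> = 1" using n1 n2 by simp
  then have "\<bar>xi m T I\<bar> = \<bar>wedge m u I\<bar>" for I
    using arg_cong[OF k, of "\<lambda>z. \<bar>z $ I\<bar>"] by (simp add: u' abs_mult)
  then have "(\<Sum>I | card I = m. \<bar>xi m T I\<bar> powr q) = (\<Sum>I | card I = m. \<bar>wedge m u I\<bar> powr q)" by simp
  also have "\<dots> = lq_sum q m u"
    unfolding lq_sum_def by (intro sum.mono_neutral_left) (auto simp: wedge_0)
  finally show ?thesis by (simp add: lq_anisotropy_def)
qed

text \<open>Both numerator and denominator are homogeneous in the Pluecker vector, so any basis of
  the plane may be used. The formula is applied to bases moving with a rotation.\<close>

lemma lq_anisotropy_family:
  fixes T :: "real ^ 'n::{finite,linorder} ^ 'n::{finite,linorder}"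
  assumes T: "T \<in> Grass m" and v: "\<And>i. i < m \<Longrightarrow> T *v v i = v i" "W m v \<noteq> 0" and q: "0 < q"
  shows "lq_anisotropy m q T = lq_sum q m v powr (1 / q) / norm (W m v)"
proof -
  obtain u where u: "orthonormal m u" "span (u ` {..<m}) = range ((*v) T)"
    using Grass_orthonormal_basis[OF T] by blast
  have n1: "norm (W m u) = 1" using norm_W_orthonormal[OF u(1)] by (simp add: norm_eq_1)
  have "v i \<in> span (u ` {..<m})" if "i < m" for i
    unfolding u(2) using v(1)[OF that] Grass_range[OF T] by blast
  then obtain k where k: "W m v = k *\<^sub>R W m u" using W_same_span[of m v u] by blast
  have k0: "0 < \<bar>k\<bar>" using v(2) k by auto
  have "\<bar>wedge m v I\<bar> = \<bar>k\<bar> * \<bar>wedge m u I\<bar>" for I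
    using arg_cong[OF k, of "\<lambda>z. \<bar>z $ I\<bar>"] by (simp add: abs_mult)
  then have "lq_sum q m v = \<bar>k\<bar> powr q * lq_sum q m u"
    unfolding lq_sum_def by (simp add: powr_mult sum_distrib_left)
  then have "lq_sum q m v powr (1 / q) = (\<bar>k\<bar> powr q) powr (1 / q) * lq_sum q m u powr (1 / q)"
    by (simp add: powr_mult)
  also have "(\<bar>k\<bar> powr q) powr (1 / q) = \<bar>k\<bar>" using q k0 by (simp add: powr_powr)
  also have "\<bar>k\<bar> = norm (W m v)" using k n1 by simp
  finally show ?thesis using lq_anisotropy_orthonormal[OF T u, of q] v(2) by simp
qed

text \<open>The coordinates of a unit vector are at most \<open>1\<close> in modulus, so lowering
  the exponent from \<open>2\<close> to \<open>q\<close> only increases their powers. This gives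
  positivity and allows the factors \<open>\<Psi> T * \<Psi> S\<close> to be dropped in the final
  bound.\<close>

lemma lq_anisotropy_ge_1:
  fixes T :: "real ^ 'n::{finite,linorder} ^ 'n::{finite,linorder}"
  assumes T: "T \<in> Grass m" and q: "0 < q" "q \<le> 2"
  shows "1 \<le> lq_anisotropy m q T"
proof -
  obtain u where u: "orthonormal m u" "span (u ` {..<m}) = range ((*v) T)"
    using Grass_orthonormal_basis[OF T] by blast
  have s: "(\<Sum>I\<in>UNIV. (wedge m u I)\<^sup>2) = 1"
    using norm_W_orthonormal[OF u(1)] by (simp add: inner_vec_def power2_eq_square)
  have "(wedge m u I)\<^sup>2 \<le> \<bar>wedge m u I\<bar> powr q" for I
  proof (cases "wedge m u I = 0")
    case False
    have "(wedge m u I)\<^sup>2 \<le> 1" unfolding s[symmetric] by (intro member_le_sum) auto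
    then have "\<bar>wedge m u I\<bar> \<le> 1" by (simp add: abs_square_le_1)
    then have "\<bar>wedge m u I\<bar> powr 2 \<le> \<bar>wedge m u I\<bar> powr q" using q by (intro powr_mono') auto
    then show ?thesis using False by simp
  qed simp
  then have "1 \<le> lq_sum q m u" unfolding s[symmetric] lq_sum_def by (rule sum_mono)
  then have "1 powr (1 / q) \<le> lq_sum q m u powr (1 / q)" using q by (intro powr_mono2) auto
  then show ?thesis using lq_anisotropy_orthonormal[OF T u, of q] by simp
qed

lemma continuous_on_phi:
  assumes "e < 1"
  shows "continuous_on UNIV (phi e)"
proof -
  have "phi e = (\<lambda>t. max t 0 powr (1 - e) - max (- t) 0 powr (1 - e))"
    by (auto simp: fun_eq_iff phi_def max_def sgn_real_def)
  moreover have "continuous_on UNIV (\<lambda>t. max t 0 powr (1 - e) - max (- t) 0 powr (1 - e))"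
    using assms by (intro continuous_intros continuous_on_powr') auto
  ultimately show ?thesis by simp
qed

text \<open>At \<open>0\<close> the difference quotient is \<open>phi e\<close> itself, which is
  continuous and vanishes there because \<open>e < 1\<close>.\<close>

lemma DERIV_abs_powr:
  assumes e: "e < 1"
  shows "((\<lambda>t. \<bar>t\<bar> powr (2 - e)) has_real_derivative (2 - e) * phi e t) (at t)"
proof (cases t "0 :: real" rule: linorder_cases)
  case equal
  have "isCont (phi e) 0" using continuous_on_phi[OF e] by (simp add: continuous_on_eq_continuous_at)
  then have "(phi e \<longlongrightarrow> 0) (at 0)" by (simp add: isCont_def)
  moreover have "(\<bar>0 + h\<bar> powr (2 - e) - \<bar>0\<bar> powr (2 - e)) / h = phi e h" if "h \<noteq> 0" for h
    using phi_mult_self[of e h] that by (simp add: field_simps)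
  then have "\<forall>\<^sub>F h in at 0. phi e h = (\<bar>0 + h\<bar> powr (2 - e) - \<bar>0\<bar> powr (2 - e)) / h"
    unfolding eventually_at_filter by (intro always_eventually) auto
  ultimately have "((\<lambda>h. (\<bar>0 + h\<bar> powr (2 - e) - \<bar>0\<bar> powr (2 - e)) / h) \<longlongrightarrow> 0) (at 0)"
    by (rule Lim_transform_eventually)
  then show ?thesis using equal by (simp add: DERIV_def)
next
  case greater
  have "((\<lambda>t. t powr (2 - e)) has_real_derivative (2 - e) * t powr (2 - e - 1)) (at t)"
    by (rule has_real_derivative_powr[OF greater])
  then have "((\<lambda>t. \<bar>t\<bar> powr (2 - e)) has_real_derivative (2 - e) * t powr (2 - e - 1)) (at t)"
    by (rule has_field_derivative_transform_within_open[where S = "{0<..}"]) (use greater in auto)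
  then show ?thesis using greater by (simp add: phi_pos)
next
  case less
  have "((\<lambda>t. (- t) powr (2 - e)) has_real_derivative (2 - e) * (- t) powr (2 - e - of_nat 1) * (- 1)) (at t)"
    using less by (intro DERIV_fun_powr) (auto intro!: derivative_eq_intros)
  then have "((\<lambda>t. \<bar>t\<bar> powr (2 - e)) has_real_derivative (2 - e) * (- t) powr (2 - e - of_nat 1) * (- 1)) (at t)"
    by (rule has_field_derivative_transform_within_open[where S = "{..<0}"]) (use less in auto)
  moreover have "phi e t = - ((- t) powr (1 - e))" using phi_pos[of "- t" e] less by simp
  ultimately show ?thesis by simp
qed

section \<open>Functions with continuous gradient\<close>

definition C1_on :: "'a::real_inner set \<Rightarrow> ('a \<Rightarrow> real) \<Rightarrow> bool" where
  "C1_on U F \<longleftrightarrow> (\<exists>D. (\<forall>x\<in>U. GDERIV F x :> D x) \<and> continuous_on U D)"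

lemma C1_onI: "(\<And>x. x \<in> U \<Longrightarrow> GDERIV F x :> D x) \<Longrightarrow> continuous_on U D \<Longrightarrow> C1_on U F"
  by (auto simp: C1_on_def)

lemma C1_on_continuous: "C1_on U F \<Longrightarrow> continuous_on U F"
  unfolding C1_on_def gderiv_def
  by (meson continuous_at_imp_continuous_on has_derivative_continuous)

lemma C1_on_const: "C1_on U (\<lambda>x. c)"
  by (rule C1_onI[where D = "\<lambda>_. 0"]) (auto intro: GDERIV_const)

lemma C1_on_add:
  assumes "C1_on U F" "C1_on U G"
  shows "C1_on U (\<lambda>x. F x + G x)"
proof -
  obtain D E where "\<And>x. x \<in> U \<Longrightarrow> GDERIV F x :> D x" "continuous_on U D"
    "\<And>x. x \<in> U \<Longrightarrow> GDERIV G x :> E x" "continuous_on U E"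
    using assms unfolding C1_on_def by blast
  then show ?thesis by (intro C1_onI[where D = "\<lambda>x. D x + E x"] GDERIV_add continuous_on_add) auto
qed

lemma C1_on_mult:
  assumes F: "C1_on U F" and G: "C1_on U G"
  shows "C1_on U (\<lambda>x. F x * G x)"
proof -
  obtain D E where D: "\<And>x. x \<in> U \<Longrightarrow> GDERIV F x :> D x" "continuous_on U D"
    and E: "\<And>x. x \<in> U \<Longrightarrow> GDERIV G x :> E x" "continuous_on U E"
    using F G unfolding C1_on_def by blast
  show ?thesis
  proof (rule C1_onI[where D = "\<lambda>x. F x *\<^sub>R E x + G x *\<^sub>R D x"])
    show "GDERIV (\<lambda>x. F x * G x) x :> F x *\<^sub>R E x + G x *\<^sub>R D x" if "x \<in> U" for x
      using D(1)[OF that] E(1)[OF that] by (rule GDERIV_mult)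
    show "continuous_on U (\<lambda>x. F x *\<^sub>R E x + G x *\<^sub>R D x)"
      using D(2) E(2) C1_on_continuous[OF F] C1_on_continuous[OF G] by (intro continuous_intros)
  qed
qed

lemma C1_on_compose:
  assumes F: "C1_on U F" and sub: "F ` U \<subseteq> V" and g: "\<And>y. y \<in> V \<Longrightarrow> (g has_real_derivative g' y) (at y)"
    and g': "continuous_on V g'"
  shows "C1_on U (\<lambda>x. g (F x))"
proof -
  obtain D where D: "\<And>x. x \<in> U \<Longrightarrow> GDERIV F x :> D x" "continuous_on U D"
    using F unfolding C1_on_def by blast
  show ?thesis
  proof (rule C1_onI[where D = "\<lambda>x. g' (F x) *\<^sub>R D x"])
    show "GDERIV (\<lambda>x. g (F x)) x :> g' (F x) *\<^sub>R D x" if "x \<in> U" for x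
      using D(1)[OF that] g[of "F x"] sub that by (intro GDERIV_DERIV_compose) auto
    show "continuous_on U (\<lambda>x. g' (F x) *\<^sub>R D x)"
      using continuous_on_compose2[OF g' C1_on_continuous[OF F] sub] D(2) by (intro continuous_intros)
  qed
qed

lemma C1_on_sum: "(\<And>k. k \<in> K \<Longrightarrow> C1_on U (F k)) \<Longrightarrow> C1_on U (\<lambda>x. \<Sum>k\<in>K. F k x)"
  by (induction K rule: infinite_finite_induct) (simp_all add: C1_on_const C1_on_add)

lemma C1_on_prod: "(\<And>k. k \<in> K \<Longrightarrow> C1_on U (F k)) \<Longrightarrow> C1_on U (\<lambda>x. \<Prod>k\<in>K. F k x)"
  by (induction K rule: infinite_finite_induct) (simp_all add: C1_on_const C1_on_mult)

lemma C1_on_entry: "C1_on U (\<lambda>X :: real ^ 'n ^ 'm. X $ i $ j)"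
proof (rule C1_onI[where D = "\<lambda>_. axis i (axis j 1)"])
  have e: "(\<lambda>X :: real ^ 'n ^ 'm. X $ i $ j) = (\<lambda>X. X \<bullet> axis i (axis j 1))"
    by (simp add: fun_eq_iff inner_axis)
  show "GDERIV (\<lambda>X :: real ^ 'n ^ 'm. X $ i $ j) X :> axis i (axis j 1)" for X
    unfolding gderiv_def e by (auto intro!: derivative_eq_intros)
qed simp

text \<open>
  The products \<open>\<xi> I * \<xi> J\<close> of Pluecker coordinates extend to polynomials, the minors of the projection matrix;
  this is where the \<open>C\<^sup>1\<close> extension of the anisotropy comes from.
\<close>

definition minor :: "nat \<Rightarrow> 'n::{finite,linorder} set \<Rightarrow> 'n::{finite,linorder} set \<Rightarrow>
    real ^ 'n::{finite,linorder} ^ 'n::{finite,linorder} \<Rightarrow> real" where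
  "minor m I J X = wedge m (\<lambda>k. column (sorted_list_of_set J ! k) X) I"

lemma minor_Grass:
  fixes T :: "real ^ 'n::{finite,linorder} ^ 'n::{finite,linorder}"
  assumes T: "T \<in> Grass m" and u: "orthonormal m u" "span (u ` {..<m}) = range ((*v) T)" and J: "card J = m"
  shows "minor m I J T = wedge m u I * wedge m u J"
proof -
  have col: "column j T = (\<Sum>l<m. (u l $ j) *\<^sub>R u l)" for j
    by (subst Grass_sum_outer[OF T u]) (simp add: vec_eq_iff column_def outer_def sum_component mult.commute)
  have "W m (\<lambda>k. column (sorted_list_of_set J ! k) T) = ldet m (\<lambda>k l. u l $ (sorted_list_of_set J ! k)) *\<^sub>R W m u"
    by (rule W_lincomb) (rule col)
  also have "ldet m (\<lambda>k l. u l $ (sorted_list_of_set J ! k)) = wedge m u J"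
    using ldet_transpose[of m "\<lambda>l k. u l $ (sorted_list_of_set J ! k)"] by (simp add: wedge_ldet[OF J])
  finally show ?thesis by (simp add: vec_eq_iff minor_def mult.commute)
qed

lemma C1_on_minor: "C1_on U (minor m I J)"
proof (cases "card I = m")
  case True
  have "minor m I J = (\<lambda>X. \<Sum>p | p permutes {..<m}. of_int (sign p) *
      (\<Prod>k<m. X $ (sorted_list_of_set I ! p k) $ (sorted_list_of_set J ! k)))"
    using True by (simp add: fun_eq_iff minor_def wedge_def column_def)
  then show ?thesis by (auto intro!: C1_on_sum C1_on_mult C1_on_const C1_on_prod C1_on_entry)
next
  case False
  then have "minor m I J = (\<lambda>X. 0)" by (simp add: fun_eq_iff minor_def wedge_0)
  then show ?thesis by (simp add: C1_on_const)
qed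

text \<open>On the Grassmannian the double sum \<open>G\<close> factors into the square of the sum
  of the \<open>\<bar>\<xi> I\<bar> powr q\<close>, which explains the exponent
  \<open>1 / (2 * q)\<close>. The outer power is smooth where \<open>G\<close> is positive, and
  \<open>U\<close> is that open set.\<close>

lemma lq_C1_extension:
  fixes m :: nat
  assumes e: "e < 1"
  shows "\<exists>F D. C1_extension m (lq_anisotropy m (2 - e) :: real ^ 'n::{finite,linorder} ^ 'n::{finite,linorder} \<Rightarrow> real) F D"
proof -
  let ?q = "2 - e"
  define G where "G = (\<lambda>X :: ((real, 'n) vec, 'n) vec. \<Sum>I\<in>UNIV. \<Sum>J | card J = m. \<bar>minor m I J X\<bar> powr ?q)"
  define F where "F = (\<lambda>X. G X powr (1 / (2 * ?q)))"
  define U where "U = {X. 0 < G X}"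
  have q: "0 < ?q" using e by simp
  have GC: "C1_on V G" for V
    unfolding G_def
  proof (intro C1_on_sum)
    fix I J
    show "C1_on V (\<lambda>X. \<bar>minor m I J X\<bar> powr ?q)"
      using C1_on_compose[OF C1_on_minor[of V m I J], of UNIV "\<lambda>t. \<bar>t\<bar> powr ?q" "\<lambda>t. ?q * phi e t"]
        DERIV_abs_powr[OF e] continuous_on_mult_left[OF continuous_on_phi[OF e]] by auto
  qed
  have "open U" unfolding U_def
    using C1_on_continuous[OF GC[of UNIV]] by (intro open_Collect_less) auto
  have FC: "C1_on U F" unfolding F_def
  proof (rule C1_on_compose[OF GC, where V = "{0<..}"])
    show "((\<lambda>y. y powr (1 / (2 * ?q))) has_real_derivative (1 / (2 * ?q)) * y powr (1 / (2 * ?q) - 1)) (at y)"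
      if "y \<in> {0<..}" for y
      using that by (intro has_real_derivative_powr) auto
    show "continuous_on {0<..} (\<lambda>y. (1 / (2 * ?q)) * y powr (1 / (2 * ?q) - 1))"
      by (intro continuous_intros) auto
  qed (auto simp: U_def)
  then obtain D where D: "\<forall>X\<in>U. GDERIV F X :> D X" "continuous_on U D" unfolding C1_on_def by blast
  have on: "0 < G T \<and> F T = lq_anisotropy m ?q T" if T: "T \<in> Grass m" for T
  proof -
    obtain u where u: "orthonormal m u" "span (u ` {..<m}) = range ((*v) T)"
      using Grass_orthonormal_basis[OF T] by blast
    have "W m u \<noteq> 0" using norm_W_orthonormal[OF u(1)] by auto
    then have p: "0 < lq_sum ?q m u" by (rule lq_sum_pos)
    have "G T = (\<Sum>I\<in>UNIV. \<Sum>J | card J = m. \<bar>wedge m u I\<bar> powr ?q * \<bar>wedge m u J\<bar> powr ?q)"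
      unfolding G_def by (intro sum.cong refl) (simp add: minor_Grass[OF T u] abs_mult powr_mult)
    also have "\<dots> = lq_sum ?q m u * (\<Sum>J | card J = m. \<bar>wedge m u J\<bar> powr ?q)"
      by (simp add: lq_sum_def sum_product)
    also have "(\<Sum>J | card J = m. \<bar>wedge m u J\<bar> powr ?q) = lq_sum ?q m u"
      unfolding lq_sum_def by (intro sum.mono_neutral_left) (auto simp: wedge_0)
    finally have G: "G T = lq_sum ?q m u * lq_sum ?q m u" .
    have "F T = (lq_sum ?q m u powr 2) powr (1 / (2 * ?q))"
      unfolding F_def G using p by (simp add: power2_eq_square)
    have "2 * (1 / (2 * ?q)) = 1 / ?q" using q by (simp add: field_simps)
    then have "(lq_sum ?q m u powr 2) powr (1 / (2 * ?q)) = lq_sum ?q m u powr (1 / ?q)" by (simp only: powr_powr)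
    with \<open>F T = _\<close> show ?thesis using G p lq_anisotropy_orthonormal[OF T u, of ?q] by simp
  qed
  then have "C1_extension m (lq_anisotropy m ?q) F D"
    unfolding C1_extension_def using \<open>open U\<close> D by (auto simp: U_def)
  then show ?thesis by blast
qed

section \<open>The matrix of the anisotropy\<close>

text \<open>On the orthogonal complement of \<open>u\<close> the map \<open>R\<close> turns
  \<open>w\<close> into \<open>x\<close> and fixes what is orthogonal to \<open>w\<close>. It thus
  carries a basis of the plane along the rotation while preserving its Gram matrix.\<close>

lemma rotated_family:
  fixes T :: "real ^ 'n ^ 'n" and w u z z' :: "real ^ 'n" and t :: real
  assumes w: "w \<bullet> w = 1" and u: "u \<bullet> u = 1" and wu: "w \<bullet> u = 0"
  defines "x \<equiv> cos t *\<^sub>R w + sin t *\<^sub>R u" and "R \<equiv> \<lambda>z. z - (w \<bullet> z) *\<^sub>R w + (w \<bullet> z) *\<^sub>R (cos t *\<^sub>R w + sin t *\<^sub>R u)"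
  shows "u \<bullet> z = 0 \<Longrightarrow> u \<bullet> z' = 0 \<Longrightarrow> R z \<bullet> R z' = z \<bullet> z'"
    and "u \<bullet> z = 0 \<Longrightarrow> T *v z = z \<Longrightarrow> T *v w = w \<Longrightarrow> T *v u = 0 \<Longrightarrow>
      (T - outer w w + outer x x) *v R z = R z"
proof -
  have xx: "x \<bullet> x = 1"
    using w u wu sin_cos_squared_add[of t]
    by (simp add: x_def inner_add_left inner_add_right inner_commute[of u w] power2_eq_square)
  have wx: "w \<bullet> x = cos t" "x \<bullet> w = cos t"
    using w wu by (simp_all add: x_def inner_add_right inner_add_left inner_commute[of u w])
  have xz: "x \<bullet> z = cos t * (w \<bullet> z)" "z \<bullet> x = cos t * (w \<bullet> z)" if "u \<bullet> z = 0" for z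
    using that by (simp_all add: x_def inner_add_left inner_commute[of z])
  have R: "R z = z - (w \<bullet> z) *\<^sub>R w + (w \<bullet> z) *\<^sub>R x" for z by (simp add: R_def x_def)
  show "R z \<bullet> R z' = z \<bullet> z'" if "u \<bullet> z = 0" "u \<bullet> z' = 0"
    unfolding R using xx wx xz that w
    by (simp add: inner_add_left inner_add_right inner_diff_left inner_diff_right inner_commute[of z w] algebra_simps)
  show "(T - outer w w + outer x x) *v R z = R z"
    if "u \<bullet> z = 0" "T *v z = z" "T *v w = w" "T *v u = 0"
  proof -
    have Tx: "T *v x = cos t *\<^sub>R w"
      by (simp add: x_def matrix_vector_right_distrib matrix_vector_scaleR that)
    have wR: "w \<bullet> R z = cos t * (w \<bullet> z)" unfolding R using w wx by (simp add: inner_add_right inner_diff_right)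
    have xR: "x \<bullet> R z = w \<bullet> z"
      unfolding R using xx wx xz[OF that(1)] by (simp add: inner_add_right inner_diff_right)
    have "T *v R z = z - (w \<bullet> z) *\<^sub>R w + (w \<bullet> z) *\<^sub>R (cos t *\<^sub>R w)"
      unfolding R by (simp add: matrix_vector_right_distrib matrix_vector_mult_diff_distrib matrix_vector_scaleR that Tx)
    then show ?thesis
      by (simp add: matrix_vector_mult_add_rdistrib matrix_vector_mult_diff_rdistrib outer_mult_vec wR xR)
        (simp add: R mult.commute)
  qed
qed

lemma inner_symmetrized: "u \<bullet> ((E + transpose E) *v w) = E \<bullet> (outer u w + outer w u)" for E :: "real ^ 'n ^ 'n"
proof -
  have "u \<bullet> (transpose E *v w) = w \<bullet> (E *v u)"
    by (metis dot_lmul_matrix inner_commute vector_transpose_matrix transpose_transpose)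
  then show ?thesis
    by (simp add: matrix_vector_mult_add_rdistrib inner_add_right inner_outer)
qed

text \<open>On the plane spanned by a basis \<open>v\<close> these are the coordinates with respect
  to \<open>v\<close>; in normal directions they are logarithmic derivatives of the power sum.
  Together they define an oblique projection onto the plane.\<close>

definition slot_functional :: "real \<Rightarrow> nat \<Rightarrow> (nat \<Rightarrow> real ^ 'n::{finite,linorder}) \<Rightarrow> nat \<Rightarrow> real ^ 'n::{finite,linorder} \<Rightarrow> real" where
  "slot_functional e m v i u = phiW e m v \<bullet> W m (v(i := u)) / (phiW e m v \<bullet> W m v)"

lemma linear_slot_functional: "i < m \<Longrightarrow> linear (slot_functional e m v i)"
proof -
  assume i: "i < m"
  interpret l: linear "\<lambda>x. W m (v(i := x))" by (rule linear_W_slot[OF i])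
  show ?thesis
    by (intro linearI) (simp_all add: slot_functional_def l.add l.scale inner_add_right add_divide_distrib)
qed

lemma phiW_inner_W: "phiW e m v \<bullet> W m v = lq_sum (2 - e) m v"
  by (simp add: phiW_def inner_vec_def phi_mult_self lq_sum_def)

text \<open>The anisotropy is differentiated along the rotation of \<open>w\<close> towards
  \<open>u\<close> in two ways: by the chain rule for the extension \<open>F\<close>, and through a
  basis carried along. The wedge of that basis keeps its length, so only the power sum
  varies.\<close>

lemma tangential_derivative_unit:
  fixes T :: "real ^ 'n::{finite,linorder} ^ 'n::{finite,linorder}"
  assumes T: "T \<in> Grass m" and e: "e < 1"
    and C: "C1_extension m (lq_anisotropy m (2 - e)) F D"
    and v: "\<And>i. i < m \<Longrightarrow> T *v v i = v i" and W0: "W m v \<noteq> 0"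
    and w: "T *v w = w" "norm w = 1" and u: "T *v u = 0" "norm u = 1"
  shows "u \<bullet> ((D T + transpose (D T)) *v w)
    = lq_anisotropy m (2 - e) T * (\<Sum>i<m. (w \<bullet> v i) * slot_functional e m v i u)"
proof -
  let ?q = "2 - e"
  have q: "0 < ?q" using e by simp
  have ww: "w \<bullet> w = 1" "u \<bullet> u = 1" using w u by (auto simp: norm_eq_1)
  have perp: "u \<bullet> z = 0" if "T *v z = z" for z
    using Grass_sym[OF T, of u z] that u by simp
  have wu: "w \<bullet> u = 0" using perp[OF w(1)] by (simp add: inner_commute)
  define X where "X = outer u w + outer w u"
  define x where "x t = cos t *\<^sub>R w + sin t *\<^sub>R u" for t
  define \<gamma> where "\<gamma> t = T - outer w w + outer (x t) (x t)" for t
  define R where "R t z = z - (w \<bullet> z) *\<^sub>R w + (w \<bullet> z) *\<^sub>R (cos t *\<^sub>R w + sin t *\<^sub>R u)" for t z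
  define y where "y t i = R t (v i)" for t i
  have \<gamma>G: "\<gamma> t \<in> Grass m" for t
    unfolding \<gamma>_def x_def by (rule rotate_in_Grass[OF T w u]) simp
  have \<gamma>0: "\<gamma> 0 = T" by (simp add: \<gamma>_def x_def)
  have yfix: "\<gamma> t *v y t i = y t i" if "i < m" for t i
    unfolding \<gamma>_def x_def y_def R_def using rotated_family(2)[OF ww wu perp[OF v[OF that]] v[OF that] w(1) u(1)] .
  have gram: "y t i \<bullet> y t j = v i \<bullet> v j" if "i < m" "j < m" for t i j
    unfolding y_def R_def using rotated_family(1)[OF ww wu perp[OF v[OF that(1)]] perp[OF v[OF that(2)]]] .
  have WW: "W m (y t) \<bullet> W m (y t) = W m v \<bullet> W m v" for t
    unfolding W_inner by (rule ldet_cong) (rule gram)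
  then have nW: "norm (W m (y t)) = norm (W m v)" for t by (simp add: norm_eq_sqrt_inner)
  then have W0': "W m (y t) \<noteq> 0" for t using W0 by (metis norm_eq_zero)
  have val: "F (\<gamma> t) = lq_sum ?q m (y t) powr (1 / ?q) / norm (W m v)" for t
    using C \<gamma>G[of t] lq_anisotropy_family[OF \<gamma>G yfix W0' q, of t] nW[of t] by (simp add: C1_extension_def)
  have y0: "y 0 i = v i" for i by (simp add: y_def R_def)
  define \<Sigma> where "\<Sigma> = (\<Sum>i<m. (w \<bullet> v i) * (phiW e m v \<bullet> W m (v(i := u))))"
  have dy: "((\<lambda>t. y t i) has_vector_derivative (w \<bullet> v i) *\<^sub>R u) (at 0)" for i
    unfolding y_def R_def by (auto intro!: derivative_eq_intros)
  have dW: "((\<lambda>t. wedge m (y t) I) has_real_derivative (\<Sum>i<m. wedge m ((y 0)(i := (w \<bullet> v i) *\<^sub>R u)) I)) (at 0)" for I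
    by (rule has_derivative_wedge) (rule dy)
  have "((\<lambda>t. lq_sum ?q m (y t)) has_real_derivative
      (\<Sum>I\<in>UNIV. ?q * phi e (wedge m (y 0) I) * (\<Sum>i<m. wedge m ((y 0)(i := (w \<bullet> v i) *\<^sub>R u)) I))) (at 0)"
    unfolding lq_sum_def by (intro DERIV_sum DERIV_chain2[OF DERIV_abs_powr[OF e] dW])
  moreover have "(\<Sum>I\<in>UNIV. ?q * phi e (wedge m (y 0) I) * (\<Sum>i<m. wedge m ((y 0)(i := (w \<bullet> v i) *\<^sub>R u)) I)) = ?q * \<Sigma>"
  proof -
    have yv: "y 0 = v" by (rule ext) (rule y0)
    have sl: "wedge m (v(i := (w \<bullet> v i) *\<^sub>R u)) I = (w \<bullet> v i) * wedge m (v(i := u)) I" if "i < m" for i I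
      using arg_cong[OF linear_cmul[OF linear_W_slot[OF that, of v], of "w \<bullet> v i" u], of "\<lambda>z. z $ I"] by simp
    have "(\<Sum>I\<in>UNIV. ?q * phi e (wedge m v I) * (\<Sum>i<m. wedge m (v(i := (w \<bullet> v i) *\<^sub>R u)) I))
      = (\<Sum>I\<in>UNIV. \<Sum>i<m. ?q * ((w \<bullet> v i) * (phi e (wedge m v I) * wedge m (v(i := u)) I)))"
      unfolding sum_distrib_left by (intro sum.cong refl) (simp add: sl)
    also have "\<dots> = ?q * \<Sigma>"
      unfolding \<Sigma>_def by (subst sum.swap) (simp add: phiW_def inner_vec_def sum_distrib_left)
    finally show ?thesis unfolding yv .
  qed
  ultimately have d1: "((\<lambda>t. lq_sum ?q m (y t)) has_real_derivative ?q * \<Sigma>) (at 0)" by simp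
  define Z where "Z = lq_sum ?q m v"
  have Z: "0 < Z" unfolding Z_def by (rule lq_sum_pos[OF W0])
  have Z0: "lq_sum ?q m (y 0) = Z" unfolding Z_def lq_sum_def using wedge_cong[of m "y 0" v] y0 by simp
  have "((\<lambda>t. lq_sum ?q m (y t) powr (1 / ?q)) has_real_derivative
      (1 / ?q) * lq_sum ?q m (y 0) powr (1 / ?q - of_nat 1) * (?q * \<Sigma>)) (at 0)"
    using Z Z0 by (intro DERIV_fun_powr d1) simp
  then have "((\<lambda>t. lq_sum ?q m (y t) powr (1 / ?q) / norm (W m v)) has_real_derivative
      (1 / ?q) * Z powr (1 / ?q - of_nat 1) * (?q * \<Sigma>) / norm (W m v)) (at 0)"
    unfolding Z0 by (rule DERIV_cdivide)
  then have dF: "((\<lambda>t. F (\<gamma> t)) has_real_derivative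
      (1 / ?q) * Z powr (1 / ?q - of_nat 1) * (?q * \<Sigma>) / norm (W m v)) (at 0)"
    unfolding val .
  have d\<gamma>: "(\<gamma> has_derivative (\<lambda>h. h *\<^sub>R X)) (at 0)"
  proof -
    have "\<gamma> = (\<lambda>t. T - outer w w + (cos t)\<^sup>2 *\<^sub>R outer w w + (sin t * cos t) *\<^sub>R X + (sin t)\<^sup>2 *\<^sub>R outer u u)"
      by (simp add: fun_eq_iff \<gamma>_def x_def X_def vec_eq_iff outer_def algebra_simps power2_eq_square)
    then show ?thesis by (auto intro!: derivative_eq_intros)
  qed
  have "GDERIV F (\<gamma> 0) :> D T" using C T unfolding C1_extension_def \<gamma>0 by blast
  then have "((\<lambda>t. F (\<gamma> t)) has_derivative (\<lambda>h. (h *\<^sub>R X) \<bullet> D T)) (at 0)"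
    unfolding gderiv_def by (rule has_derivative_compose[OF d\<gamma>])
  then have "((\<lambda>t. F (\<gamma> t)) has_real_derivative X \<bullet> D T) (at 0)"
    by (simp add: has_field_derivative_def mult_commute_abs)
  from DERIV_unique[OF this dF]
  have "X \<bullet> D T = (1 / ?q) * Z powr (1 / ?q - of_nat 1) * (?q * \<Sigma>) / norm (W m v)" .
  also have "\<dots> = Z powr (1 / ?q) / norm (W m v) * (\<Sigma> / Z)"
    using Z q by (simp add: powr_diff)
  also have "Z powr (1 / ?q) / norm (W m v) = lq_anisotropy m ?q T"
    unfolding Z_def using lq_anisotropy_family[OF T v W0 q] by simp
  also have "\<Sigma> / Z = (\<Sum>i<m. (w \<bullet> v i) * slot_functional e m v i u)"
    unfolding \<Sigma>_def slot_functional_def phiW_inner_W Z_def by (simp add: sum_divide_distrib)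
  finally show ?thesis unfolding inner_symmetrized X_def by (simp add: inner_commute)
qed

lemma tangential_derivative:
  fixes T :: "real ^ 'n::{finite,linorder} ^ 'n::{finite,linorder}"
  assumes T: "T \<in> Grass m" and e: "e < 1"
    and C: "C1_extension m (lq_anisotropy m (2 - e)) F D"
    and v: "\<And>i. i < m \<Longrightarrow> T *v v i = v i" and W0: "W m v \<noteq> 0"
    and w: "T *v w = w" and u: "T *v u = 0"
  shows "u \<bullet> ((D T + transpose (D T)) *v w)
    = lq_anisotropy m (2 - e) T * (\<Sum>i<m. (w \<bullet> v i) * slot_functional e m v i u)"
proof (cases "u = 0 \<or> w = 0")
  case True
  have "slot_functional e m v i 0 = 0" if "i < m" for i
    using linear_0[OF linear_slot_functional[OF that]] .
  then show ?thesis using True by auto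
next
  case False
  define a b where "a = inverse (norm w)" and "b = inverse (norm u)"
  have ab: "a \<noteq> 0" "b \<noteq> 0" using False by (auto simp: a_def b_def)
  have 1: "(b *\<^sub>R u) \<bullet> ((D T + transpose (D T)) *v (a *\<^sub>R w))
    = lq_anisotropy m (2 - e) T * (\<Sum>i<m. ((a *\<^sub>R w) \<bullet> v i) * slot_functional e m v i (b *\<^sub>R u))"
    by (rule tangential_derivative_unit[OF T e C v W0])
      (use False in \<open>auto simp: matrix_vector_scaleR w u a_def b_def\<close>)
  have sl: "slot_functional e m v i (b *\<^sub>R u) = b * slot_functional e m v i u" if "i < m" for i
    using linear_cmul[OF linear_slot_functional[OF that, of e v], of b u] by simp
  have "(\<Sum>i<m. ((a *\<^sub>R w) \<bullet> v i) * slot_functional e m v i (b *\<^sub>R u))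
    = (a * b) * (\<Sum>i<m. (w \<bullet> v i) * slot_functional e m v i u)"
    unfolding sum_distrib_left by (intro sum.cong refl) (simp add: sl)
  moreover have "(b *\<^sub>R u) \<bullet> ((D T + transpose (D T)) *v (a *\<^sub>R w)) = (a * b) * (u \<bullet> ((D T + transpose (D T)) *v w))"
    unfolding matrix_vector_scaleR inner_scaleR_left inner_scaleR_right by (simp only: mult_ac)
  ultimately have "(a * b) * (u \<bullet> ((D T + transpose (D T)) *v w))
    = lq_anisotropy m (2 - e) T * ((a * b) * (\<Sum>i<m. (w \<bullet> v i) * slot_functional e m v i u))"
    using 1 by metis
  also have "\<dots> = (a * b) * (lq_anisotropy m (2 - e) T * (\<Sum>i<m. (w \<bullet> v i) * slot_functional e m v i u))"
    by (simp only: mult_ac)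
  finally have "(a * b) * (u \<bullet> ((D T + transpose (D T)) *v w))
    = (a * b) * (lq_anisotropy m (2 - e) T * (\<Sum>i<m. (w \<bullet> v i) * slot_functional e m v i u))" .
  moreover have "a * b \<noteq> 0" using ab by simp
  ultimately show ?thesis using mult_left_cancel by blast
qed

text \<open>In the plane the slot functionals are coordinates, which gives \<open>\<Psi> T\<close>
  times the identity; on the orthogonal part of \<open>u\<close> they are given by the tangential
  derivative. So the transposed matrix is \<open>\<Psi> T\<close> times an oblique projection onto
  the plane.\<close>

lemma B_mat_transpose_apply:
  fixes T :: "real ^ 'n::{finite,linorder} ^ 'n::{finite,linorder}"
  assumes T: "T \<in> Grass m" and e: "e < 1"
    and v: "span (v ` {..<m}) = range ((*v) T)" and W0: "W m v \<noteq> 0"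
  shows "transpose (B_mat m (lq_anisotropy m (2 - e)) T) *v u
    = lq_anisotropy m (2 - e) T *\<^sub>R (\<Sum>i<m. slot_functional e m v i u *\<^sub>R v i)"
proof -
  let ?\<Psi> = "lq_anisotropy m (2 - e) T"
  obtain F D where C: "C1_extension m (lq_anisotropy m (2 - e) :: ((real, 'n) vec, 'n) vec \<Rightarrow> real) F D"
    using lq_C1_extension[OF e] by blast
  define d where "d = D T + transpose (D T)"
  have Tt: "transpose T = T" using T by (simp add: Grass_def)
  have dt: "transpose d = d" by (simp add: d_def transpose_add add.commute)
  have pt: "transpose (perp T) = perp T" by (simp add: perp_def transpose_diff Tt)
  have B: "transpose (B_mat m (lq_anisotropy m (2 - e)) T) = ?\<Psi> *\<^sub>R T + T ** d ** perp T"
  proof -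
    have "transpose (?\<Psi> *\<^sub>R T) = ?\<Psi> *\<^sub>R T" using Tt by (metis transpose_scalar)
    then show ?thesis
      unfolding B_mat_eq[OF T C] d_def[symmetric]
      by (simp add: transpose_add matrix_transpose_mul Tt dt pt matrix_mul_assoc)
  qed
  have vf: "T *v v i = v i" if "i < m" for i
    using Grass_range[OF T, of "v i"] span_base[of "v i" "v ` {..<m}"] that unfolding v by auto
  define a b where "a = T *v u" and "b = u - T *v u"
  have ab: "T *v a = a" "T *v b = 0" "u = a + b"
    by (simp_all add: a_def b_def Grass_idem[OF T] matrix_vector_mult_diff_distrib)
  have Bu: "transpose (B_mat m (lq_anisotropy m (2 - e)) T) *v u = ?\<Psi> *\<^sub>R a + T *v (d *v b)"
    unfolding B by (simp add: matrix_vector_mult_add_rdistrib scaleR_matrix_vector_assoc[symmetric]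
        matrix_vector_mul_assoc[symmetric] a_def b_def perp_def matrix_vector_mult_diff_rdistrib)
  have Z: "phiW e m v \<bullet> W m v \<noteq> 0" using lq_sum_pos[OF W0, of "2 - e"] by (simp add: phiW_inner_W)
  have fv: "slot_functional e m v i (v k) = (if i = k then 1 else 0)" if "i < m" "k < m" for i k
    using that Z W_slot_other[of i m k v] by (auto simp: slot_functional_def)
  have fa: "(\<Sum>i<m. slot_functional e m v i a *\<^sub>R v i) = a"
  proof -
    have "a \<in> span (v ` {..<m})" unfolding v using ab(1) Grass_range[OF T] by blast
    then obtain g where g: "a = (\<Sum>k<m. g k *\<^sub>R v k)" using span_family_lincomb by blast
    have "slot_functional e m v i a = g i" if i: "i < m" for i
    proof -
      interpret l: linear "slot_functional e m v i" by (rule linear_slot_functional[OF i])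
      have "slot_functional e m v i a = (\<Sum>k<m. g k * slot_functional e m v i (v k))"
        unfolding g by (simp add: l.sum l.scale)
      also have "\<dots> = (\<Sum>k<m. if k = i then g i else 0)" using i by (intro sum.cong) (auto simp: fv)
      finally show ?thesis using i by simp
    qed
    then show ?thesis by (subst (2) g) (auto intro!: sum.cong)
  qed
  have fb: "T *v (d *v b) = ?\<Psi> *\<^sub>R (\<Sum>i<m. slot_functional e m v i b *\<^sub>R v i)"
  proof -
    have "y \<bullet> (T *v (d *v b)) = y \<bullet> (?\<Psi> *\<^sub>R (\<Sum>i<m. slot_functional e m v i b *\<^sub>R v i))" for y
    proof -
      have "y \<bullet> (T *v (d *v b)) = (T *v y) \<bullet> (d *v b)" by (rule Grass_sym[OF T])
      also have "\<dots> = b \<bullet> (d *v (T *v y))"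
        by (metis dt dot_lmul_matrix inner_commute vector_transpose_matrix)
      also have "\<dots> = ?\<Psi> * (\<Sum>i<m. ((T *v y) \<bullet> v i) * slot_functional e m v i b)"
        unfolding d_def by (rule tangential_derivative[OF T e C vf W0 Grass_idem[OF T] ab(2)])
      also have "\<dots> = ?\<Psi> * (\<Sum>i<m. (y \<bullet> v i) * slot_functional e m v i b)"
        by (intro arg_cong2[where f="(*)"] sum.cong refl) (metis Grass_sym[OF T] vf lessThan_iff)
      finally show ?thesis by (simp add: inner_sum_right mult.commute)
    qed
    then show ?thesis by (metis vector_eq_ldot)
  qed
  have "(\<Sum>i<m. slot_functional e m v i u *\<^sub>R v i)
    = (\<Sum>i<m. slot_functional e m v i a *\<^sub>R v i) + (\<Sum>i<m. slot_functional e m v i b *\<^sub>R v i)"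
    unfolding sum.distrib[symmetric]
    by (intro sum.cong refl) (simp add: ab(3) linear_add[OF linear_slot_functional] scaleR_add_left)
  then show ?thesis unfolding Bu fa fb by (simp add: fa scaleR_add_right)
qed

lemma B_mat_transpose_sum_outer:
  fixes T :: "real ^ 'n::{finite,linorder} ^ 'n::{finite,linorder}"
  assumes T: "T \<in> Grass m" and e: "e < 1"
    and v: "span (v ` {..<m}) = range ((*v) T)" and W0: "W m v \<noteq> 0"
  shows "transpose (B_mat m (lq_anisotropy m (2 - e)) T)
    = lq_anisotropy m (2 - e) T *\<^sub>R (\<Sum>i<m. outer (v i) (\<chi> j. slot_functional e m v i (axis j 1)))"
proof -
  have f: "(\<chi> j. slot_functional e m v i (axis j 1)) \<bullet> u = slot_functional e m v i u" if i: "i < m" for i u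
  proof -
    interpret l: linear "slot_functional e m v i" by (rule linear_slot_functional[OF i])
    have "slot_functional e m v i u = slot_functional e m v i (\<Sum>j\<in>UNIV. u $ j *\<^sub>R axis j 1)"
      using basis_expansion[of u] by (simp add: scalar_mult_eq_scaleR)
    also have "\<dots> = (\<Sum>j\<in>UNIV. u $ j * slot_functional e m v i (axis j 1))" by (simp add: l.sum l.scale)
    finally show ?thesis by (simp add: inner_vec_def mult.commute)
  qed
  show ?thesis
    unfolding matrix_eq B_mat_transpose_apply[OF T e v W0]
    using f by (auto simp: scaleR_matrix_vector_assoc[symmetric] matrix_sum_outer_mult)
qed

text \<open>The dual matrix at \<open>perp S\<close> is \<open>\<Psi> S\<close> times the identity
  minus the transpose of \<open>B_mat m \<Psi> S\<close>. The pairing thus becomes the trace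
  \<open>m\<close> of one oblique projection minus the trace of a product of two.\<close>

lemma B_mat_pairing:
  fixes S T :: "real ^ 'n::{finite,linorder} ^ 'n::{finite,linorder}"
  assumes T: "T \<in> Grass m" and S: "S \<in> Grass m" and m: "m \<le> CARD('n)" and e: "e < 1"
    and v: "span (v ` {..<m}) = range ((*v) T)" "W m v \<noteq> 0"
    and w: "span (w ` {..<m}) = range ((*v) S)" "W m w \<noteq> 0"
  shows "B_mat m (lq_anisotropy m (2 - e)) T \<bullet> B_mat (CARD('n) - m) (dual_int (lq_anisotropy m (2 - e))) (perp S)
    = lq_anisotropy m (2 - e) T * lq_anisotropy m (2 - e) S *
      (m - (\<Sum>i<m. \<Sum>j<m. slot_functional e m v i (w j) * slot_functional e m w j (v i)))"
proof -
  let ?\<Psi> = "lq_anisotropy m (2 - e) :: ((real, 'n) vec, 'n) vec \<Rightarrow> real"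
  obtain F D where C: "C1_extension m ?\<Psi> F D" using lq_C1_extension[OF e] by blast
  define A where "A v i = (\<chi> j. slot_functional e m v i (axis j 1))" for v :: "nat \<Rightarrow> (real, 'n) vec" and i
  define d where "d = D S + transpose (D S)"
  have St: "transpose S = S" using S by (simp add: Grass_def)
  have dt: "transpose d = d" by (simp add: d_def transpose_add add.commute)
  have pt: "transpose (perp S) = perp S" by (simp add: perp_def transpose_diff St)
  have "transpose (?\<Psi> S *\<^sub>R S) = ?\<Psi> S *\<^sub>R S" using St by (metis transpose_scalar)
  then have "transpose (B_mat m ?\<Psi> S) = ?\<Psi> S *\<^sub>R S + S ** d ** perp S"
    unfolding B_mat_eq[OF S C] d_def[symmetric]
    by (simp add: transpose_add matrix_transpose_mul St dt pt matrix_mul_assoc)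
  then have dual: "B_mat (CARD('n) - m) (dual_int ?\<Psi>) (perp S) = ?\<Psi> S *\<^sub>R mat 1 - transpose (B_mat m ?\<Psi> S)"
    unfolding B_mat_dual_eq[OF S m C] d_def[symmetric] by (simp add: perp_def scaleR_diff_right)
  have BT: "B_mat m ?\<Psi> T = ?\<Psi> T *\<^sub>R (\<Sum>i<m. outer (A v i) (v i))"
  proof -
    have "B_mat m ?\<Psi> T = transpose (transpose (B_mat m ?\<Psi> T))" by simp
    also have "\<dots> = transpose (?\<Psi> T *\<^sub>R (\<Sum>i<m. outer (v i) (A v i)))"
      unfolding B_mat_transpose_sum_outer[OF T e v] A_def ..
    also have "\<dots> = ?\<Psi> T *\<^sub>R (\<Sum>i<m. outer (A v i) (v i))"
      by (simp add: vec_eq_iff transpose_def outer_def sum_component mult.commute)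
    finally show ?thesis .
  qed
  have f: "A v i \<bullet> u = slot_functional e m v i u" if i: "i < m" for v i u
  proof -
    interpret l: linear "slot_functional e m v i" by (rule linear_slot_functional[OF i])
    have "slot_functional e m v i u = slot_functional e m v i (\<Sum>j\<in>UNIV. u $ j *\<^sub>R axis j 1)"
      using basis_expansion[of u] by (simp add: scalar_mult_eq_scaleR)
    also have "\<dots> = (\<Sum>j\<in>UNIV. u $ j * slot_functional e m v i (axis j 1))" by (simp add: l.sum l.scale)
    finally show ?thesis by (simp add: A_def inner_vec_def mult.commute)
  qed
  have Z: "phiW e m v \<bullet> W m v \<noteq> 0" using lq_sum_pos[OF v(2), of "2 - e"] by (simp add: phiW_inner_W)
  have 1: "(\<Sum>i<m. outer (A v i) (v i)) \<bullet> mat 1 = m"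
  proof -
    have "outer a b \<bullet> mat 1 = a \<bullet> b" for a b :: "(real, 'n) vec"
      using inner_outer[of "mat 1" a b] by (simp add: inner_commute)
    then have "(\<Sum>i<m. outer (A v i) (v i)) \<bullet> mat 1 = (\<Sum>i<m. slot_functional e m v i (v i))"
      by (simp add: inner_sum_left f)
    also have "\<dots> = m" using Z by (simp add: slot_functional_def)
    finally show ?thesis .
  qed
  have 2: "(\<Sum>i<m. outer (A v i) (v i)) \<bullet> (\<Sum>j<m. outer (w j) (A w j))
    = (\<Sum>i<m. \<Sum>j<m. slot_functional e m v i (w j) * slot_functional e m w j (v i))"
  proof -
    have "outer a b \<bullet> outer c g = (a \<bullet> c) * (g \<bullet> b)" for a b c g :: "(real, 'n) vec"
      using inner_outer[of "outer c g" a b] by (simp add: inner_commute[of "outer a b"] outer_mult_vec)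
    then show ?thesis unfolding inner_sum_left inner_sum_right by (subst sum.swap, intro sum.cong refl) (simp add: f)
  qed
  show ?thesis
    unfolding dual BT B_mat_transpose_sum_outer[OF S e w] A_def[symmetric]
    unfolding inner_diff_right inner_scaleR_left inner_scaleR_right 1 2
    by (simp add: algebra_simps)
qed

section \<open>Duality and the main theorem\<close>

text \<open>The squared distance of the projections is twice the sum of the squared sines of the
  principal angles, each at most \<open>X\<close>.\<close>

lemma norm_diff_projections:
  fixes v w :: "nat \<Rightarrow> real ^ 'n::{finite,linorder}"
  assumes pb: "principal_bases m v w c"
  shows "(norm ((\<Sum>k<m. outer (v k) (v k)) - (\<Sum>k<m. outer (w k) (w k))))\<^sup>2
    \<le> 2 * real m * (1 - (W m v \<bullet> W m w)\<^sup>2)"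
proof -
  interpret pb: principal_bases m v w c by (rule pb)
  have oo: "outer a a \<bullet> outer b b = (a \<bullet> b)\<^sup>2" for a b :: "(real, 'n) vec"
    using inner_outer[of "outer b b" a a]
    by (simp add: inner_commute[of "outer a a"] outer_mult_vec power2_eq_square inner_commute[of b a])
  have sums: "(\<Sum>k<m. outer (a k) (a k)) \<bullet> (\<Sum>k<m. outer (b k) (b k)) = (\<Sum>k<m. (d k)\<^sup>2)"
    if "\<And>i j. i < m \<Longrightarrow> j < m \<Longrightarrow> a i \<bullet> b j = (if i = j then d i else 0)" for a b :: "nat \<Rightarrow> (real, 'n) vec" and d
  proof -
    have "(\<Sum>k<m. outer (a k) (a k)) \<bullet> (\<Sum>k<m. outer (b k) (b k)) = (\<Sum>k<m. \<Sum>l<m. (a k \<bullet> b l)\<^sup>2)"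
      unfolding inner_sum_left inner_sum_right by (subst sum.swap) (simp add: oo)
    also have "\<dots> = (\<Sum>k<m. \<Sum>l<m. if l = k then (d k)\<^sup>2 else 0)"
      using that by (intro sum.cong refl) auto
    finally show ?thesis by simp
  qed
  define A B where "A = (\<Sum>k<m. outer (v k) (v k))" and "B = (\<Sum>k<m. outer (w k) (w k))"
  have AA: "A \<bullet> A = m" "B \<bullet> B = m" "A \<bullet> B = (\<Sum>k<m. (c k)\<^sup>2)"
    unfolding A_def B_def using sums[of v v "\<lambda>_. 1"] sums[of w w "\<lambda>_. 1"] sums[of v w c]
    by (simp_all add: pb.vv pb.ww pb.vw)
  have "(norm (A - B))\<^sup>2 = A \<bullet> A + B \<bullet> B - 2 * (A \<bullet> B)"
    unfolding power2_norm_eq_inner by (simp add: inner_diff_left inner_diff_right inner_commute[of B A])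
  also have "\<dots> = 2 * (\<Sum>k<m. pb.x k)" unfolding AA by (simp add: pb.x_def sum_subtractf)
  also have "\<dots> \<le> 2 * (\<Sum>k<m. pb.X)" by (intro mult_left_mono sum_mono pb.x_le_X) auto
  also have "\<dots> = 2 * real m * (1 - (W m v \<bullet> W m w)\<^sup>2)" by (simp add: pb.X_def pb.W_vw)
  finally show ?thesis unfolding A_def B_def .
qed

lemma lq_pairing_lower_bound:
  assumes m: "1 \<le> m" "m \<le> CARD('n::{finite,linorder})" and e: "0 \<le> e" "e * real m \<le> 7/10"
  shows "\<exists>k>0. \<forall>S\<in>Grass m. \<forall>T\<in>(Grass m :: (real ^ 'n::{finite,linorder} ^ 'n::{finite,linorder}) set).
    k * (norm (T - S))\<^sup>2 \<le> B_mat m (lq_anisotropy m (2 - e)) T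
      \<bullet> B_mat (CARD('n) - m) (dual_int (lq_anisotropy m (2 - e))) (perp S)"
proof -
  have "e * 1 \<le> e * real m" using m e by (intro mult_left_mono) auto
  then have e1: "e < 1" using e by linarith
  obtain k where k: "0 < k" and F: "\<And>v w :: nat \<Rightarrow> (real, 'n) vec. orthonormal m v \<Longrightarrow> orthonormal m w \<Longrightarrow>
    \<exists>v' w'. span (v' ` {..<m}) = span (v ` {..<m}) \<and> span (w' ` {..<m}) = span (w ` {..<m}) \<and>
      0 < phiW e m v' \<bullet> W m v' \<and> 0 < phiW e m w' \<bullet> W m w' \<and>
      k * (1 - (W m v \<bullet> W m w)\<^sup>2) \<le> m - (\<Sum>i<m. \<Sum>j<m.
        (phiW e m v' \<bullet> W m (v'(i := w' j)) / (phiW e m v' \<bullet> W m v')) *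
        (phiW e m w' \<bullet> W m (w'(j := v' i)) / (phiW e m w' \<bullet> W m w')))"
    by (rule trace_deficit_uniform[OF m(1) e]) (rule that, assumption, blast)
  show ?thesis
  proof (intro exI[of _ "k / (2 * real m)"] conjI ballI)
    show "0 < k / (2 * real m)" using k m by simp
    fix S T :: "((real, 'n) vec, 'n) vec"
    assume S: "S \<in> Grass m" and T: "T \<in> Grass m"
    obtain v w c where pb: "principal_bases m v w c"
      and sp: "span (v ` {..<m}) = range ((*v) T)" "span (w ` {..<m}) = range ((*v) S)"
      by (rule principal_bases_exist[OF subspace_range_matrix subspace_range_matrix dim_range_Grass[OF T] dim_range_Grass[OF S]])
    interpret pb: principal_bases m v w c by (rule pb)
    obtain v' w' where sp': "span (v' ` {..<m}) = range ((*v) T)" "span (w' ` {..<m}) = range ((*v) S)"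
      and Z: "0 < phiW e m v' \<bullet> W m v'" "0 < phiW e m w' \<bullet> W m w'"
      and le: "k * (1 - (W m v \<bullet> W m w)\<^sup>2) \<le> m - (\<Sum>i<m. \<Sum>j<m.
        slot_functional e m v' i (w' j) * slot_functional e m w' j (v' i))"
      using F[OF pb.v pb.w] unfolding sp slot_functional_def by blast
    have W0: "W m v' \<noteq> 0" "W m w' \<noteq> 0" using Z by auto
    let ?F = "m - (\<Sum>i<m. \<Sum>j<m. slot_functional e m v' i (w' j) * slot_functional e m w' j (v' i))"
    let ?d = "(norm (T - S))\<^sup>2"
    have "?d \<le> 2 * real m * (1 - (W m v \<bullet> W m w)\<^sup>2)"
      using norm_diff_projections[OF pb] unfolding Grass_sum_outer[OF T pb.v sp(1), symmetric]
        Grass_sum_outer[OF S pb.w sp(2), symmetric] .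
    then have "k / (2 * real m) * ?d \<le> k / (2 * real m) * (2 * real m * (1 - (W m v \<bullet> W m w)\<^sup>2))"
      using k by (intro mult_left_mono) auto
    also have "\<dots> = k * (1 - (W m v \<bullet> W m w)\<^sup>2)" using m by simp
    also note le
    finally have dF: "k / (2 * real m) * ?d \<le> ?F" .
    moreover have "0 \<le> k / (2 * real m) * ?d" using k by simp
    ultimately have F0: "0 \<le> ?F" by (rule order_trans[rotated])
    have "1 * 1 \<le> lq_anisotropy m (2 - e) T * lq_anisotropy m (2 - e) S"
      using lq_anisotropy_ge_1[OF T, of "2 - e"] lq_anisotropy_ge_1[OF S, of "2 - e"] e e1 by (intro mult_mono) auto
    then have "1 * ?F \<le> lq_anisotropy m (2 - e) T * lq_anisotropy m (2 - e) S * ?F"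
      using F0 by (intro mult_right_mono) auto
    then show "k / (2 * real m) * ?d \<le> B_mat m (lq_anisotropy m (2 - e)) T
      \<bullet> B_mat (CARD('n) - m) (dual_int (lq_anisotropy m (2 - e))) (perp S)"
      using dF unfolding B_mat_pairing[OF T S m(2) e1 sp'(1) W0(1) sp'(2) W0(2)] by simp
  qed
qed

section \<open>Complementary Pluecker coordinates\<close>

lemma ldet_leading_block:
  assumes mN: "m \<le> N" and A: "\<And>j k. j < N \<Longrightarrow> m \<le> k \<Longrightarrow> k < N \<Longrightarrow> A j k = (if j = k then 1 else 0)"
  shows "ldet N A = ldet m A"
proof -
  \<comment> \<open>A permutation that moves some index \<open>k \<ge> m\<close> sends another index
    \<open>j\<close> to the column \<open>k\<close>, where the entry is \<open>0\<close>.\<close>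
  have "of_int (sign p) * (\<Prod>j<N. A j (p j)) = 0" if p: "p permutes {..<N}" and np: "\<not> p permutes {..<m}" for p
  proof -
    obtain k where k: "k \<in> {..<N} - {..<m}" "p k \<noteq> k" using permutes_superset[OF p, of "{..<m}"] np by blast
    define j where "j = inv p k"
    have pj: "p j = k" using p by (simp add: j_def permutes_inverses)
    have "j < N" using permutes_in_image[OF p, of j] pj k by simp
    moreover have "j \<noteq> k" using pj k by auto
    ultimately have "A j (p j) = 0" using A[of j k] k pj by auto
    then have "(\<Prod>j<N. A j (p j)) = 0" using \<open>j < N\<close> by (intro prod_zero) auto
    then show ?thesis by simp
  qed
  then have "ldet N A = (\<Sum>p | p permutes {..<m}. of_int (sign p) * (\<Prod>j<N. A j (p j)))"
    unfolding ldet_def using mN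
    by (intro sum.mono_neutral_right finite_permutations) (auto intro: permutes_subset)
  also have "\<dots> = ldet m A"
    unfolding ldet_def
  proof (intro sum.cong refl arg_cong2[where f="(*)"])
    fix p assume p: "p \<in> {p. p permutes {..<m}}"
    show "(\<Prod>j<N. A j (p j)) = (\<Prod>j<m. A j (p j))"
    proof (rule prod.mono_neutral_right)
      show "\<forall>i\<in>{..<N} - {..<m}. A i (p i) = 1" using p A by (auto simp: permutes_not_in)
    qed (use mN in auto)
  qed
  finally show ?thesis .
qed

text \<open>In top degree \<open>UNIV\<close> is the only index set, and \<open>W_inner\<close>
  becomes the product formula for full determinants.\<close>

lemma wedge_UNIV_mult:
  fixes x y :: "nat \<Rightarrow> real ^ 'n::{finite,linorder}"
  shows "wedge CARD('n) x UNIV * wedge CARD('n) y UNIV = ldet CARD('n) (\<lambda>j k. x j \<bullet> y k)"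
proof -
  have "W CARD('n) x \<bullet> W CARD('n) y = (\<Sum>I\<in>{UNIV}. wedge CARD('n) x I * wedge CARD('n) y I)"
    unfolding inner_vec_def
  proof (simp only: W_nth inner_real_def, rule sum.mono_neutral_right)
    show "\<forall>I\<in>UNIV - {UNIV}. wedge CARD('n) x I * wedge CARD('n) y I = 0"
    proof
      fix I :: "'n set" assume "I \<in> UNIV - {UNIV}"
      then have "card I \<noteq> CARD('n)" using card_subset_eq[of UNIV I] by auto
      then show "wedge CARD('n) x I * wedge CARD('n) y I = 0" by (simp add: wedge_0)
    qed
  qed auto
  then show ?thesis by (simp add: W_inner)
qed

definition joined :: "nat \<Rightarrow> (nat \<Rightarrow> 'a) \<Rightarrow> (nat \<Rightarrow> 'a) \<Rightarrow> nat \<Rightarrow> 'a" where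
  "joined m a b i = (if i < m then a i else b (i - m))"

lemma wedge_joined_mult:
  fixes a b z :: "nat \<Rightarrow> real ^ 'n::{finite,linorder}"
  assumes m: "m \<le> CARD('n)" and o: "orthonormal CARD('n) (joined m a b)"
  shows "wedge CARD('n) (joined m a b) UNIV * wedge CARD('n) (joined m z b) UNIV = ldet m (\<lambda>j k. a j \<bullet> z k)"
    and "\<bar>wedge CARD('n) (joined m a b) UNIV\<bar> = 1"
proof -
  have "ldet CARD('n) (\<lambda>j k. joined m a b j \<bullet> joined m z b k) = ldet m (\<lambda>j k. joined m a b j \<bullet> joined m z b k)"
  proof (rule ldet_leading_block[OF m])
    fix j k assume jk: "j < CARD('n)" "m \<le> k" "k < CARD('n)"
    then have "joined m z b k = joined m a b k" by (simp add: joined_def)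
    then show "joined m a b j \<bullet> joined m z b k = (if j = k then 1 else 0)"
      using o jk by (simp add: orthonormal_def)
  qed
  also have "\<dots> = ldet m (\<lambda>j k. a j \<bullet> z k)" by (rule ldet_cong) (simp add: joined_def)
  finally show "wedge CARD('n) (joined m a b) UNIV * wedge CARD('n) (joined m z b) UNIV = ldet m (\<lambda>j k. a j \<bullet> z k)"
    unfolding wedge_UNIV_mult .
  have "wedge CARD('n) (joined m a b) UNIV * wedge CARD('n) (joined m a b) UNIV = (\<Prod>j<CARD('n). 1)"
    unfolding wedge_UNIV_mult using o by (subst ldet_diag) (auto simp: orthonormal_def)
  then have "(wedge CARD('n) (joined m a b) UNIV)\<^sup>2 = 1" by (simp add: power2_eq_square)
  then show "\<bar>wedge CARD('n) (joined m a b) UNIV\<bar> = 1" by (simp add: power2_eq_1_iff abs_if) auto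
qed

text \<open>The two families differ by a cyclic shift of the \<open>m + l\<close> positions, which
  costs only a sign.\<close>

lemma wedge_joined_swap:
  fixes a b :: "nat \<Rightarrow> real ^ 'n::{finite,linorder}"
  assumes ml: "m + l = CARD('n)"
  shows "\<bar>wedge CARD('n) (joined m a b) UNIV\<bar> = \<bar>wedge CARD('n) (joined l b a) UNIV\<bar>"
proof -
  define s where "s k = (if k < l then m + k else if k < m + l then k - l else k)" for k
  have s: "s permutes {..<m + l}"
  proof (rule bij_imp_permutes)
    show "bij_betw s {..<m + l} {..<m + l}"
      by (rule bij_betw_byWitness[where f' = "\<lambda>k. if k < m then k + l else k - m"]) (auto simp: s_def)
  qed (auto simp: s_def)
  have "wedge CARD('n) (joined l b a) UNIV = wedge CARD('n) (\<lambda>k. joined m a b (s k)) UNIV"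
    unfolding ml[symmetric] by (rule fun_cong[OF wedge_cong]) (auto simp: joined_def s_def)
  also have "\<dots> = of_int (sign s) * wedge CARD('n) (joined m a b) UNIV"
    using ldet_permute_rows[OF s, of "\<lambda>j k. joined m a b j $ (sorted_list_of_set UNIV ! k)"]
    unfolding ml by (simp add: wedge_ldet)
  finally show ?thesis by (simp add: abs_mult sign_def)
qed

text \<open>Jacobi's theorem on complementary minors of an orthogonal matrix. Completing
  \<open>v\<close> by \<open>u\<close>, and the axes of \<open>- I\<close> by those of
  \<open>I\<close>, shows that both sides are the modulus of the determinant of the axes of
  \<open>I\<close> joined with \<open>u\<close>.\<close>

lemma wedge_complement:
  fixes v u :: "nat \<Rightarrow> real ^ 'n::{finite,linorder}"
  assumes ml: "m + l = CARD('n)" and v: "orthonormal m v" and u: "orthonormal l u"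
    and vu: "\<And>i j. i < m \<Longrightarrow> j < l \<Longrightarrow> v i \<bullet> u j = 0" and I: "card I = m"
  shows "\<bar>wedge m v I\<bar> = \<bar>wedge l u (- I)\<bar>"
proof -
  define a b :: "nat \<Rightarrow> (real, 'n) vec" where "a k = axis (sorted_list_of_set I ! k) 1"
    and "b k = axis (sorted_list_of_set (- I) ! k) 1" for k
  have J: "card (- I) = l" using I ml by (simp add: Compl_eq_Diff_UNIV card_Diff_subset)
  have ba: "bij_betw ((!) (sorted_list_of_set I)) {..<m} I" and bb: "bij_betw ((!) (sorted_list_of_set (- I))) {..<l} (- I)"
    using I J by (auto intro: bij_betw_nth_sorted_list_of_set)
  have ax: "axis i 1 \<bullet> (axis j 1 :: (real, 'n) vec) = (if i = j then 1 else 0)" for i j by (simp add: inner_axis_axis)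
  have o1: "orthonormal CARD('n) (joined m v u)"
    unfolding orthonormal_def
  proof (intro allI impI)
    fix i j assume ij: "i < CARD('n)" "j < CARD('n)"
    show "joined m v u i \<bullet> joined m v u j = (if i = j then 1 else 0)"
      using ij v u vu[of i "j - m"] vu[of j "i - m"] ml
      by (auto simp: joined_def orthonormal_def inner_commute)
  qed
  have aI: "sorted_list_of_set I ! k \<in> I" if "k < m" for k using bij_betwE[OF ba] that by auto
  have bI: "sorted_list_of_set (- I) ! k \<in> - I" if "k < l" for k using bij_betwE[OF bb] that by auto
  have o2: "orthonormal CARD('n) (joined l b a)"
    unfolding orthonormal_def
  proof (intro allI impI)
    fix i j assume ij: "i < CARD('n)" "j < CARD('n)"
    have 1: "a p \<bullet> a q = (if p = q then 1 else 0)" if "p < m" "q < m" for p q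
      using bij_betw_imp_inj_on[OF ba] that unfolding a_def ax by (auto dest: inj_onD)
    have 2: "b p \<bullet> b q = (if p = q then 1 else 0)" if "p < l" "q < l" for p q
      using bij_betw_imp_inj_on[OF bb] that unfolding b_def ax by (auto dest: inj_onD)
    have 3: "a p \<bullet> b q = 0" "b q \<bullet> a p = 0" if "p < m" "q < l" for p q
      using aI[OF that(1)] bI[OF that(2)] unfolding a_def b_def ax by auto
    show "joined l b a i \<bullet> joined l b a j = (if i = j then 1 else 0)"
      using ij 1[of "i - l" "j - l"] 2[of i j] 3[of "i - l" j] 3[of "j - l" i] ml
      by (auto simp: joined_def)
  qed
  have "ldet m (\<lambda>j k. v j \<bullet> a k) = wedge m v I"
    unfolding wedge_ldet[OF I] by (rule ldet_cong) (simp add: a_def inner_axis)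
  then have "wedge m v I = wedge CARD('n) (joined m v u) UNIV * wedge CARD('n) (joined m a u) UNIV"
    using wedge_joined_mult(1)[OF _ o1, of a] ml by simp
  moreover have "\<bar>wedge CARD('n) (joined m v u) UNIV\<bar> = 1"
    by (rule wedge_joined_mult(2)[OF _ o1]) (use ml in simp)
  ultimately have 1: "\<bar>wedge m v I\<bar> = \<bar>wedge CARD('n) (joined m a u) UNIV\<bar>" by (simp add: abs_mult)
  have "ldet l (\<lambda>j k. b j \<bullet> u k) = ldet l (\<lambda>j k. u k $ (sorted_list_of_set (- I) ! j))"
    by (rule ldet_cong) (simp add: b_def inner_axis inner_commute[of "axis _ _"])
  also have "\<dots> = wedge l u (- I)"
    unfolding wedge_ldet[OF J] by (rule ldet_transpose[of l "\<lambda>j k. u j $ (sorted_list_of_set (- I) ! k)"])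
  finally have "wedge l u (- I) = wedge CARD('n) (joined l b a) UNIV * wedge CARD('n) (joined l u a) UNIV"
    using wedge_joined_mult(1)[OF _ o2, of u] ml by simp
  moreover have "\<bar>wedge CARD('n) (joined l b a) UNIV\<bar> = 1"
    by (rule wedge_joined_mult(2)[OF _ o2]) (use ml in simp)
  ultimately have "\<bar>wedge l u (- I)\<bar> = \<bar>wedge CARD('n) (joined l u a) UNIV\<bar>" by (simp add: abs_mult)
  then show ?thesis using 1 wedge_joined_swap[OF ml, of a u] by simp
qed

lemma lq_anisotropy_perp:
  fixes T :: "real ^ 'n::{finite,linorder} ^ 'n::{finite,linorder}"
  assumes T: "T \<in> Grass m" and m: "m \<le> CARD('n)"
  shows "lq_anisotropy (CARD('n) - m) q (perp T) = lq_anisotropy m q T"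
proof -
  let ?l = "CARD('n) - m"
  have P: "perp T \<in> Grass ?l" by (rule perp_in_Grass[OF T m])
  obtain v where v: "orthonormal m v" "span (v ` {..<m}) = range ((*v) T)" using Grass_orthonormal_basis[OF T] by blast
  obtain u where u: "orthonormal ?l u" "span (u ` {..<?l}) = range ((*v) (perp T))" using Grass_orthonormal_basis[OF P] by blast
  have "v i \<bullet> u j = 0" if "i < m" "j < ?l" for i j
  proof -
    have "T *v v i = v i" using Grass_range[OF T, of "v i"] span_base[of "v i" "v ` {..<m}"] that unfolding v by auto
    moreover have "perp T *v u j = u j" using Grass_range[OF P, of "u j"] span_base[of "u j" "u ` {..<?l}"] that unfolding u by auto
    then have "T *v u j = 0" by (simp add: perp_def matrix_vector_mult_diff_rdistrib)
    ultimately show ?thesis using Grass_sym[OF T, of "v i" "u j"] by simp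
  qed
  then have eq: "\<bar>wedge m v I\<bar> = \<bar>wedge ?l u (- I)\<bar>" if "card I = m" for I
    using wedge_complement[OF _ v(1) u(1) _ that] m by auto
  have "lq_sum q ?l u = (\<Sum>I\<in>UNIV. \<bar>wedge ?l u (- I)\<bar> powr q)"
    unfolding lq_sum_def
    by (rule sum.reindex_bij_witness[where i = uminus and j = uminus]) auto
  also have "\<dots> = lq_sum q m v"
    unfolding lq_sum_def
  proof (intro sum.cong refl)
    fix I :: "'n set"
    show "\<bar>wedge ?l u (- I)\<bar> powr q = \<bar>wedge m v I\<bar> powr q"
    proof (cases "card I = m")
      case False
      then have "card (- I) \<noteq> ?l" using m card_mono[of UNIV I] by (simp add: Compl_eq_Diff_UNIV card_Diff_subset)
      then show ?thesis using False by (simp add: wedge_0)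
    qed (simp add: eq)
  qed
  finally show ?thesis
    using lq_anisotropy_orthonormal[OF T v, of q] lq_anisotropy_orthonormal[OF P u, of q] by simp
qed

text \<open>Integrands that agree on the Grassmannian have the same extensions, so even the
  arbitrary choice in \<open>grad_ext\<close> is the same.\<close>

lemma B_mat_cong:
  assumes eq: "\<And>T. T \<in> Grass m \<Longrightarrow> \<Psi> T = \<Psi>' T" and T: "T \<in> Grass m"
  shows "B_mat m \<Psi> T = B_mat m \<Psi>' T"
proof -
  have "C1_extension m \<Psi> F D = C1_extension m \<Psi>' F D" for F D
    using eq by (auto simp: C1_extension_def)
  then show ?thesis using eq[OF T] by (simp add: B_mat_def d_int_def grad_ext_def)
qed

theorem theorem1p3:
  fixes m :: nat and q :: real
  assumes "1 \<le> m" and "m < CARD('n::{finite,linorder})"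
    and "2 - 7 / (10 * real (min m (CARD('n::{finite,linorder}) - m))) \<le> q" and "q \<le> 2"
  shows "USAC m (lq_anisotropy m q :: real ^ 'n::{finite,linorder} ^ 'n::{finite,linorder} \<Rightarrow> real)"
proof -
  define e l where "e = 2 - q" and "l = CARD('n) - m"
  have q: "q = 2 - e" by (simp add: e_def)
  have l: "1 \<le> l" "l \<le> CARD('n)" "CARD('n) - l = m" "m \<le> CARD('n)" using assms(1,2) by (auto simp: l_def)
  have e0: "0 \<le> e" using assms(4) by (simp add: e_def)
  have mn: "1 \<le> real (min m l)" using assms(1) l by auto
  have "e \<le> 7 / (10 * real (min m l))" using assms(3) by (simp add: e_def l_def)
  then have "e * (10 * real (min m l)) \<le> 7" using mn by (subst (asm) pos_le_divide_eq) auto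
  then have em: "e * real (min m l) \<le> 7/10" by simp
  have "e * 1 \<le> e * real (min m l)" using mn e0 by (intro mult_left_mono) auto
  then have e1: "e < 1" using em by linarith
  let ?\<Psi> = "lq_anisotropy m q :: ((real, 'n) vec, 'n) vec \<Rightarrow> real"
  have "0 < ?\<Psi> T" if "T \<in> Grass m" for T
    using lq_anisotropy_ge_1[OF that, of q] e1 assms(4) by (auto simp: e_def)
  then have C1: "C1_integrand m ?\<Psi>"
    unfolding C1_integrand_def using lq_C1_extension[OF e1, of m, where 'n = 'n] unfolding q by blast
  have "\<exists>k>0. \<forall>S\<in>Grass m. \<forall>T\<in>Grass m.
    k * (norm (T - S))\<^sup>2 \<le> B_mat m ?\<Psi> T \<bullet> B_mat (CARD('n) - m) (dual_int ?\<Psi>) (perp S)"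
  proof (cases "m \<le> l")
    case True
    then have "e * real m \<le> 7/10" using em by (simp add: min_def)
    then show ?thesis unfolding q by (rule lq_pairing_lower_bound[OF assms(1) l(4) e0])
  next
    case False
    \<comment> \<open>On \<open>l\<close>-planes the anisotropy is \<open>?\<Phi>\<close>, whose
      dual agrees with \<open>?\<Psi>\<close> on \<open>m\<close>-planes, and vice versa. Hence the
      pairing for \<open>perp T\<close> and \<open>perp S\<close> in degree \<open>l\<close> is the
      required one with its two factors exchanged.\<close>
    let ?\<Phi> = "lq_anisotropy l q :: ((real, 'n) vec, 'n) vec \<Rightarrow> real"
    have "e * real l \<le> 7/10" using em False by (simp add: min_def)
    then have "\<exists>k>0. \<forall>S\<in>Grass l. \<forall>T\<in>Grass l.
      k * (norm (T - S))\<^sup>2 \<le> B_mat l ?\<Phi> T \<bullet> B_mat m (dual_int ?\<Phi>) (perp S)"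
      unfolding q by (rule lq_pairing_lower_bound[OF l(1,2) e0, unfolded l(3)])
    then obtain k where k: "0 < k" and F: "\<And>S T. S \<in> Grass l \<Longrightarrow> T \<in> Grass l \<Longrightarrow>
      k * (norm (T - S))\<^sup>2 \<le> B_mat l ?\<Phi> T \<bullet> B_mat m (dual_int ?\<Phi>) (perp S)"
      by blast
    have "k * (norm (T - S))\<^sup>2 \<le> B_mat m ?\<Psi> T \<bullet> B_mat l (dual_int ?\<Psi>) (perp S)"
      if S: "S \<in> Grass m" and T: "T \<in> Grass m" for S T :: "((real, 'n) vec, 'n) vec"
    proof -
      have P: "perp S \<in> Grass l" "perp T \<in> Grass l" unfolding l_def using perp_in_Grass S T l(4) by auto
      have BT: "B_mat m (dual_int ?\<Phi>) T = B_mat m ?\<Psi> T"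
        by (rule B_mat_cong[OF _ T]) (use lq_anisotropy_perp l(4) in \<open>simp add: dual_int_def l_def\<close>)
      have perp_\<Phi>: "lq_anisotropy m q (perp P) = ?\<Phi> P" if "P \<in> Grass l" for P
        using lq_anisotropy_perp[OF that l(2), of q] unfolding l(3) .
      have BP: "B_mat l ?\<Phi> (perp S) = B_mat l (dual_int ?\<Psi>) (perp S)"
        by (rule B_mat_cong[OF _ P(1)]) (simp add: dual_int_def perp_\<Phi>)
      have "norm (perp S - perp T) = norm (T - S)" by (simp add: perp_def)
      then show ?thesis using F[OF P(2,1)] BT BP by (simp add: inner_commute)
    qed
    then show ?thesis using k unfolding l_def by blast
  qed
  then show ?thesis unfolding USAC_def using C1 by auto
qed

end
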